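(* $3$-Regular List Colouring is NP-complete when restricted to $(3P_1, P_1+P_2)$-free graphs.
   Context: A colouring of a graph $G=(V,E)$ is a map $c:V\to\{1,2,\dots\}$ with $c(u)\neq c(v)$ for every edge $uv$. A list assignment $L$ gives each vertex $u$ a set $L(u)\subseteq\{1,2,\dots\}$; a colouring $c$ respects $L$ if $c(u)\in L(u)$ for all $u$. $L$ is $3$-regular if $|L(u)|=3$ for every vertex $u$. The problem $3$-Regular List Colouring takes as input a graph $G$ with a $3$-regular list assignment $L$ and asks whether $G$ has a colouring respecting $L$. $P_n$ is the path on $n$ vertices; $G+H$ is the disjoint union of $G$ and $H$ and $kG$ is the disjoint union of $k$ copies of $G$. Thus $3P_1$ is the edgeless graph on three vertices and $P_1+P_2$ is the graph consisting of an edge and an isolated vertex. A graph is $(3P_1,P_1+P_2)$-free if it contains no induced subgraph isomorphic to $3P_1$ or to $P_1+P_2$. *)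

theory Defs
  imports Main "HOL-Computational_Algebra.Polynomial"
begin

section \<open>Graphs\<close>

type_synonym 'a graph = "'a set \<times> 'a set set"

abbreviation verts :: "'a graph \<Rightarrow> 'a set" where "verts \<equiv> fst"
abbreviation edges :: "'a graph \<Rightarrow> 'a set set" where "edges \<equiv> snd"

definition simple_graph :: "'a graph \<Rightarrow> bool" where
  "simple_graph G \<longleftrightarrow>
     finite (verts G) \<and> (\<forall>e \<in> edges G. e \<subseteq> verts G \<and> card e = 2)"

definition induced :: "'a graph \<Rightarrow> 'a set \<Rightarrow> 'a graph" where
  "induced G S = (S, {e \<in> edges G. e \<subseteq> S})"

definition isomorphic :: "'a graph \<Rightarrow> 'b graph \<Rightarrow> bool" where
  "isomorphic G H \<longleftrightarrow>
     (\<exists>f. bij_betw f (verts G) (verts H) \<and>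
          (\<forall>u \<in> verts G. \<forall>v \<in> verts G. {u, v} \<in> edges G \<longleftrightarrow> {f u, f v} \<in> edges H))"

definition free_of :: "'b graph \<Rightarrow> 'a graph \<Rightarrow> bool" where
  "free_of H G \<longleftrightarrow> (\<nexists>S. S \<subseteq> verts G \<and> isomorphic (induced G S) H)"

definition path_graph :: "nat \<Rightarrow> nat graph" where
  "path_graph n = ({..<n}, {{i, Suc i} | i. Suc i < n})"

definition disjoint_union :: "'a graph \<Rightarrow> 'b graph \<Rightarrow> ('a + 'b) graph" where
  "disjoint_union G H =
     (verts G <+> verts H, (`) Inl ` edges G \<union> (`) Inr ` edges H)"

definition copies :: "nat \<Rightarrow> 'a graph \<Rightarrow> (nat \<times> 'a) graph" where
  "copies k G = ({..<k} \<times> verts G, {Pair i ` e | i e. i < k \<and> e \<in> edges G})"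


section \<open>List colouring\<close>

definition colouring :: "'a graph \<Rightarrow> ('a \<Rightarrow> nat) \<Rightarrow> bool" where
  "colouring G c \<longleftrightarrow>
     (\<forall>u \<in> verts G. c u \<ge> 1) \<and>
     (\<forall>u \<in> verts G. \<forall>v \<in> verts G. {u, v} \<in> edges G \<longrightarrow> c u \<noteq> c v)"

definition list_assignment :: "'a graph \<Rightarrow> ('a \<Rightarrow> nat set) \<Rightarrow> bool" where
  "list_assignment G L \<longleftrightarrow> (\<forall>u \<in> verts G. L u \<subseteq> {1..})"

definition regular_lists :: "nat \<Rightarrow> 'a graph \<Rightarrow> ('a \<Rightarrow> nat set) \<Rightarrow> bool" where
  "regular_lists k G L \<longleftrightarrow> (\<forall>u \<in> verts G. finite (L u) \<and> card (L u) = k)"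

definition respects_lists :: "'a graph \<Rightarrow> ('a \<Rightarrow> nat) \<Rightarrow> ('a \<Rightarrow> nat set) \<Rightarrow> bool" where
  "respects_lists G c L \<longleftrightarrow> (\<forall>u \<in> verts G. c u \<in> L u)"


section \<open>Turing machines\<close>

text \<open>Deterministic machines with any fixed number of two-way infinite tapes. States and tape
  symbols are initial segments of the natural numbers; symbol 0 is the blank, and the bits
  \<^const>\<open>False\<close> and \<^const>\<open>True\<close> are the symbols 1 and 2.\<close>

datatype move = Left | Stay | Right

record tm =
  ntapes :: nat
  nsyms :: nat
  nstates :: nat
  start :: nat
  accept :: nat
  reject :: nat
  delta :: "nat \<Rightarrow> nat list \<Rightarrow> nat \<times> (nat \<times> move) list"

definition wf_tm :: "tm \<Rightarrow> bool" where
  "wf_tm M \<longleftrightarrow>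
     ntapes M \<ge> 1 \<and> nsyms M \<ge> 3 \<and>
     start M < nstates M \<and> accept M < nstates M \<and> reject M < nstates M \<and>
     accept M \<noteq> reject M \<and>
     (\<forall>q as. q < nstates M \<and> length as = ntapes M \<and> set as \<subseteq> {..<nsyms M} \<longrightarrow>
        (case delta M q as of (q', acts) \<Rightarrow>
           q' < nstates M \<and> length acts = ntapes M \<and> fst ` set acts \<subseteq> {..<nsyms M}))"

text \<open>A tape is a head position together with the cell contents.\<close>

type_synonym tape = "int \<times> (int \<Rightarrow> nat)"
type_synonym config = "nat \<times> tape list"

fun offset :: "move \<Rightarrow> int" where
  "offset Left = -1"
| "offset Stay = 0"
| "offset Right = 1"

fun act :: "nat \<times> move \<Rightarrow> tape \<Rightarrow> tape" where
  "act (a, m) (h, t) = (h + offset m, t(h := a))"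

definition halted :: "tm \<Rightarrow> config \<Rightarrow> bool" where
  "halted M c \<longleftrightarrow> fst c \<in> {accept M, reject M}"

fun step :: "tm \<Rightarrow> config \<Rightarrow> config" where
  "step M (q, ts) =
     (if halted M (q, ts) then (q, ts)
      else case delta M q (map (\<lambda>(h, t). t h) ts) of (q', acts) \<Rightarrow> (q', map2 act acts ts))"

definition word_cells :: "bool list \<Rightarrow> int \<Rightarrow> nat" where
  "word_cells x i =
     (if 0 \<le> i \<and> i < int (length x) then (if x ! nat i then 2 else 1) else 0)"

text \<open>The input words are written on the first tapes, one word per tape.\<close>

definition init_config :: "tm \<Rightarrow> bool list list \<Rightarrow> config" where
  "init_config M xs =
     (start M,
      map (\<lambda>j. (0, word_cells (if j < length xs then xs ! j else []))) [0..<ntapes M])"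

definition run :: "tm \<Rightarrow> bool list list \<Rightarrow> nat \<Rightarrow> config" where
  "run M xs t = (step M ^^ t) (init_config M xs)"


section \<open>NP-completeness\<close>

definition in_NP :: "bool list set \<Rightarrow> bool" where
  "in_NP A \<longleftrightarrow>
     (\<exists>M (p :: nat poly) (r :: nat poly).
        wf_tm M \<and> ntapes M \<ge> 2 \<and>
        (\<forall>x y. halted M (run M [x, y] (poly r (length x + length y)))) \<and>
        (\<forall>x. x \<in> A \<longleftrightarrow>
           (\<exists>y. length y \<le> poly p (length x) \<and>
                (\<exists>t. fst (run M [x, y] t) = accept M))))"

text \<open>The value of the function is the only thing left on the last tape when the machine halts.\<close>

definition polytime_computable :: "(bool list \<Rightarrow> bool list) \<Rightarrow> bool" where
  "polytime_computable f \<longleftrightarrow>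
     (\<exists>M (p :: nat poly). wf_tm M \<and>
        (\<forall>x. case run M [x] (poly p (length x)) of (q, ts) \<Rightarrow>
               q = accept M \<and> snd (last ts) = word_cells (f x)))"

definition polytime_reducible :: "bool list set \<Rightarrow> bool list set \<Rightarrow> bool" where
  "polytime_reducible A B \<longleftrightarrow>
     (\<exists>f. polytime_computable f \<and> (\<forall>x. x \<in> A \<longleftrightarrow> f x \<in> B))"

definition NP_hard :: "bool list set \<Rightarrow> bool" where
  "NP_hard B \<longleftrightarrow> (\<forall>A. in_NP A \<longrightarrow> polytime_reducible A B)"

definition NP_complete :: "bool list set \<Rightarrow> bool" where
  "NP_complete B \<longleftrightarrow> in_NP B \<and> NP_hard B"


section \<open>Regular list colouring as a language\<close>

text \<open>Instances are first written over a four-letter alphabet, then in binary with two bits per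
  letter. For each vertex \<open>u\<close> of a graph on \<open>{0, \<dots>, n - 1}\<close> we write its row of the adjacency
  matrix, then its admissible colours in binary (least significant bit first), in any order and
  each preceded by a comma, and finally a semicolon.\<close>

datatype letter = Bit bool | Comma | Semicolon

fun letter_code :: "letter \<Rightarrow> bool list" where
  "letter_code (Bit b) = [False, b]"
| "letter_code Comma = [True, False]"
| "letter_code Semicolon = [True, True]"

fun binary :: "nat \<Rightarrow> bool list" where
  "binary n = (if n = 0 then [] else odd n # binary (n div 2))"

declare binary.simps [simp del]

definition vertex_letters :: "nat \<Rightarrow> nat graph \<Rightarrow> nat list \<Rightarrow> nat \<Rightarrow> letter list" where
  "vertex_letters n G cs u =
     map (\<lambda>v. Bit ({u, v} \<in> edges G)) [0..<n] @
     concat (map (\<lambda>a. Comma # map Bit (binary a)) cs) @ [Semicolon]"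

definition encodes :: "bool list \<Rightarrow> nat graph \<Rightarrow> (nat \<Rightarrow> nat set) \<Rightarrow> bool" where
  "encodes w G L \<longleftrightarrow>
     (\<exists>n cs. verts G = {..<n} \<and>
        (\<forall>u < n. distinct (cs u) \<and> set (cs u) = L u) \<and>
        w = concat (map letter_code
              (concat (map (\<lambda>u. vertex_letters n G (cs u) u) [0..<n]))))"

text \<open>The yes-instances of the restriction of the problem to the graphs satisfying \<open>C\<close>.\<close>

definition regular_list_colouring :: "nat \<Rightarrow> (nat graph \<Rightarrow> bool) \<Rightarrow> bool list set" where
  "regular_list_colouring k C =
     {w. \<exists>G L. encodes w G L \<and> simple_graph G \<and> C G \<and>
               list_assignment G L \<and> regular_lists k G L \<and>
               (\<exists>c. colouring G c \<and> respects_lists G c L)}"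

end

theory Submission
  imports Defs
begin

text \<open>A graph of the class is a complete graph minus a matching, so in a colouring every colour is used
  by one vertex or by one pair of non-adjacent vertices, and colours behave like resources.
  A pair with lists \<open>{a, b}\<close> and \<open>{a, c}\<close> consumes either \<open>a\<close> or both \<open>b\<close> and \<open>c\<close>: if \<open>a\<close> is consumed
  elsewhere, \<open>b\<close> and \<open>c\<close> are consumed too. Chains of such pairs distribute the truth value of a variable
  to all clauses, and a vertex whose list consists of three such copies is a clause. Three vertices with
  the same list make its colours useless and allow short lists to be padded.
  The clauses come from the tableau of a nondeterministic computation, written relative to the heads
  so that one step depends on three facts only.

  All machines arise from one small language in which loop counters range over polynomial bounds and input
  bits are read at computed positions. Its programs run in polynomial time for reasons of syntax, so the
  certificate check and the reduction need only be written in that language.\<close>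

section \<open>Programs and Turing machines\<close>

text \<open>Two obstacles shape the proof. Three literals per clause and three colours per list
  leave little room, so everything flows in one direction: a chain only uses up the colours of one
  truth value, and the tableau only forces the facts of an actual run to hold. Surplus facts do no
  harm, so no clause has to say that a machine is in one state only or that a cell holds one symbol
  only. Colours are written in binary, while the counters of the language stay polynomial; a colour
  is therefore never held in a counter. A certificate stores colours as tables of digits, and the
  reduction names a colour by a numeral whose digits form three unary fields, which loops can print.
  Nor is the input ever parsed: the verifier prints the word that the certificate describes. Each
  variable and clause index gets seven pairs: two chain links, one pair that chooses the truth
  value, one for the clause, and three that exhaust the padding colours. A pair without a role at
  its index gets colours of its own, which keeps the numbering of the vertices uniform.\<close>

text \<open>A head position serves as a counter: after \<open>Init\<close>, which marks cell 0 of the counter tapes, only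
  the last tape is written. \<open>Whl j a P\<close> repeats \<open>P\<close> until tape \<open>j\<close> scans \<open>a\<close>.\<close>

datatype prog =
    Skip
  | Inc nat
  | Dec nat
  | Emit bool
  | Init
  | Seq prog prog (infixr ";;" 60)
  | IfS nat nat prog prog
  | Whl nat nat prog
  | Fail

definition idle :: "nat list \<Rightarrow> (nat \<times> move) list" where
  "idle as = map (\<lambda>a. (a, Stay)) as"

definition bit_symbol :: "bool \<Rightarrow> nat" where
  "bit_symbol b = (if b then 2 else 1)"

fun next_action :: "nat \<Rightarrow> prog list \<Rightarrow> nat list \<Rightarrow> prog list \<times> (nat \<times> move) list" where
  "next_action k [] as = ([], idle as)"
| "next_action k (Skip # s) as = (s, idle as)"
| "next_action k (Inc j # s) as = (s, (idle as)[j := (as ! j, Right)])"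
| "next_action k (Dec j # s) as = (s, (idle as)[j := (as ! j, Left)])"
| "next_action k (Emit b # s) as = (s, (idle as)[k - 1 := (bit_symbol b, Right)])"
| "next_action k (Init # s) as =
     (s, map (\<lambda>j. (if 2 \<le> j \<and> j < k - 1 then 1 else as ! j, Stay)) [0..<length as])"
| "next_action k (Seq P Q # s) as = (P # Q # s, idle as)"
| "next_action k (IfS j a P Q # s) as = ((if as ! j = a then P else Q) # s, idle as)"
| "next_action k (Whl j a P # s) as = (if as ! j = a then s else P # Whl j a P # s, idle as)"
| "next_action k (Fail # s) as = ([Fail], idle as)"

text \<open>The control state is the stack of the programs that remain to be executed.\<close>

definition mstep :: "nat \<Rightarrow> prog list \<times> tape list \<Rightarrow> prog list \<times> tape list" where
  "mstep k = (\<lambda>(s, ts). case next_action k s (map (\<lambda>(h, t). t h) ts) of (s', acts) \<Rightarrow> (s', map2 act acts ts))"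

text \<open>A finite superset of the stacks reachable from \<open>[P]\<close>. It is finite because
  at each level of the syntax at most one continuation waits below the stack of \<open>P\<close>:
  \<open>Q\<close> in \<open>P ;; Q\<close>, the loop itself in \<open>Whl\<close>.
  \<open>[]\<close> and \<open>[Fail]\<close> always belong to it, as they become the halting
  states.\<close>

fun stacks :: "prog \<Rightarrow> prog list set" where
  "stacks (Seq P Q) = {[Seq P Q]} \<union> (\<lambda>s. s @ [Q]) ` stacks P \<union> stacks Q"
| "stacks (IfS j a P Q) = {[IfS j a P Q]} \<union> stacks P \<union> stacks Q"
| "stacks (Whl j a P) = {[], [Fail], [Whl j a P]} \<union> (\<lambda>s. s @ [Whl j a P]) ` stacks P"
| "stacks P = {[], [Fail], [P]}"

lemma finite_stacks: "finite (stacks P)"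
  by (induction P) auto

lemma self_in_stacks: "[P] \<in> stacks P"
  by (induction P) auto

lemma end_in_stacks: "[] \<in> stacks P" "[Fail] \<in> stacks P"
  by (induction P) auto

text \<open>Only the top of the stack is inspected, so what lies below is carried along;
  \<open>Fail\<close> alone discards it, which accounts for the second alternative.\<close>

lemma next_action_append:
  assumes "s \<noteq> []"
  shows "fst (next_action k (s @ s') as) = fst (next_action k s as) @ s' \<or> fst (next_action k (s @ s') as) = [Fail]"
proof -
  obtain P u where "s = P # u" using assms by (cases s) auto
  then show ?thesis by (cases P) auto
qed

lemma next_action_in_stacks: "s \<in> stacks P \<Longrightarrow> fst (next_action k s as) \<in> stacks P"
proof (induction P arbitrary: s)
  case (Seq P Q)
  consider "s = [Seq P Q]" | u where "u \<in> stacks P" "s = u @ [Q]" | "s \<in> stacks Q"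
    using Seq.prems by auto
  then show ?case
  proof cases
    case 1
    then show ?thesis using self_in_stacks[of P] by force
  next
    case 2
    show ?thesis
    proof (cases "u = []")
      case True
      then show ?thesis using 2 Seq.IH(2)[OF self_in_stacks] by auto
    next
      case False
      from next_action_append[OF this, of k "[Q]" as] 2 Seq.IH(1)[OF 2(1)] show ?thesis
        by (auto simp: end_in_stacks)
    qed
  next
    case 3
    then show ?thesis using Seq.IH(2) by auto
  qed
next
  case (IfS j a P Q)
  then consider "s = [IfS j a P Q]" | "s \<in> stacks P" | "s \<in> stacks Q" by auto
  then show ?case using IfS.IH self_in_stacks by cases auto
next
  case (Whl j a P)
  then consider "s = []" | "s = [Fail]" | "s = [Whl j a P]" | u where "u \<in> stacks P" "s = u @ [Whl j a P]"
    by auto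
  then show ?case
  proof cases
    case 3
    then show ?thesis using self_in_stacks[of P] by force
  next
    case 4
    show ?thesis
    proof (cases "u = []")
      case True
      then show ?thesis using 4 self_in_stacks[of P] by force
    next
      case False
      from next_action_append[OF this, of k "[Whl j a P]" as] 4 Whl.IH[OF 4(1)] show ?thesis
        by auto
    qed
  qed auto
qed auto

lemma next_action_wf:
  assumes "length as = k" "set as \<subseteq> {..<3}"
  shows "length (snd (next_action k s as)) = k" "fst ` set (snd (next_action k s as)) \<subseteq> {..<3}"
proof -
  have idle: "length (idle as) = k" "fst ` set (idle as) \<subseteq> {..<3}"
    using assms by (auto simp: idle_def)
  have upd: "fst ` set ((idle as)[j := (c, m)]) \<subseteq> {..<3}" if "j < k \<longrightarrow> c < 3" for j c m
  proof (cases "j < k")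
    case True
    have c: "c < 3" using that True by simp
    show ?thesis
    proof
      fix b assume "b \<in> fst ` set ((idle as)[j := (c, m)])"
      then have "b \<in> fst ` insert (c, m) (set (idle as))"
        using set_update_subset_insert by fast
      then show "b \<in> {..<3}" using idle(2) c by auto
    qed
  next
    case False
    then show ?thesis using idle by (simp add: list_update_beyond)
  qed
  have nth: "j < k \<longrightarrow> as ! j < 3" for j using assms by (metis lessThan_iff nth_mem subsetD)
  show "length (snd (next_action k s as)) = k"
    by (cases "(k, s, as)" rule: next_action.cases) (use idle assms in auto)
  show "fst ` set (snd (next_action k s as)) \<subseteq> {..<3}"
  proof (cases "(k, s, as)" rule: next_action.cases)
    case (5 k b s as)
    then show ?thesis using upd[of "k - 1" "bit_symbol b"] by (auto simp: bit_symbol_def)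
  next
    case (6 k s as)
    then show ?thesis using nth assms by auto
  qed (use idle upd nth in auto)
qed

lemma act_idle: "act (snd T (fst T), Stay) T = T"
  by (cases T) simp

lemma map2_idle: "map2 act (idle (map (\<lambda>(h, t). t h) ts)) ts = ts"
  by (rule nth_equalityI) (auto simp: idle_def split_beta act_idle)

abbreviation init_tapes :: "nat \<Rightarrow> bool list list \<Rightarrow> tape list" where
  "init_tapes k xs \<equiv> map (\<lambda>j. (0, word_cells (if j < length xs then xs ! j else []))) [0..<k]"

text \<open>Numbering \<open>stacks P\<close> makes each stack a state. On \<open>[]\<close> and
  \<open>[Fail]\<close>, the accepting and the rejecting state, \<open>mstep\<close> merely idles,
  and \<open>step\<close> leaves a halted configuration alone; hence both runs agree at every time,
  also after halting.\<close>

lemma machine_exists: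
  assumes "k \<ge> 1"
  shows "\<exists>M enc. wf_tm M \<and> ntapes M = k \<and> enc [] = accept M \<and> enc [Fail] = reject M \<and>
    (\<forall>xs t. run M xs t = map_prod enc id
       ((mstep k ^^ t) ([P], init_tapes k xs)))"
proof -
  obtain enc where enc: "bij_betw enc (stacks P) {..<card (stacks P)}"
    using finite_stacks[of P] ex_bij_betw_finite_nat[of "stacks P"] by (metis atLeast0LessThan)
  define N where "N = card (stacks P)"
  define dec where "dec = inv_into (stacks P) enc"
  have enc_less: "enc s < N" if "s \<in> stacks P" for s
    using enc that bij_betwE by (auto simp: N_def)
  have dec_in: "dec q \<in> stacks P" if "q < N" for q
    using enc that unfolding dec_def N_def by (metis bij_betw_def inv_into_into lessThan_iff)
  have dec_enc: "dec (enc s) = s" if "s \<in> stacks P" for s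
    using enc that unfolding dec_def by (simp add: bij_betw_def)
  define M where "M = \<lparr>ntapes = k, nsyms = 3, nstates = N, start = enc [P], accept = enc [],
     reject = enc [Fail], delta = (\<lambda>q as. map_prod enc id (next_action k (dec q) as))\<rparr>"
  have inj: "enc s = enc s' \<longleftrightarrow> s = s'" if "s \<in> stacks P" "s' \<in> stacks P" for s s'
    using dec_enc that by metis
  have wf: "wf_tm M"
    using assms next_action_wf[of _ k] next_action_in_stacks[OF dec_in] enc_less self_in_stacks end_in_stacks
    by (auto simp: wf_tm_def M_def inj map_prod_def split_beta)
  have stp: "step M (enc s, ts) = map_prod enc id (mstep k (s, ts))" if "s \<in> stacks P" for s ts
  proof (cases "s = [] \<or> s = [Fail]")
    case True
    then show ?thesis using that by (auto simp: mstep_def halted_def M_def map2_idle)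
  next
    case False
    then have "\<not> halted M (enc s, ts)" using that by (auto simp: halted_def M_def inj end_in_stacks)
    then show ?thesis using that by (auto simp: mstep_def M_def dec_enc split_beta)
  qed
  have "run M xs t = map_prod enc id ((mstep k ^^ t)
       ([P], init_tapes k xs)) \<and>
      fst ((mstep k ^^ t) ([P], init_tapes k xs)) \<in> stacks P"
    (is "run M xs t = map_prod enc id (?c t) \<and> _ ") for xs t
  proof (induction t)
    case 0
    then show ?case by (simp add: run_def init_config_def M_def self_in_stacks)
  next
    case (Suc t)
    obtain s ts where c: "?c t = (s, ts)" by force
    have "fst (mstep k (s, ts)) \<in> stacks P"
      using Suc c next_action_in_stacks[of s P k] by (auto simp: mstep_def split_beta)
    then show ?case using Suc c stp[of s ts] by (simp add: run_def id_def del: step.simps)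
  qed
  then show ?thesis using wf by (intro exI[of _ M] exI[of _ enc]) (auto simp: M_def)
qed

section \<open>Execution of programs on counters, with running time\<close>

definition cells :: "bool list \<Rightarrow> bool list \<Rightarrow> nat \<Rightarrow> int \<Rightarrow> nat" where
  "cells x y j = (if j = 0 then word_cells x else if j = 1 then word_cells y
     else (\<lambda>i. if i = 0 then 1 else 0))"

type_synonym cstate = "(nat \<Rightarrow> nat) \<times> bool list"

definition scan :: "bool list \<Rightarrow> bool list \<Rightarrow> (nat \<Rightarrow> nat) \<Rightarrow> nat \<Rightarrow> nat" where
  "scan x y h j = cells x y j (int (h j))"

text \<open>The cost is the exact number of machine steps. \<open>exec_Dec\<close> demands a
  positive counter, so heads stay on nonnegative cells and natural numbers describe them.
  \<open>Init\<close> and \<open>Fail\<close> have no rule: they occur only before and after the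
  part that is analysed in this way.\<close>

inductive exec :: "bool list \<Rightarrow> bool list \<Rightarrow> prog \<Rightarrow> cstate \<Rightarrow> nat \<Rightarrow> cstate \<Rightarrow> bool" for x y where
  exec_Skip: "exec x y Skip \<sigma> 1 \<sigma>"
| exec_Inc: "exec x y (Inc j) (h, w) 1 (h(j := Suc (h j)), w)"
| exec_Dec: "h j > 0 \<Longrightarrow> exec x y (Dec j) (h, w) 1 (h(j := h j - 1), w)"
| exec_Emit: "exec x y (Emit b) (h, w) 1 (h, w @ [b])"
| exec_Seq: "exec x y P \<sigma> m \<sigma>' \<Longrightarrow> exec x y Q \<sigma>' n \<sigma>'' \<Longrightarrow> exec x y (P ;; Q) \<sigma> (Suc (m + n)) \<sigma>''"
| exec_IfT: "scan x y (fst \<sigma>) j = a \<Longrightarrow> exec x y P \<sigma> n \<sigma>' \<Longrightarrow> exec x y (IfS j a P Q) \<sigma> (Suc n) \<sigma>'"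
| exec_IfF: "scan x y (fst \<sigma>) j \<noteq> a \<Longrightarrow> exec x y Q \<sigma> n \<sigma>' \<Longrightarrow> exec x y (IfS j a P Q) \<sigma> (Suc n) \<sigma>'"
| exec_WhlT: "scan x y (fst \<sigma>) j = a \<Longrightarrow> exec x y (Whl j a P) \<sigma> 1 \<sigma>"
| exec_WhlF: "scan x y (fst \<sigma>) j \<noteq> a \<Longrightarrow> exec x y P \<sigma> m \<sigma>' \<Longrightarrow> exec x y (Whl j a P) \<sigma>' n \<sigma>'' \<Longrightarrow>
    exec x y (Whl j a P) \<sigma> (Suc (m + n)) \<sigma>''"

fun valid :: "nat \<Rightarrow> prog \<Rightarrow> bool" where
  "valid k (Inc j) \<longleftrightarrow> j < k - 1"
| "valid k (Dec j) \<longleftrightarrow> j < k - 1"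
| "valid k (Seq P Q) \<longleftrightarrow> valid k P \<and> valid k Q"
| "valid k (IfS j a P Q) \<longleftrightarrow> j < k - 1 \<and> valid k P \<and> valid k Q"
| "valid k (Whl j a P) \<longleftrightarrow> j < k - 1 \<and> valid k P"
| "valid k _ \<longleftrightarrow> True"

lemma valid_mono: "valid k P \<Longrightarrow> k \<le> k' \<Longrightarrow> valid k' P"
  by (induction P) auto

text \<open>A program names finitely many counters, so the number of tapes can be chosen after the
  program, with the last tape kept for the output.\<close>

lemma valid_exists: "\<exists>k \<ge> k0. valid k P"
proof (induction P)
  case (Inc j) show ?case by (auto intro: exI[of _ "k0 + j + 2"])
next
  case (Dec j) show ?case by (auto intro: exI[of _ "k0 + j + 2"])
next
  case (Seq P Q)
  then obtain k k' where "k \<ge> k0" "valid k P" "k' \<ge> k0" "valid k' Q" by auto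
  then show ?case using valid_mono[of k P "k + k'"] valid_mono[of k' Q "k + k'"]
    by (auto intro!: exI[of _ "k + k'"])
next
  case (IfS j a P Q)
  then obtain k k' where "k \<ge> k0" "valid k P" "k' \<ge> k0" "valid k' Q" by auto
  then show ?case using valid_mono[of k P "k + k' + j + 2"] valid_mono[of k' Q "k + k' + j + 2"]
    by (auto intro!: exI[of _ "k + k' + j + 2"])
next
  case (Whl j a P)
  then obtain k where "k \<ge> k0" "valid k P" by auto
  then show ?case using valid_mono[of k P "k + j + 2"]
    by (auto intro!: exI[of _ "k + j + 2"])
qed auto

definition tapes :: "bool list \<Rightarrow> bool list \<Rightarrow> nat \<Rightarrow> cstate \<Rightarrow> tape list" where
  "tapes x y k \<sigma> = map (\<lambda>j. if j = k - 1 then (int (length (snd \<sigma>)), word_cells (snd \<sigma>))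
     else (int (fst \<sigma> j), cells x y j)) [0..<k]"

lemma scan_tapes:
  assumes "j < k - 1"
  shows "map (\<lambda>(h, t). t h) (tapes x y k \<sigma>) ! j = scan x y (fst \<sigma>) j"
  using assms by (simp add: tapes_def scan_def)

lemma map2_idle_upd:
  assumes "j < length ts"
  shows "map2 act ((idle (map (\<lambda>(h, t). t h) ts))[j := a]) ts = ts[j := act a (ts ! j)]"
proof (rule nth_equalityI)
  fix i assume "i < length (map2 act ((idle (map (\<lambda>(h, t). t h) ts))[j := a]) ts)"
  then have "i < length ts" by (simp add: idle_def)
  then show "map2 act ((idle (map (\<lambda>(h, t). t h) ts))[j := a]) ts ! i = ts[j := act a (ts ! j)] ! i"
    using act_idle[of "ts ! i"] assms by (auto simp: idle_def nth_list_update split_beta)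
qed (simp add: idle_def)

lemma mstep_Inc:
  assumes "j < k - 1"
  shows "mstep k (Inc j # s, tapes x y k (h, w)) = (s, tapes x y k (h(j := Suc (h j)), w))"
proof -
  have "map2 act ((idle (map (\<lambda>(h, t). t h) (tapes x y k (h, w))))[j :=
      (map (\<lambda>(h, t). t h) (tapes x y k (h, w)) ! j, Right)]) (tapes x y k (h, w)) = tapes x y k (h(j := Suc (h j)), w)"
    using assms by (subst map2_idle_upd) (auto simp: tapes_def intro!: nth_equalityI simp: nth_list_update)
  then show ?thesis by (simp add: mstep_def)
qed

lemma mstep_Dec:
  assumes "j < k - 1" "h j > 0"
  shows "mstep k (Dec j # s, tapes x y k (h, w)) = (s, tapes x y k (h(j := h j - 1), w))"
proof -
  have "map2 act ((idle (map (\<lambda>(h, t). t h) (tapes x y k (h, w))))[j :=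
      (map (\<lambda>(h, t). t h) (tapes x y k (h, w)) ! j, Left)]) (tapes x y k (h, w)) = tapes x y k (h(j := h j - 1), w)"
    using assms by (subst map2_idle_upd) (auto simp: tapes_def intro!: nth_equalityI simp: nth_list_update)
  then show ?thesis by (simp add: mstep_def)
qed

lemma word_cells_snoc: "(word_cells w)(int (length w) := bit_symbol b) = word_cells (w @ [b])"
  by (auto simp: word_cells_def bit_symbol_def fun_eq_iff nth_append nat_less_iff)

lemma mstep_Emit:
  assumes "k \<ge> 1"
  shows "mstep k (Emit b # s, tapes x y k (h, w)) = (s, tapes x y k (h, w @ [b]))"
proof -
  have "map2 act ((idle (map (\<lambda>(h, t). t h) (tapes x y k (h, w))))[k - 1 :=
      (bit_symbol b, Right)]) (tapes x y k (h, w)) = tapes x y k (h, w @ [b])"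
    using assms by (subst map2_idle_upd)
      (auto simp: tapes_def word_cells_snoc intro!: nth_equalityI simp: nth_list_update)
  then show ?thesis by (simp add: mstep_def)
qed

text \<open>The stack below \<open>P\<close> is arbitrary: in the cases of \<open>;;\<close> and
  \<open>Whl\<close> it holds the pending continuation while the first part runs.\<close>

lemma exec_mstep:
  "exec x y P \<sigma> n \<sigma>' \<Longrightarrow> valid k P \<Longrightarrow> k \<ge> 1 \<Longrightarrow>
   (mstep k ^^ n) (P # s, tapes x y k \<sigma>) = (s, tapes x y k \<sigma>')"
proof (induction arbitrary: s rule: exec.induct)
  case (exec_Skip \<sigma>)
  then show ?case by (simp add: mstep_def map2_idle)
next
  case (exec_Inc j h w)
  then show ?case by (simp add: mstep_Inc)
next
  case (exec_Dec h j w)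
  then show ?case by (simp add: mstep_Dec)
next
  case (exec_Emit b h w)
  then show ?case by (simp add: mstep_Emit)
next
  case (exec_Seq P \<sigma> m \<sigma>' Q n \<sigma>'')
  have "mstep k ((P ;; Q) # s, tapes x y k \<sigma>) = (P # Q # s, tapes x y k \<sigma>)"
    by (simp add: mstep_def map2_idle)
  then show ?case using exec_Seq
    by (simp add: funpow_swap1 funpow_add add.commute[of m])
next
  case (exec_IfT \<sigma> j a P n \<sigma>' Q)
  have "mstep k (IfS j a P Q # s, tapes x y k \<sigma>) = (P # s, tapes x y k \<sigma>)"
    using exec_IfT by (simp add: mstep_def map2_idle scan_tapes del: nth_map)
  then show ?case using exec_IfT by (simp add: funpow_swap1)
next
  case (exec_IfF \<sigma> j a Q n \<sigma>' P)
  have "mstep k (IfS j a P Q # s, tapes x y k \<sigma>) = (Q # s, tapes x y k \<sigma>)"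
    using exec_IfF by (simp add: mstep_def map2_idle scan_tapes del: nth_map)
  then show ?case using exec_IfF by (simp add: funpow_swap1)
next
  case (exec_WhlT \<sigma> j a P)
  then show ?case by (simp add: mstep_def map2_idle scan_tapes del: nth_map)
next
  case (exec_WhlF \<sigma> j a P m \<sigma>' n \<sigma>'')
  have "mstep k (Whl j a P # s, tapes x y k \<sigma>) = (P # Whl j a P # s, tapes x y k \<sigma>)"
    using exec_WhlF by (simp add: mstep_def map2_idle scan_tapes del: nth_map)
  then show ?case using exec_WhlF
    by (simp add: funpow_swap1 funpow_add add.commute[of m])
qed

lemma mstep_Init:
  assumes "k \<ge> 3" "xs = [x, y] \<or> xs = [x] \<and> y = []"
  shows "mstep k (Init # s, init_tapes k xs) =
    (s, tapes x y k (\<lambda>_. 0, []))"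
proof -
  define w where "w j = (if j < length xs then xs ! j else [])" for j
  have w: "w 0 = x" "w (Suc 0) = y" "2 \<le> j \<Longrightarrow> w j = []" for j
    using assms(2) by (auto simp: w_def)
  have marker: "(word_cells [])(0 := 1) = (\<lambda>i. if i = 0 then 1 else 0)"
    by (auto simp: word_cells_def)
  have "map2 act (snd (next_action k (Init # s) (map (\<lambda>(h, t). t h) (map (\<lambda>j. (0, word_cells (w j))) [0..<k]))))
     (map (\<lambda>j. (0, word_cells (w j))) [0..<k]) = tapes x y k (\<lambda>_. 0, [])"
  proof (rule nth_equalityI)
    fix j assume "j < length (map2 act (snd (next_action k (Init # s) (map (\<lambda>(h, t). t h) (map (\<lambda>j. (0, word_cells (w j))) [0..<k]))))
     (map (\<lambda>j. (0, word_cells (w j))) [0..<k]))"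
    then have "j < k" by simp
    then have "map2 act (snd (next_action k (Init # s) (map (\<lambda>(h, t). t h) (map (\<lambda>j. (0, word_cells (w j))) [0..<k]))))
     (map (\<lambda>j. (0, word_cells (w j))) [0..<k]) ! j =
      act (if 2 \<le> j \<and> j < k - 1 then 1 else word_cells (w j) 0, Stay) (0, word_cells (w j))"
      by simp
    also have "\<dots> = (0, if 2 \<le> j \<and> j < k - 1 then (\<lambda>i. if i = 0 then 1 else 0) else word_cells (w j))"
      using w(3)[of j] marker by auto
    also have "\<dots> = tapes x y k (\<lambda>_. 0, []) ! j"
    proof -
      consider "j = 0" | "j = 1" | "2 \<le> j" "j < k - 1" | "2 \<le> j" "j = k - 1"
        using \<open>j < k\<close> by linarith
      then show ?thesis
        using w \<open>j < k\<close> \<open>k \<ge> 3\<close> by cases (auto simp: tapes_def cells_def)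
    qed
    finally show "map2 act (snd (next_action k (Init # s) (map (\<lambda>(h, t). t h) (map (\<lambda>j. (0, word_cells (w j))) [0..<k]))))
     (map (\<lambda>j. (0, word_cells (w j))) [0..<k]) ! j = tapes x y k (\<lambda>_. 0, []) ! j" .
  qed (simp add: tapes_def)
  then show ?thesis unfolding w_def by (simp add: mstep_def cong: if_cong)
qed

definition upd :: "nat \<Rightarrow> nat \<Rightarrow> cstate \<Rightarrow> cstate" where
  "upd j v \<sigma> = ((fst \<sigma>)(j := v), snd \<sigma>)"

lemma upd_simps [simp]: "upd j v (h, w) = (h(j := v), w)" "fst (upd j v \<sigma>) = (fst \<sigma>)(j := v)"
    "snd (upd j v \<sigma>) = snd \<sigma>"
  by (simp_all add: upd_def)

text \<open>Bounds instead of exact costs, so that both branches of a conditional and all iterations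
  of a loop can share one number.\<close>

definition runs :: "bool list \<Rightarrow> bool list \<Rightarrow> prog \<Rightarrow> cstate \<Rightarrow> nat \<Rightarrow> cstate \<Rightarrow> bool" where
  "runs x y P \<sigma> n \<sigma>' \<longleftrightarrow> (\<exists>m \<le> n. exec x y P \<sigma> m \<sigma>')"

lemma runs_mono: "runs x y P \<sigma> n \<sigma>' \<Longrightarrow> n \<le> m \<Longrightarrow> runs x y P \<sigma> m \<sigma>'"
  unfolding runs_def by (meson order_trans)

lemma runs_cong: "runs x y P \<sigma> n \<sigma>' \<Longrightarrow> \<sigma>' = \<tau> \<Longrightarrow> n \<le> m \<Longrightarrow> runs x y P \<sigma> m \<tau>"
  using runs_mono by blast

lemma runs_Seq:
  assumes "runs x y P \<sigma> m \<sigma>'" "runs x y Q \<sigma>' n \<sigma>''"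
  shows "runs x y (P ;; Q) \<sigma> (m + n + 1) \<sigma>''"
proof -
  obtain m' n' where "m' \<le> m" "exec x y P \<sigma> m' \<sigma>'" "n' \<le> n" "exec x y Q \<sigma>' n' \<sigma>''"
    using assms unfolding runs_def by blast
  then show ?thesis unfolding runs_def
    by (intro exI[of _ "Suc (m' + n')"]) (auto intro: exec_Seq)
qed

lemma runs_Skip: "runs x y Skip \<sigma> 1 \<sigma>"
  unfolding runs_def using exec_Skip by blast

lemma runs_Inc: "runs x y (Inc j) (h, w) 1 (h(j := Suc (h j)), w)"
  unfolding runs_def using exec_Inc by blast

lemma runs_Dec: "h j > 0 \<Longrightarrow> runs x y (Dec j) (h, w) 1 (h(j := h j - 1), w)"
  unfolding runs_def using exec_Dec by blast

lemma runs_Emit: "runs x y (Emit b) (h, w) 1 (h, w @ [b])"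
  unfolding runs_def using exec_Emit by blast

lemma runs_IfT: "scan x y (fst \<sigma>) j = a \<Longrightarrow> runs x y P \<sigma> n \<sigma>' \<Longrightarrow> runs x y (IfS j a P Q) \<sigma> (Suc n) \<sigma>'"
  unfolding runs_def using exec_IfT by (metis Suc_le_mono)

lemma runs_IfF: "scan x y (fst \<sigma>) j \<noteq> a \<Longrightarrow> runs x y Q \<sigma> n \<sigma>' \<Longrightarrow> runs x y (IfS j a P Q) \<sigma> (Suc n) \<sigma>'"
  unfolding runs_def using exec_IfF by (metis Suc_le_mono)

lemma runs_WhlT: "scan x y (fst \<sigma>) j = a \<Longrightarrow> runs x y (Whl j a P) \<sigma> 1 \<sigma>"
  unfolding runs_def using exec_WhlT by blast

lemma runs_WhlF:
  assumes "scan x y (fst \<sigma>) j \<noteq> a" "runs x y P \<sigma> m \<sigma>'" "runs x y (Whl j a P) \<sigma>' n \<sigma>''"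
  shows "runs x y (Whl j a P) \<sigma> (m + n + 1) \<sigma>''"
proof -
  obtain m' n' where "m' \<le> m" "exec x y P \<sigma> m' \<sigma>'" "n' \<le> n" "exec x y (Whl j a P) \<sigma>' n' \<sigma>''"
    using assms unfolding runs_def by blast
  then show ?thesis unfolding runs_def using assms(1)
    by (intro exI[of _ "Suc (m' + n')"]) (auto intro: exec_WhlF)
qed

lemma runs_Whl:
  assumes "\<And>i. i < N \<Longrightarrow> scan x y (fst (S i)) j \<noteq> a" "scan x y (fst (S N)) j = a"
    and "\<And>i. i < N \<Longrightarrow> runs x y P (S i) n (S (Suc i))"
  shows "runs x y (Whl j a P) (S 0) (N * (n + 1) + 1) (S N)"
proof -
  \<comment> \<open>\<open>d\<close> counts the iterations that remain: a loop unfolds at its front,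
    so the induction runs backwards from the final state.\<close>
  have "runs x y (Whl j a P) (S (N - d)) (d * (n + 1) + 1) (S N)" if "d \<le> N" for d
    using that
  proof (induction d)
    case 0
    then show ?case using runs_WhlT assms(2) by simp
  next
    case (Suc d)
    then have s: "Suc (N - Suc d) = N - d" by simp
    have "runs x y (Whl j a P) (S (N - Suc d)) (n + (d * (n + 1) + 1) + 1) (S N)"
      by (rule runs_WhlF[of _ _ _ _ _ _ _ "S (N - d)"])
        (use Suc assms(1,3)[of "N - Suc d"] s in auto)
    then show ?case by (simp add: algebra_simps)
  qed
  from this[of N] show ?thesis by simp
qed

definition Loop :: "nat \<Rightarrow> prog \<Rightarrow> prog" where
  "Loop j P = Whl j 1 (Dec j ;; P)"

lemma scan_counter: "2 \<le> j \<Longrightarrow> scan x y h j = (if h j = 0 then 1 else 0)"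
  by (simp add: scan_def cells_def)

text \<open>\<open>S i\<close> is the state before the test of iteration \<open>i\<close>. The
  counter is lowered before the body runs, so the body starts from \<open>S i\<close> with
  \<open>N - Suc i\<close> in the counter. The 3 pays for the test, the sequencing and
  \<open>Dec\<close>.\<close>

lemma runs_Loop:
  assumes "2 \<le> j" "\<And>i. i \<le> N \<Longrightarrow> fst (S i) j = N - i"
    and "\<And>i. i < N \<Longrightarrow> runs x y P (upd j (N - Suc i) (S i)) n (S (Suc i))"
    and "\<sigma> = S 0" "\<tau> = S N"
  shows "runs x y (Loop j P) \<sigma> (N * (n + 3) + 1) \<tau>"
proof -
  have "runs x y (Dec j ;; P) (S i) (n + 2) (S (Suc i))" if "i < N" for i
  proof -
    obtain h w where S: "S i = (h, w)" by force
    then have "h j = N - i" using assms(2)[of i] that by simp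
    then have "runs x y (Dec j) (S i) 1 (upd j (N - Suc i) (S i))"
      using runs_Dec[of h j x y w] that S by simp
    from runs_Seq[OF this assms(3)[OF that]] show ?thesis by (simp add: add.commute)
  qed
  then have "runs x y (Loop j P) (S 0) (N * (n + 2 + 1) + 1) (S N)"
    unfolding Loop_def using assms(1,2) by (intro runs_Whl) (auto simp: scan_counter)
  moreover have "n + 2 + 1 = n + 3" by simp
  ultimately show ?thesis using assms(4,5) by metis
qed

lemma runs_Loop_Inc:
  assumes "2 \<le> a" "a \<noteq> b"
  shows "runs x y (Loop a (Inc b)) (h, w) (h a * 4 + 1) (h(a := 0, b := h b + h a), w)"
  by (rule runs_cong[OF runs_Loop[where N = "h a" and S = "\<lambda>i. (h(a := h a - i, b := h b + i), w)" and n = 1]])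
    (use assms in \<open>auto simp: fun_eq_iff intro!: runs_cong[OF runs_Inc]\<close>)

lemma runs_Loop_Skip:
  assumes "2 \<le> a"
  shows "runs x y (Loop a Skip) (h, w) (h a * 4 + 1) (h(a := 0), w)"
  by (rule runs_cong[OF runs_Loop[where N = "h a" and S = "\<lambda>i. (h(a := h a - i), w)" and n = 1]])
    (use assms in \<open>auto simp: fun_eq_iff intro!: runs_cong[OF runs_Skip]\<close>)

lemma runs_Loop_Dec:
  assumes "2 \<le> a" "a \<noteq> b" "h a \<le> h b"
  shows "runs x y (Loop a (Dec b)) (h, w) (h a * 4 + 1) (h(a := 0, b := h b - h a), w)"
  by (rule runs_cong[OF runs_Loop[where N = "h a" and S = "\<lambda>i. (h(a := h a - i, b := h b - i), w)" and n = 1]])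
    (use assms in \<open>auto simp: fun_eq_iff intro!: runs_cong[OF runs_Dec]\<close>)

lemma runs_Loop_Inc_Inc:
  assumes "2 \<le> a" "a \<noteq> b" "a \<noteq> c" "b \<noteq> c"
  shows "runs x y (Loop a (Inc b ;; Inc c)) (h, w) (h a * 6 + 1) (h(a := 0, b := h b + h a, c := h c + h a), w)"
proof -
  have "runs x y (Inc b ;; Inc c) (g, w) 3 (g(b := Suc (g b), c := Suc (g c)), w)" for g
    by (rule runs_cong[OF runs_Seq[OF runs_Inc runs_Inc]]) (use assms in auto)
  note body = this[unfolded One_nat_def]
  show ?thesis
    by (intro runs_cong[OF runs_Loop[where N = "h a" and S = "\<lambda>i. (h(a := h a - i, b := h b + i, c := h c + i), w)" and n = 3]])
      (use assms in \<open>auto simp: fun_eq_iff intro!: runs_cong[OF body]\<close>)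
qed

lemma runs_Loop_Sub:
  assumes "2 \<le> a" "2 \<le> b" "a \<noteq> b"
  shows "runs x y (Loop a (IfS b 1 Skip (Dec b))) (h, w) (h a * 5 + 1) (h(a := 0, b := h b - h a), w)"
proof -
  have "runs x y (IfS b 1 Skip (Dec b)) (g, w) 2 (g(b := g b - 1), w)" for g
  proof (cases "g b = 0")
    case True
    then show ?thesis using assms runs_IfT[OF _ runs_Skip, of x y "(g, w)" b 1 "Dec b"]
      by (simp add: scan_counter fun_upd_idem numeral_2_eq_2)
  next
    case False
    then show ?thesis using assms runs_IfF[OF _ runs_Dec, of x y g w b 1]
      by (simp add: scan_counter numeral_2_eq_2)
  qed
  note body = this[unfolded One_nat_def]
  show ?thesis
    by (intro runs_cong[OF runs_Loop[where N = "h a" and S = "\<lambda>i. (h(a := h a - i, b := h b - i), w)" and n = 2]])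
      (use assms in \<open>auto simp: fun_eq_iff intro!: runs_cong[OF body]\<close>)
qed

text \<open>Repeated addition: each pass empties \<open>c\<close> into \<open>b\<close> and the
  scratch counter \<open>e\<close>, and then restores \<open>c\<close> from
  \<open>e\<close>.\<close>

lemma runs_Loop_Mul:
  assumes "2 \<le> a" "2 \<le> c" "2 \<le> e" "distinct [a, b, c, e]" "h e = 0"
  shows "runs x y (Loop a (Loop c (Inc b ;; Inc e) ;; Loop e (Inc c))) (h, w)
    (h a * (h c * 10 + 6) + 1) (h(a := 0, b := h b + h a * h c), w)"
proof -
  have "runs x y (Loop c (Inc b ;; Inc e) ;; Loop e (Inc c)) (g, w) (g c * 10 + 3) (g(b := g b + g c), w)"
    if "g e = 0" for g
    by (rule runs_cong[OF runs_Seq[OF runs_Loop_Inc_Inc runs_Loop_Inc]])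
      (use assms that in \<open>auto simp: fun_eq_iff\<close>)
  note body = this[unfolded One_nat_def]
  show ?thesis
    by (intro runs_cong[OF runs_Loop[where N = "h a" and S = "\<lambda>i. (h(a := h a - i, b := h b + i * h c), w)" and n = "h c * 10 + 3"]])
      (use assms in \<open>auto simp: fun_eq_iff intro!: runs_cong[OF body]\<close>)
qed

section \<open>Arithmetic expressions evaluated on counters\<close>

datatype expr = V nat | C nat | Add expr expr | Mul expr expr | Sub expr expr

fun val :: "(nat \<Rightarrow> nat) \<Rightarrow> expr \<Rightarrow> nat" where
  "val \<rho> (V v) = \<rho> v"
| "val \<rho> (C n) = n"
| "val \<rho> (Add e f) = val \<rho> e + val \<rho> f"
| "val \<rho> (Mul e f) = val \<rho> e * val \<rho> f"
| "val \<rho> (Sub e f) = val \<rho> e - val \<rho> f"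

text \<open>Counter \<open>4 + 2 * v\<close> holds the variable \<open>v\<close>, and \<open>5 + 2 * v\<close> the number of iterations left to the loop that
  binds it; counter 2 receives truth values and counter 3 counts mismatches. The value of an expression is
  delivered in the counter \<open>b\<close>. At depth \<open>d\<close> only the variables below \<open>d\<close> are bound, and others count as 0.\<close>

fun comp_expr :: "nat \<Rightarrow> nat \<Rightarrow> expr \<Rightarrow> prog" where
  "comp_expr d b (V v) = (if v < d then Loop (4 + 2 * v) (Inc b ;; Inc (b + 1)) ;; Loop (b + 1) (Inc (4 + 2 * v)) else Skip)"
| "comp_expr d b (C n) = ((;;) (Inc b) ^^ n) Skip"
| "comp_expr d b (Add e f) = comp_expr d b e ;; comp_expr d (b + 1) f ;; Loop (b + 1) (Inc b)"
| "comp_expr d b (Sub e f) = comp_expr d b e ;; comp_expr d (b + 1) f ;; Loop (b + 1) (IfS b 1 Skip (Dec b))"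
| "comp_expr d b (Mul e f) = comp_expr d (b + 1) e ;; comp_expr d (b + 2) f ;;
     Loop (b + 1) (Loop (b + 2) (Inc b ;; Inc (b + 3)) ;; Loop (b + 3) (Inc (b + 2))) ;; Loop (b + 2) Skip"

definition vars :: "nat \<Rightarrow> (nat \<Rightarrow> nat) \<Rightarrow> (nat \<Rightarrow> nat) \<Rightarrow> bool" where
  "vars d \<rho> h \<longleftrightarrow> (\<forall>v < d. h (4 + 2 * v) = \<rho> v) \<and> (\<forall>v \<ge> d. \<rho> v = 0)"

lemma poly_nat_mono: "m \<le> n \<Longrightarrow> poly p m \<le> poly (p :: nat poly) n"
  by (induction p) (auto intro!: add_mono mult_mono)

text \<open>The polynomial depends on the expression alone. It bounds the value as well as the time,
  since values become the iteration counts of loops.\<close>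

definition expr_spec :: "expr \<Rightarrow> nat poly \<Rightarrow> bool" where
  "expr_spec e p \<longleftrightarrow>
     (\<forall>x y d b h w \<rho> B. vars d \<rho> h \<longrightarrow> 4 + 2 * d \<le> b \<longrightarrow> (\<forall>j \<ge> b. h j = 0) \<longrightarrow> (\<forall>v. \<rho> v \<le> B) \<longrightarrow>
        runs x y (comp_expr d b e) (h, w) (poly p B) (h(b := val \<rho> e), w) \<and> val \<rho> e \<le> poly p B)"

lemma expr_specI:
  assumes "\<And>x y d b h w \<rho> B. vars d \<rho> h \<Longrightarrow> 4 + 2 * d \<le> b \<Longrightarrow> (\<And>j. j \<ge> b \<Longrightarrow> h j = 0) \<Longrightarrow> (\<And>v. \<rho> v \<le> B) \<Longrightarrow>
        runs x y (comp_expr d b e) (h, w) (poly p B) (h(b := val \<rho> e), w) \<and> val \<rho> e \<le> poly p B"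
  shows "\<exists>p. expr_spec e p"
  using assms unfolding expr_spec_def by blast

lemma expr_specD:
  assumes "expr_spec e p" "vars d \<rho> h" "4 + 2 * d \<le> b" "\<And>j. j \<ge> b \<Longrightarrow> h j = 0" "\<And>v. \<rho> v \<le> B"
  shows "runs x y (comp_expr d b e) (h, w) (poly p B) (h(b := val \<rho> e), w)" "val \<rho> e \<le> poly p B"
  using assms unfolding expr_spec_def by blast+

lemma vars_upd [simp]: "4 + 2 * d \<le> b \<Longrightarrow> vars d \<rho> (h(b := v)) = vars d \<rho> h"
  by (auto simp: vars_def)

lemma expr_spec_exists: "\<exists>p. expr_spec e p"
proof (induction e)
  case (V v)
  show ?case
  proof (rule expr_specI[where p = "[:10, 10:]"], rule conjI)
    fix x y d b h w \<rho> B
    assume *: "vars d \<rho> h" "4 + 2 * d \<le> b" "\<And>j. j \<ge> b \<Longrightarrow> h j = 0" "\<And>v. \<rho> v \<le> B"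
    have B: "\<rho> v \<le> B" using * by blast
    have hz: "h b = 0" "h (Suc b) = 0" using *(3) by auto
    show "val \<rho> (V v) \<le> poly [:10, 10:] B" using B by simp
    show "runs x y (comp_expr d b (V v)) (h, w) (poly [:10, 10:] B) (h(b := val \<rho> (V v)), w)"
    proof (cases "v < d")
      case True
      then have h: "h (4 + 2 * v) = \<rho> v" using * by (simp add: vars_def)
      then show ?thesis
        using True *(2) B hz
        by (auto simp: fun_eq_iff intro!: runs_cong[OF runs_Seq[OF runs_Loop_Inc_Inc runs_Loop_Inc]])
    next
      case False
      then have "\<rho> v = 0" using * by (simp add: vars_def)
      then show ?thesis using hz False by (auto intro!: runs_cong[OF runs_Skip])
    qed
  qed
next
  case (C n)
  have rn: "runs x y (((;;) (Inc b) ^^ n) Skip) (h, w) (2 * n + 1) (h(b := h b + n), w)" for x y b h w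
  proof (induction n arbitrary: h)
    case 0
    then show ?case using runs_Skip by simp
  next
    case (Suc n)
    show ?case unfolding funpow.simps comp_apply
      by (rule runs_cong[OF runs_Seq[OF runs_Inc Suc.IH]]) (auto simp: fun_eq_iff)
  qed
  show ?case
  proof (rule expr_specI[where p = "[:2 * n + 1:]"], rule conjI)
    fix x y w and d b B :: nat and h \<rho> :: "nat \<Rightarrow> nat"
    assume "\<And>j. j \<ge> b \<Longrightarrow> h j = 0"
    from this[OF order.refl] have "h b = 0" .
    then show "runs x y (comp_expr d b (C n)) (h, w) (poly [:2 * n + 1:] B) (h(b := val \<rho> (C n)), w)"
      using rn[of x y b h w] by simp
  qed simp
next
  case (Add e f)
  then obtain p q where p: "expr_spec e p" and q: "expr_spec f q"
    by blast
  show ?case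
  proof (rule expr_specI[where p = "p + smult 5 q + [:3:]"], rule conjI)
    fix x y d b h w \<rho> B
    assume *: "vars d \<rho> h" "4 + 2 * d \<le> b" "\<And>j. j \<ge> b \<Longrightarrow> h j = 0" "\<And>v. \<rho> v \<le> B"
    note 1 = expr_specD[OF p *]
    have 2: "runs x y (comp_expr d (b + 1) f) (h(b := val \<rho> e), w) (poly q B) (h(b := val \<rho> e, b + 1 := val \<rho> f), w)"
      by (rule expr_specD[OF q]) (use * in auto)
    note 3 = expr_specD(2)[OF q *]
    have b: "2 \<le> b" and hz: "h b = 0" "h (Suc b) = 0" using * by auto
    show "runs x y (comp_expr d b (Add e f)) (h, w) (poly (p + smult 5 q + [:3:]) B) (h(b := val \<rho> (Add e f)), w)"
      unfolding comp_expr.simps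
      by (rule runs_cong[OF runs_Seq[OF 1(1) runs_Seq[OF 2 runs_Loop_Inc]]])
        (use b hz 1(2) 3 in \<open>auto simp: fun_eq_iff\<close>)
    show "val \<rho> (Add e f) \<le> poly (p + smult 5 q + [:3:]) B" using 1(2) 3 by simp
  qed
next
  case (Sub e f)
  then obtain p q where p: "expr_spec e p" and q: "expr_spec f q"
    by blast
  show ?case
  proof (rule expr_specI[where p = "p + smult 6 q + [:3:]"], rule conjI)
    fix x y d b h w \<rho> B
    assume *: "vars d \<rho> h" "4 + 2 * d \<le> b" "\<And>j. j \<ge> b \<Longrightarrow> h j = 0" "\<And>v. \<rho> v \<le> B"
    note 1 = expr_specD[OF p *]
    have 2: "runs x y (comp_expr d (b + 1) f) (h(b := val \<rho> e), w) (poly q B) (h(b := val \<rho> e, b + 1 := val \<rho> f), w)"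
      by (rule expr_specD[OF q]) (use * in auto)
    note 3 = expr_specD(2)[OF q *]
    have b: "2 \<le> b" and hz: "h b = 0" "h (Suc b) = 0" using * by auto
    show "runs x y (comp_expr d b (Sub e f)) (h, w) (poly (p + smult 6 q + [:3:]) B) (h(b := val \<rho> (Sub e f)), w)"
      unfolding comp_expr.simps
      by (rule runs_cong[OF runs_Seq[OF 1(1) runs_Seq[OF 2 runs_Loop_Sub]]])
        (use b hz 1(2) 3 in \<open>auto simp: fun_eq_iff\<close>)
    show "val \<rho> (Sub e f) \<le> poly (p + smult 6 q + [:3:]) B" using 1(2) 3 by simp
  qed
next
  case (Mul e f)
  then obtain p q where p: "expr_spec e p" and q: "expr_spec f q"
    by blast
  \<comment> \<open>The product is the cost of the multiplication loop with the value bounds put in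
    for its factors; the linear part pays for evaluating both factors and for clearing
    \<open>b + 2\<close>.\<close>
  define r where "r = p + smult 5 q + p * (smult 10 q + [:6:]) + [:5:]"
  show ?case
  proof (rule expr_specI[where p = r], rule conjI)
    fix x y d b h w \<rho> B
    assume *: "vars d \<rho> h" "4 + 2 * d \<le> b" "\<And>j. j \<ge> b \<Longrightarrow> h j = 0" "\<And>v. \<rho> v \<le> B"
    have 1: "runs x y (comp_expr d (b + 1) e) (h, w) (poly p B) (h(b + 1 := val \<rho> e), w)"
      by (rule expr_specD[OF p]) (use * in auto)
    have 2: "runs x y (comp_expr d (b + 2) f) (h(b + 1 := val \<rho> e), w) (poly q B) (h(b + 1 := val \<rho> e, b + 2 := val \<rho> f), w)"
      by (rule expr_specD[OF q]) (use * in auto)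
    note v = expr_specD(2)[OF p *] expr_specD(2)[OF q *]
    have 3: "val \<rho> e * (val \<rho> f * 10 + 6) \<le> poly p B * (poly q B * 10 + 6)" "val \<rho> e * val \<rho> f \<le> poly p B * poly q B"
      using v by (auto intro!: mult_mono)
    have b: "2 \<le> b" and hz: "h b = 0" "h (Suc b) = 0" "h (Suc (Suc b)) = 0" "h (b + 3) = 0" using * by auto
    have 4: "runs x y (Loop (b + 1) (Loop (b + 2) (Inc b ;; Inc (b + 3)) ;; Loop (b + 3) (Inc (b + 2))))
      (h(b + 1 := val \<rho> e, b + 2 := val \<rho> f), w) (val \<rho> e * (val \<rho> f * 10 + 6) + 1)
      (h(b := val \<rho> e * val \<rho> f, b + 2 := val \<rho> f), w)"
      by (rule runs_cong[OF runs_Loop_Mul]) (use b hz in \<open>auto simp: fun_eq_iff\<close>)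
    have 5: "runs x y (Loop (b + 2) Skip) (h(b := val \<rho> e * val \<rho> f, b + 2 := val \<rho> f), w) (val \<rho> f * 4 + 1)
      (h(b := val \<rho> e * val \<rho> f), w)"
      by (rule runs_cong[OF runs_Loop_Skip]) (use b hz in \<open>auto simp: fun_eq_iff\<close>)
    show "runs x y (comp_expr d b (Mul e f)) (h, w) (poly r B) (h(b := val \<rho> (Mul e f)), w)"
      unfolding comp_expr.simps val.simps
    proof (rule runs_mono[OF runs_Seq[OF 1 runs_Seq[OF 2 runs_Seq[OF 4 5]]]])
      show "poly p B + (poly q B + (val \<rho> e * (val \<rho> f * 10 + 6) + 1 + (val \<rho> f * 4 + 1) + 1) + 1) + 1 \<le> poly r B"
        using 3(1) v by (simp add: r_def mult.commute)
    qed
    show "val \<rho> (Mul e f) \<le> poly r B" using 3 by (simp add: r_def algebra_simps)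
  qed
qed

section \<open>A language with bounded loops\<close>

datatype form = NZ expr | InputBit expr | Neg form | Conj form form | Exi expr form

text \<open>A binder at depth \<open>d\<close> binds the variable \<open>d\<close>.\<close>

fun holds :: "(nat \<Rightarrow> bool) \<Rightarrow> nat \<Rightarrow> (nat \<Rightarrow> nat) \<Rightarrow> form \<Rightarrow> bool" where
  "holds z d \<rho> (NZ e) \<longleftrightarrow> val \<rho> e \<noteq> 0"
| "holds z d \<rho> (InputBit e) \<longleftrightarrow> z (val \<rho> e)"
| "holds z d \<rho> (Neg \<phi>) \<longleftrightarrow> \<not> holds z d \<rho> \<phi>"
| "holds z d \<rho> (Conj \<phi> \<psi>) \<longleftrightarrow> holds z d \<rho> \<phi> \<and> holds z d \<rho> \<psi>"
| "holds z d \<rho> (Exi e \<phi>) \<longleftrightarrow> (\<exists>i < val \<rho> e. holds z (Suc d) (\<rho>(d := i)) \<phi>)"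

text \<open>For \<open>InputBit\<close> the head of tape \<open>rd\<close> walks to the position and
  back, and \<open>b + 1\<close> remembers the distance. For \<open>Exi\<close> the body is skipped
  once a witness has been found, so counter 2 is 0 whenever the body starts.\<close>

fun comp_form :: "nat \<Rightarrow> nat \<Rightarrow> form \<Rightarrow> prog" where
  "comp_form rd d (NZ e) = (let b = 4 + 2 * d in
     comp_expr d b e ;; IfS b 1 Skip (Inc 2) ;; Loop b Skip)"
| "comp_form rd d (InputBit e) = (let b = 4 + 2 * d in
     comp_expr d b e ;; Loop b (Inc rd ;; Inc (b + 1)) ;; IfS rd 2 (Inc 2) Skip ;; Loop (b + 1) (Dec rd))"
| "comp_form rd d (Neg \<phi>) = comp_form rd d \<phi> ;; IfS 2 1 (Inc 2) (Dec 2)"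
| "comp_form rd d (Conj \<phi> \<psi>) = comp_form rd d \<phi> ;; IfS 2 1 Skip (Dec 2 ;; comp_form rd d \<psi>)"
| "comp_form rd d (Exi e \<phi>) = (let b = 4 + 2 * d in
     comp_expr d (b + 1) e ;; Loop (b + 1) (IfS 2 1 (comp_form rd (Suc d) \<phi>) Skip ;; Inc b) ;; Loop b Skip)"

definition good :: "nat \<Rightarrow> nat \<Rightarrow> (nat \<Rightarrow> nat) \<Rightarrow> (nat \<Rightarrow> nat) \<Rightarrow> bool" where
  "good rd d \<rho> h \<longleftrightarrow> vars d \<rho> h \<and> h rd = 0 \<and> h 2 = 0 \<and> (\<forall>j \<ge> 4 + 2 * d. h j = 0)"

definition bit_at :: "bool list \<Rightarrow> nat \<Rightarrow> bool" where
  "bit_at z i \<longleftrightarrow> i < length z \<and> z ! i"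

definition input :: "nat \<Rightarrow> bool list \<Rightarrow> bool list \<Rightarrow> bool list" where
  "input rd x y = (if rd = 0 then x else y)"

lemma scan_input: "rd < 2 \<Longrightarrow> scan x y h rd = 2 \<longleftrightarrow> bit_at (input rd x y) (h rd)"
  by (cases "rd = 0") (auto simp: scan_def cells_def word_cells_def bit_at_def input_def)

definition form_spec :: "nat \<Rightarrow> form \<Rightarrow> nat poly \<Rightarrow> bool" where
  "form_spec rd \<phi> p \<longleftrightarrow>
     (\<forall>x y d h w \<rho> B. good rd d \<rho> h \<longrightarrow> (\<forall>v. \<rho> v \<le> B) \<longrightarrow>
        runs x y (comp_form rd d \<phi>) (h, w) (poly p B) (h(2 := of_bool (holds (bit_at (input rd x y)) d \<rho> \<phi>)), w))"

lemma form_specI: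
  assumes "\<And>x y d h w \<rho> B. good rd d \<rho> h \<Longrightarrow> (\<And>v. \<rho> v \<le> B) \<Longrightarrow>
        runs x y (comp_form rd d \<phi>) (h, w) (poly p B) (h(2 := of_bool (holds (bit_at (input rd x y)) d \<rho> \<phi>)), w)"
  shows "\<exists>p. form_spec rd \<phi> p"
  using assms unfolding form_spec_def by blast

lemma form_specD:
  assumes "form_spec rd \<phi> p" "good rd d \<rho> h" "\<And>v. \<rho> v \<le> B"
  shows "runs x y (comp_form rd d \<phi>) (h, w) (poly p B) (h(2 := of_bool (holds (bit_at (input rd x y)) d \<rho> \<phi>)), w)"
  using assms unfolding form_spec_def by blast

lemma goodD:
  assumes "good rd d \<rho> h"
  shows "vars d \<rho> h" "h rd = 0" "h 2 = 0" "\<And>j. j \<ge> 4 + 2 * d \<Longrightarrow> h j = 0"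
  using assms by (auto simp: good_def)

lemma goodI:
  assumes "vars d \<rho> h" "h rd = 0" "h 2 = 0" "\<And>j. j \<ge> 4 + 2 * d \<Longrightarrow> h j = 0"
  shows "good rd d \<rho> h"
  using assms by (auto simp: good_def)

lemma vars_Suc: "vars d \<rho> h \<Longrightarrow> h (4 + 2 * d) = i \<Longrightarrow> vars (Suc d) (\<rho>(d := i)) h"
  by (auto simp: vars_def less_Suc_eq)

lemma form_spec_exists:
  assumes rd: "rd < 2"
  shows "\<exists>p. form_spec rd \<phi> p"
proof (induction \<phi>)
  case (NZ e)
  obtain p where p: "expr_spec e p" using expr_spec_exists by blast
  show ?case
  proof (rule form_specI[where p = "smult 5 p + [:5:]"])
    fix x y d h w \<rho> B
    assume *: "good rd d \<rho> h" "\<And>v. \<rho> v \<le> B"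
    define b where "b = 4 + 2 * d"
    have b: "4 \<le> b" by (simp add: b_def)
    have hz: "h 2 = 0" "h b = 0" using goodD[OF *(1)] by (auto simp: b_def)
    have 1: "runs x y (comp_expr d b e) (h, w) (poly p B) (h(b := val \<rho> e), w)"
      by (rule expr_specD[OF p goodD(1)[OF *(1)]]) (use * goodD(4) in \<open>auto simp: b_def\<close>)
    have v: "val \<rho> e \<le> poly p B"
      by (rule expr_specD[OF p goodD(1)[OF *(1)]]) (use * goodD(4) in \<open>auto\<close>)
    have 2: "runs x y (IfS b 1 Skip (Inc 2)) (h(b := val \<rho> e), w) 2 (h(b := val \<rho> e, 2 := of_bool (val \<rho> e \<noteq> 0)), w)"
    proof (cases "val \<rho> e = 0")
      case True
      then show ?thesis using hz b
        by (intro runs_cong[OF runs_IfT[OF _ runs_Skip]]) (auto simp: scan_counter fun_eq_iff)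
    next
      case False
      then show ?thesis using hz b
        by (intro runs_cong[OF runs_IfF[OF _ runs_Inc]]) (auto simp: scan_counter fun_eq_iff)
    qed
    show "runs x y (comp_form rd d (NZ e)) (h, w) (poly (smult 5 p + [:5:]) B)
        (h(2 := of_bool (holds (bit_at (input rd x y)) d \<rho> (NZ e))), w)"
      unfolding comp_form.simps Let_def b_def[symmetric]
      by (rule runs_cong[OF runs_Seq[OF 1 runs_Seq[OF 2 runs_Loop_Skip]]])
        (use v b hz in \<open>auto simp: fun_eq_iff\<close>)
  qed
next
  case (InputBit e)
  obtain p where p: "expr_spec e p" using expr_spec_exists by blast
  show ?case
  proof (rule form_specI[where p = "smult 11 p + [:9:]"])
    fix x y d h w \<rho> B
    assume *: "good rd d \<rho> h" "\<And>v. \<rho> v \<le> B"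
    define b where "b = 4 + 2 * d"
    have b: "4 \<le> b" by (simp add: b_def)
    have hz: "h rd = 0" "h 2 = 0" "h b = 0" "h (Suc b) = 0" using goodD[OF *(1)] by (auto simp: b_def)
    have 1: "runs x y (comp_expr d b e) (h, w) (poly p B) (h(b := val \<rho> e), w)"
      by (rule expr_specD[OF p goodD(1)[OF *(1)]]) (use * goodD(4) in \<open>auto simp: b_def\<close>)
    have v: "val \<rho> e \<le> poly p B"
      by (rule expr_specD[OF p goodD(1)[OF *(1)]]) (use * goodD(4) in \<open>auto\<close>)
    let ?h = "h(rd := val \<rho> e, b + 1 := val \<rho> e)"
    have 2: "runs x y (Loop b (Inc rd ;; Inc (b + 1))) (h(b := val \<rho> e), w) (val \<rho> e * 6 + 1) (?h, w)"
      by (rule runs_cong[OF runs_Loop_Inc_Inc]) (use b rd hz in \<open>auto simp: fun_eq_iff\<close>)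
    have 3: "runs x y (IfS rd 2 (Inc 2) Skip) (?h, w) 2
       (?h(2 := of_bool (bit_at (input rd x y) (val \<rho> e))), w)"
    proof (cases "bit_at (input rd x y) (val \<rho> e)")
      case True
      then show ?thesis using hz b rd
        by (intro runs_cong[OF runs_IfT[OF _ runs_Inc]]) (auto simp: scan_input fun_eq_iff)
    next
      case False
      then show ?thesis using hz b rd
        by (intro runs_cong[OF runs_IfF[OF _ runs_Skip]]) (auto simp: scan_input fun_eq_iff)
    qed
    show "runs x y (comp_form rd d (InputBit e)) (h, w) (poly (smult 11 p + [:9:]) B)
        (h(2 := of_bool (holds (bit_at (input rd x y)) d \<rho> (InputBit e))), w)"
      unfolding comp_form.simps Let_def b_def[symmetric]
      by (rule runs_cong[OF runs_Seq[OF 1 runs_Seq[OF 2 runs_Seq[OF 3 runs_Loop_Dec]]]])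
        (use v b rd hz in \<open>auto simp: fun_eq_iff\<close>)
  qed
next
  case (Neg \<phi>)
  then obtain p where p: "form_spec rd \<phi> p" by blast
  show ?case
  proof (rule form_specI[where p = "p + [:3:]"])
    fix x y d h w \<rho> B
    assume *: "good rd d \<rho> h" "\<And>v. \<rho> v \<le> B"
    let ?b = "holds (bit_at (input rd x y)) d \<rho> \<phi>"
    note 1 = form_specD[OF p *, of x y w]
    have 2: "runs x y (IfS 2 1 (Inc 2) (Dec 2)) (h(2 := of_bool ?b), w) 2 (h(2 := of_bool (\<not> ?b)), w)"
    proof (cases ?b)
      case True
      then show ?thesis
        by (intro runs_cong[OF runs_IfF[OF _ runs_Dec]]) (auto simp: scan_counter fun_eq_iff)
    next
      case False
      then show ?thesis
        by (intro runs_cong[OF runs_IfT[OF _ runs_Inc]]) (auto simp: scan_counter fun_eq_iff)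
    qed
    show "runs x y (comp_form rd d (Neg \<phi>)) (h, w) (poly (p + [:3:]) B)
        (h(2 := of_bool (holds (bit_at (input rd x y)) d \<rho> (Neg \<phi>))), w)"
      unfolding comp_form.simps
      by (rule runs_cong[OF runs_Seq[OF 1 2]]) auto
  qed
next
  case (Conj \<phi> \<psi>)
  then obtain p q where p: "form_spec rd \<phi> p" and q: "form_spec rd \<psi> q" by blast
  show ?case
  proof (rule form_specI[where p = "p + q + [:4:]"])
    fix x y d h w \<rho> B
    assume *: "good rd d \<rho> h" "\<And>v. \<rho> v \<le> B"
    let ?b = "holds (bit_at (input rd x y)) d \<rho> \<phi>"
    let ?c = "holds (bit_at (input rd x y)) d \<rho> \<psi>"
    note 1 = form_specD[OF p *, of x y w]
    note q' = form_specD[OF q *, of x y w]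
    have h: "h(2 := 0) = h" using goodD(3)[OF *(1)] by (auto simp: fun_eq_iff)
    have 2: "runs x y (IfS 2 1 Skip (Dec 2 ;; comp_form rd d \<psi>)) (h(2 := of_bool ?b), w) (poly q B + 3) (h(2 := of_bool (?b \<and> ?c)), w)"
    proof (cases ?b)
      case True
      have "runs x y (Dec 2) (h(2 := 1), w) 1 (h, w)"
        by (rule runs_cong[OF runs_Dec]) (use h in auto)
      from runs_Seq[OF this q'] show ?thesis using True
        by (intro runs_cong[OF runs_IfF]) (auto simp: scan_counter)
    next
      case False
      then show ?thesis
        by (intro runs_cong[OF runs_IfT[OF _ runs_Skip]]) (auto simp: scan_counter fun_eq_iff)
    qed
    show "runs x y (comp_form rd d (Conj \<phi> \<psi>)) (h, w) (poly (p + q + [:4:]) B)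
        (h(2 := of_bool (holds (bit_at (input rd x y)) d \<rho> (Conj \<phi> \<psi>))), w)"
      unfolding comp_form.simps
      by (rule runs_cong[OF runs_Seq[OF 1 2]]) auto
  qed
next
  case (Exi e \<phi>)
  then obtain q where q: "form_spec rd \<phi> q" by blast
  obtain p where p: "expr_spec e p" using expr_spec_exists by blast
  \<comment> \<open>Inside the binder the new variable is below \<open>poly p B\<close>, so all
    variables are bounded by \<open>B + poly p B\<close>; hence the composition. The depth of
    nesting is fixed by the syntax, so the bound remains a polynomial.\<close>
  define r where "r = smult 5 p + [:5:] + p * (pcompose q ([:0, 1:] + p) + [:7:])"
  show ?case
  proof (rule form_specI[where p = r])
    fix x y d h w \<rho> B
    assume *: "good rd d \<rho> h" "\<And>v. \<rho> v \<le> B"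
    define b where "b = 4 + 2 * d"
    define N where "N = val \<rho> e"
    have b: "4 \<le> b" by (simp add: b_def)
    have hz: "h 2 = 0" "h rd = 0" "h b = 0" "h (Suc b) = 0" using goodD[OF *(1)] by (auto simp: b_def)
    have 1: "runs x y (comp_expr d (b + 1) e) (h, w) (poly p B) (h(b + 1 := N), w)"
      unfolding N_def
      by (rule expr_specD[OF p goodD(1)[OF *(1)]]) (use * goodD(4) in \<open>auto simp: b_def\<close>)
    have N: "N \<le> poly p B" unfolding N_def
      by (rule expr_specD[OF p goodD(1)[OF *(1)]]) (use * goodD(4) in \<open>auto\<close>)
    define t where "t i = holds (bit_at (input rd x y)) (Suc d) (\<rho>(d := i)) \<phi>" for i
    define Q where "Q = poly q (B + poly p B)"
    let ?H = "\<lambda>i. h(b := i, b + 1 := N - i, 2 := of_bool (\<exists>i' < i. t i'))"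
    have body: "runs x y (IfS 2 1 (comp_form rd (Suc d) \<phi>) Skip ;; Inc b) (upd (b + 1) (N - Suc i) (?H i, w)) (Q + 4) (?H (Suc i), w)"
      if i: "i < N" for i
    proof -
      let ?h = "h(b := i, b + 1 := N - Suc i, 2 := of_bool (\<exists>i' < i. t i'))"
      have "runs x y (IfS 2 1 (comp_form rd (Suc d) \<phi>) Skip) (?h, w) (Q + 2) (?h(2 := of_bool (\<exists>i' < Suc i. t i')), w)"
      proof (cases "\<exists>i' < i. t i'")
        case True
        then show ?thesis
          by (intro runs_cong[OF runs_IfF[OF _ runs_Skip]]) (auto simp: scan_counter fun_eq_iff less_Suc_eq)
      next
        case False
        have "runs x y (comp_form rd (Suc d) \<phi>) (?h, w) (poly q (B + N)) (?h(2 := of_bool (t i)), w)"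
          unfolding t_def[of i]
        proof (rule form_specD[OF q])
          show "good rd (Suc d) (\<rho>(d := i)) ?h"
          proof (rule goodI)
            have "vars d \<rho> ?h" using goodD(1)[OF *(1)] b by (auto simp: vars_def b_def)
            then show "vars (Suc d) (\<rho>(d := i)) ?h" by (rule vars_Suc) (simp add: b_def)
            show "?h j = 0" if "j \<ge> 4 + 2 * Suc d" for j
              using that goodD(4)[OF *(1), of j] b by (auto simp: b_def)
          qed (use False rd b hz in auto)
          show "(\<rho>(d := i)) v \<le> B + N" for v using *(2)[of v] i by auto
        qed
        moreover have "poly q (B + N) \<le> Q" unfolding Q_def using N by (intro poly_nat_mono) simp
        ultimately show ?thesis using False
          by (intro runs_cong[OF runs_IfT]) (auto simp: scan_counter fun_eq_iff less_Suc_eq)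
      qed
      note 5 = runs_Seq[OF this runs_Inc]
      have S: "upd (b + 1) (N - Suc i) (?H i, w) = (?h, w)" using b by (auto simp: fun_eq_iff)
      show ?thesis unfolding S
        by (rule runs_cong[OF 5]) (use b in \<open>auto simp: fun_eq_iff\<close>)
    qed
    have 2: "runs x y (Loop (b + 1) (IfS 2 1 (comp_form rd (Suc d) \<phi>) Skip ;; Inc b)) (h(b + 1 := N), w) (N * (Q + 7) + 1)
       (?H N, w)"
      by (rule runs_cong[OF runs_Loop[where N = N and S = "\<lambda>i. (?H i, w)" and n = "Q + 4"]])
        (use body b hz in \<open>auto simp: fun_eq_iff simp del: upd_simps(1)\<close>)
    have 3: "runs x y (Loop b Skip) (?H N, w) (N * 4 + 1) (h(2 := of_bool (holds (bit_at (input rd x y)) d \<rho> (Exi e \<phi>))), w)"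
      by (rule runs_cong[OF runs_Loop_Skip]) (use b hz in \<open>auto simp: fun_eq_iff N_def[symmetric] t_def\<close>)
    have r: "poly r B = 5 * poly p B + 5 + poly p B * (Q + 7)"
      by (simp add: r_def Q_def poly_pcompose)
    have M: "N * (Q + 7) \<le> poly p B * (Q + 7)" using N by (intro mult_mono) auto
    show "runs x y (comp_form rd d (Exi e \<phi>)) (h, w) (poly r B)
       (h(2 := of_bool (holds (bit_at (input rd x y)) d \<rho> (Exi e \<phi>))), w)"
      unfolding comp_form.simps Let_def b_def[symmetric]
      by (rule runs_mono[OF runs_Seq[OF 1 runs_Seq[OF 2 3]]]) (use M N r in linarith)
  qed
qed

section \<open>Words generated by bounded loops\<close>

datatype emission = Nop | Out bool | Sq emission emission | Cond form emission emission | For expr emission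

fun emitted :: "(nat \<Rightarrow> bool) \<Rightarrow> nat \<Rightarrow> (nat \<Rightarrow> nat) \<Rightarrow> emission \<Rightarrow> bool list" where
  "emitted z d \<rho> Nop = []"
| "emitted z d \<rho> (Out b) = [b]"
| "emitted z d \<rho> (Sq P Q) = emitted z d \<rho> P @ emitted z d \<rho> Q"
| "emitted z d \<rho> (Cond \<phi> P Q) = (if holds z d \<rho> \<phi> then emitted z d \<rho> P else emitted z d \<rho> Q)"
| "emitted z d \<rho> (For e P) = concat (map (\<lambda>i. emitted z (Suc d) (\<rho>(d := i)) P) [0..<val \<rho> e])"

text \<open>One compiler serves two purposes: an emitted bit is written in one interpretation and
  compared with the input in the other. By \<open>keep\<close> the treatment of a bit leaves alone
  the tape \<open>rd\<close>, the truth value and all loop registers; by \<open>comm\<close> it does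
  not depend on those registers, so it commutes with the bookkeeping of loops.\<close>

locale emitter =
  fixes rd :: nat and em :: "bool \<Rightarrow> prog" and eff :: "bool list \<Rightarrow> bool list \<Rightarrow> bool \<Rightarrow> cstate \<Rightarrow> cstate"
    and T :: nat
  assumes rd: "rd < 2"
    and keep: "j = rd \<or> j = 2 \<or> j \<ge> 4 \<Longrightarrow> fst (eff x y b \<sigma>) j = fst \<sigma> j"
    and comm: "j \<ge> 4 \<Longrightarrow> eff x y b (upd j v \<sigma>) = upd j v (eff x y b \<sigma>)"
    and run: "runs x y (em b) \<sigma> T (eff x y b \<sigma>)"
begin

fun comp_emission :: "nat \<Rightarrow> emission \<Rightarrow> prog" where
  "comp_emission d Nop = Skip"
| "comp_emission d (Out b) = em b"
| "comp_emission d (Sq P Q) = comp_emission d P ;; comp_emission d Q"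
| "comp_emission d (Cond \<phi> P Q) = comp_form rd d \<phi> ;; IfS 2 1 (comp_emission d Q) (Dec 2 ;; comp_emission d P)"
| "comp_emission d (For e P) = (let b = 4 + 2 * d in
     comp_expr d (b + 1) e ;; Loop (b + 1) (comp_emission (Suc d) P ;; Inc b) ;; Loop b Skip)"

lemma keep_fold: "j = rd \<or> j = 2 \<or> j \<ge> 4 \<Longrightarrow> fst (fold (eff x y) bs \<sigma>) j = fst \<sigma> j"
  by (induction bs arbitrary: \<sigma>) (auto simp: keep)

lemma comm_fold: "j \<ge> 4 \<Longrightarrow> fold (eff x y) bs (upd j v \<sigma>) = upd j v (fold (eff x y) bs \<sigma>)"
  by (induction bs arbitrary: \<sigma>) (auto simp: comm)

lemma good_fold: "good rd d \<rho> (fst (fold (eff x y) bs \<sigma>)) \<longleftrightarrow> good rd d \<rho> (fst \<sigma>)"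
  by (auto simp: good_def vars_def keep_fold)

definition emission_spec :: "emission \<Rightarrow> nat poly \<Rightarrow> bool" where
  "emission_spec P p \<longleftrightarrow>
     (\<forall>x y d \<sigma> \<rho> B. good rd d \<rho> (fst \<sigma>) \<longrightarrow> (\<forall>v. \<rho> v \<le> B) \<longrightarrow>
        runs x y (comp_emission d P) \<sigma> (poly p B) (fold (eff x y) (emitted (bit_at (input rd x y)) d \<rho> P) \<sigma>))"

lemma emission_specI:
  assumes "\<And>x y d \<sigma> \<rho> B. good rd d \<rho> (fst \<sigma>) \<Longrightarrow> (\<And>v. \<rho> v \<le> B) \<Longrightarrow>
        runs x y (comp_emission d P) \<sigma> (poly p B) (fold (eff x y) (emitted (bit_at (input rd x y)) d \<rho> P) \<sigma>)"
  shows "\<exists>p. emission_spec P p"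
  using assms unfolding emission_spec_def by blast

lemma emission_specD:
  assumes "emission_spec P p" "good rd d \<rho> (fst \<sigma>)" "\<And>v. \<rho> v \<le> B"
  shows "runs x y (comp_emission d P) \<sigma> (poly p B) (fold (eff x y) (emitted (bit_at (input rd x y)) d \<rho> P) \<sigma>)"
  using assms unfolding emission_spec_def by blast

lemma emission_spec_exists: "\<exists>p. emission_spec P p"
proof (induction P)
  case Nop
  show ?case by (rule emission_specI[where p = "[:1:]"]) (use runs_Skip in simp)
next
  case (Out b)
  show ?case by (rule emission_specI[where p = "[:T:]"]) (use run in simp)
next
  case (Sq P Q)
  then obtain p q where p: "emission_spec P p" and q: "emission_spec Q q" by blast
  show ?case
  proof (rule emission_specI[where p = "p + q + [:1:]"])
    fix x y and d B :: nat and \<sigma> :: cstate and \<rho> :: "nat \<Rightarrow> nat"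
    assume *: "good rd d \<rho> (fst \<sigma>)" "\<And>v. \<rho> v \<le> B"
    note 1 = emission_specD[OF p *, of x y]
    have 2: "runs x y (comp_emission d Q) (fold (eff x y) (emitted (bit_at (input rd x y)) d \<rho> P) \<sigma>) (poly q B)
      (fold (eff x y) (emitted (bit_at (input rd x y)) d \<rho> Q) (fold (eff x y) (emitted (bit_at (input rd x y)) d \<rho> P) \<sigma>))"
      by (rule emission_specD[OF q]) (use * in \<open>simp_all add: good_fold\<close>)
    show "runs x y (comp_emission d (Sq P Q)) \<sigma> (poly (p + q + [:1:]) B) (fold (eff x y) (emitted (bit_at (input rd x y)) d \<rho> (Sq P Q)) \<sigma>)"
      using runs_Seq[OF 1 2] by simp
  qed
next
  case (Cond \<phi> P Q)
  then obtain p q where p: "emission_spec P p" and q: "emission_spec Q q" by blast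
  obtain r where r: "form_spec rd \<phi> r" using form_spec_exists[OF rd] by blast
  show ?case
  proof (rule emission_specI[where p = "p + q + r + [:4:]"])
    fix x y and d B :: nat and \<sigma> :: cstate and \<rho> :: "nat \<Rightarrow> nat"
    assume *: "good rd d \<rho> (fst \<sigma>)" "\<And>v. \<rho> v \<le> B"
    define h w where "h = fst \<sigma>" and "w = snd \<sigma>"
    have \<sigma>: "\<sigma> = (h, w)" by (simp add: h_def w_def)
    have h: "h(2 := 0) = h" using goodD(3)[OF *(1)] by (simp add: \<sigma> fun_eq_iff)
    have 0: "runs x y (comp_form rd d \<phi>) \<sigma> (poly r B) (h(2 := of_bool (holds (bit_at (input rd x y)) d \<rho> \<phi>)), w)"
      unfolding \<sigma> by (rule form_specD[OF r]) (use * in \<open>simp_all add: \<sigma>\<close>)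
    have 3: "runs x y (IfS 2 1 (comp_emission d Q) (Dec 2 ;; comp_emission d P)) (h(2 := of_bool (holds (bit_at (input rd x y)) d \<rho> \<phi>)), w)
       (poly (p + q) B + 3) (fold (eff x y) (emitted (bit_at (input rd x y)) d \<rho> (Cond \<phi> P Q)) \<sigma>)"
    proof (cases "holds (bit_at (input rd x y)) d \<rho> \<phi>")
      case True
      have 1: "runs x y (Dec 2) (h(2 := 1), w) 1 \<sigma>"
        by (rule runs_cong[OF runs_Dec]) (use h \<sigma> in auto)
      note 2 = emission_specD[OF p *, of x y]
      have "runs x y (IfS 2 1 (comp_emission d Q) (Dec 2 ;; comp_emission d P)) (h(2 := 1), w) (poly (p + q) B + 3)
          (fold (eff x y) (emitted (bit_at (input rd x y)) d \<rho> P) \<sigma>)"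
        by (rule runs_cong[OF runs_IfF[OF _ runs_Seq[OF 1 2]]]) (auto simp: scan_counter)
      then show ?thesis using True by simp
    next
      case False
      note 2 = emission_specD[OF q *, of x y]
      have "runs x y (IfS 2 1 (comp_emission d Q) (Dec 2 ;; comp_emission d P)) \<sigma> (poly (p + q) B + 3)
          (fold (eff x y) (emitted (bit_at (input rd x y)) d \<rho> Q) \<sigma>)"
        by (rule runs_cong[OF runs_IfT[OF _ 2]]) (use goodD(3)[OF *(1)] in \<open>auto simp: scan_counter\<close>)
      then show ?thesis using False h by (simp add: \<sigma>)
    qed
    show "runs x y (comp_emission d (Cond \<phi> P Q)) \<sigma> (poly (p + q + r + [:4:]) B)
       (fold (eff x y) (emitted (bit_at (input rd x y)) d \<rho> (Cond \<phi> P Q)) \<sigma>)"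
      unfolding comp_emission.simps by (rule runs_mono[OF runs_Seq[OF 0 3]]) simp
  qed
next
  case (For e P)
  then obtain q where q: "emission_spec P q" by blast
  obtain p where p: "expr_spec e p" using expr_spec_exists by blast
  define r where "r = smult 5 p + [:5:] + p * (pcompose q ([:0, 1:] + p) + [:7:])"
  show ?case
  proof (rule emission_specI[where p = r])
    fix x y and d B :: nat and \<sigma> :: cstate and \<rho> :: "nat \<Rightarrow> nat"
    assume *: "good rd d \<rho> (fst \<sigma>)" "\<And>v. \<rho> v \<le> B"
    define b where "b = 4 + 2 * d"
    define N where "N = val \<rho> e"
    have b: "4 \<le> b" by (simp add: b_def)
    have hz: "fst \<sigma> 2 = 0" "fst \<sigma> rd = 0" "fst \<sigma> b = 0" "fst \<sigma> (Suc b) = 0"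
      using goodD[OF *(1)] by (auto simp: b_def)
    have 1: "runs x y (comp_expr d (b + 1) e) \<sigma> (poly p B) (upd (b + 1) N \<sigma>)"
      unfolding N_def upd_def using expr_specD(1)[OF p goodD(1)[OF *(1)], where b = "b + 1" and B = B and w = "snd \<sigma>"] * goodD(4)[OF *(1)]
      by (auto simp: b_def)
    have N: "N \<le> poly p B" unfolding N_def
      by (rule expr_specD[OF p goodD(1)[OF *(1)]]) (use * goodD(4) in \<open>auto\<close>)
    define bs where "bs i = emitted (bit_at (input rd x y)) (Suc d) (\<rho>(d := i)) P" for i
    define Q where "Q = poly q (B + poly p B)"
    \<comment> \<open>\<open>F i\<close> is the effect of the first \<open>i\<close> iterations with
      the registers of this loop still at 0. By \<open>comm_fold\<close> their current values can be
      put on top afterwards.\<close>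
    define F where "F i = fold (eff x y) (concat (map bs [0..<i])) \<sigma>" for i
    have F: "fst (F i) b = 0" "fst (F i) (Suc b) = 0" for i
      unfolding F_def using b hz by (simp_all add: keep_fold)
    let ?S = "\<lambda>i. upd b i (upd (b + 1) (N - i) (F i))"
    have body: "runs x y (comp_emission (Suc d) P ;; Inc b) (upd (b + 1) (N - Suc i) (?S i)) (Q + 2) (?S (Suc i))"
      if i: "i < N" for i
    proof -
      let ?\<tau> = "upd b i (upd (b + 1) (N - Suc i) (F i))"
      have \<tau>: "upd (b + 1) (N - Suc i) (?S i) = ?\<tau>"
        by (auto simp: upd_def fun_eq_iff)
      have g: "good rd (Suc d) (\<rho>(d := i)) (fst ?\<tau>)"
      proof (rule goodI)
        have "good rd d \<rho> (fst (F i))" unfolding F_def using *(1) by (simp add: good_fold)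
        note G = goodD[OF this]
        have "vars d \<rho> (fst ?\<tau>)" using G(1) b by (auto simp: vars_def b_def)
        then show "vars (Suc d) (\<rho>(d := i)) (fst ?\<tau>)" by (rule vars_Suc) (simp add: b_def)
        show "fst ?\<tau> j = 0" if "j \<ge> 4 + 2 * Suc d" for j
          using that G(4)[of j] by (auto simp: b_def)
        show "fst ?\<tau> rd = 0" "fst ?\<tau> 2 = 0" using G(2,3) rd b by auto
      qed
      have "runs x y (comp_emission (Suc d) P) ?\<tau> (poly q (B + N)) (fold (eff x y) (bs i) ?\<tau>)"
        unfolding bs_def by (rule emission_specD[OF q g]) (use *(2) i in \<open>auto simp: trans_le_add1\<close>)
      moreover have "fold (eff x y) (bs i) ?\<tau> = upd b i (upd (b + 1) (N - Suc i) (F (Suc i)))"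
        using b by (simp add: comm_fold F_def)
      moreover have "poly q (B + N) \<le> Q" unfolding Q_def using N by (intro poly_nat_mono) simp
      ultimately have 5: "runs x y (comp_emission (Suc d) P) ?\<tau> Q (upd b i (upd (b + 1) (N - Suc i) (F (Suc i))))"
        using runs_mono by simp
      have 6: "runs x y (Inc b) (upd b i (upd (b + 1) (N - Suc i) (F (Suc i)))) 1 (?S (Suc i))"
        unfolding upd_def by (rule runs_cong[OF runs_Inc]) (auto simp: fun_eq_iff)
      show ?thesis unfolding \<tau> by (rule runs_mono[OF runs_Seq[OF 5 6]]) simp
    qed
    have 2: "runs x y (Loop (b + 1) (comp_emission (Suc d) P ;; Inc b)) (upd (b + 1) N \<sigma>) (N * (Q + 5) + 1) (?S N)"
    proof (rule runs_cong[OF runs_Loop[where N = N and S = ?S and n = "Q + 2"]])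
      show "upd (b + 1) N \<sigma> = ?S 0" using hz by (auto simp: upd_def fun_eq_iff F_def)
    qed (use body b in auto)
    have 3: "runs x y (Loop b Skip) (?S N) (N * 4 + 1) (F N)"
      unfolding upd_def
      by (rule runs_cong[OF runs_Loop_Skip]) (use b F[of N] in \<open>auto simp: fun_eq_iff prod_eq_iff\<close>)
    have r: "poly r B = 5 * poly p B + 5 + poly p B * (Q + 7)"
      by (simp add: r_def Q_def poly_pcompose)
    have M2: "N * (Q + 5) \<le> N * (Q + 7)" by simp
    have M: "N * (Q + 7) \<le> poly p B * (Q + 7)" using N by (intro mult_mono) auto
    have "runs x y (comp_emission d (For e P)) \<sigma> (poly r B) (F N)"
      unfolding comp_emission.simps Let_def b_def[symmetric]
      by (rule runs_mono[OF runs_Seq[OF 1 runs_Seq[OF 2 3]]]) (use M M2 N r in linarith)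
    then show "runs x y (comp_emission d (For e P)) \<sigma> (poly r B) (fold (eff x y) (emitted (bit_at (input rd x y)) d \<rho> (For e P)) \<sigma>)"
      by (simp add: F_def bs_def[abs_def] N_def del: comp_emission.simps)
  qed
qed

end

section \<open>Transducers and verifiers obtained from emissions\<close>

definition init_env :: "bool list \<Rightarrow> bool list \<Rightarrow> nat \<Rightarrow> nat" where
  "init_env x y = (\<lambda>_. 0)(0 := length x, 1 := length y)"

text \<open>Counters 4 and 6 are the places of variables 0 and 1, so after the two length
  computations the input lengths are bound and programs start at depth 2. Counter 5 remembers how
  far the head has to return.\<close>

definition input_length :: "nat \<Rightarrow> nat \<Rightarrow> prog" where
  "input_length j c = Whl j 0 (Inc j ;; Inc c ;; Inc 5) ;; Loop 5 (Dec j)"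

lemma scan_blank: "j < 2 \<Longrightarrow> scan x y h j = 0 \<longleftrightarrow> length (input j x y) \<le> h j"
  by (cases "j = 0") (auto simp: scan_def cells_def word_cells_def input_def)

lemma runs_input_length:
  assumes "j < 2" "c = 4 \<or> c = 6" "h j = 0" "h 5 = 0" "h c = 0" "L = length (input j x y)"
  shows "runs x y (input_length j c) (h, w) (L * 10 + 3) (h(c := L), w)"
proof -
  let ?S = "\<lambda>i. (h(j := i, c := i, 5 := i), w)"
  have ne: "j \<noteq> c" "j \<noteq> 5" "c \<noteq> 5" using assms by auto
  have "runs x y (Whl j 0 (Inc j ;; Inc c ;; Inc 5)) (?S 0) (L * (5 + 1) + 1) (?S L)"
  proof (rule runs_Whl)
    show "runs x y (Inc j ;; Inc c ;; Inc 5) (?S i) 5 (?S (Suc i))" for i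
      by (rule runs_cong[OF runs_Seq[OF runs_Inc runs_Seq[OF runs_Inc runs_Inc]]])
        (use ne in \<open>auto simp: fun_eq_iff\<close>)
  qed (use assms ne in \<open>auto simp: scan_blank\<close>)
  moreover have "?S 0 = (h, w)" using assms by (auto simp: fun_eq_iff)
  ultimately have 1: "runs x y (Whl j 0 (Inc j ;; Inc c ;; Inc 5)) (h, w) (L * 6 + 1) (?S L)" by simp
  have 2: "runs x y (Loop 5 (Dec j)) (?S L) (L * 4 + 1) (h(c := L), w)"
    by (rule runs_cong[OF runs_Loop_Dec]) (use assms ne in \<open>auto simp: fun_eq_iff\<close>)
  show ?thesis unfolding input_length_def by (rule runs_mono[OF runs_Seq[OF 1 2]]) simp
qed

definition start_state :: "bool list \<Rightarrow> bool list \<Rightarrow> cstate" where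
  "start_state x y = ((\<lambda>_. 0)(4 := length x, 6 := length y), [])"

lemma runs_prelude:
  "runs x y (input_length 0 4 ;; input_length 1 6) (\<lambda>_. 0, []) ((length x + length y) * 10 + 7) (start_state x y)"
proof -
  have 1: "runs x y (input_length 0 4) (\<lambda>_. 0, []) (length x * 10 + 3) ((\<lambda>_. 0)(4 := length x), [])"
    by (rule runs_input_length) (auto simp: input_def)
  have 2: "runs x y (input_length 1 6) ((\<lambda>_. 0)(4 := length x), []) (length y * 10 + 3) (start_state x y)"
    unfolding start_state_def by (rule runs_input_length) (auto simp: input_def)
  show ?thesis by (rule runs_mono[OF runs_Seq[OF 1 2]]) simp
qed

lemma good_start: "rd < 2 \<Longrightarrow> good rd 2 (init_env x y) (fst (start_state x y))"
  by (rule goodI) (auto simp: vars_def init_env_def start_state_def less_2_cases_iff)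

lemma init_env_le: "init_env x y v \<le> length x + length y"
  by (auto simp: init_env_def)

definition with_init :: "prog \<Rightarrow> prog \<Rightarrow> prog" where
  "with_init R F = Init ;; (R ;; F)"

lemma mstep_with_init:
  assumes "runs x y R (\<lambda>_. 0, []) n \<sigma>" "valid k R" "k \<ge> 3" "xs = [x, y] \<or> xs = [x] \<and> y = []"
  shows "\<exists>m \<le> n + 3. (mstep k ^^ m) ([with_init R F],
     init_tapes k xs) = ([F], tapes x y k \<sigma>)"
proof -
  obtain m where m: "m \<le> n" "exec x y R (\<lambda>_. 0, []) m \<sigma>" using assms(1) by (auto simp: runs_def)
  let ?i = "init_tapes k xs"
  have 1: "mstep k ([with_init R F], ?i) = ([Init, R ;; F], ?i)"
    using map2_idle by (simp add: mstep_def with_init_def)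
  have 2: "mstep k ([Init, R ;; F], ?i) = ([R ;; F], tapes x y k (\<lambda>_. 0, []))"
    using assms by (intro mstep_Init)
  have 3: "mstep k ([R ;; F], tapes x y k (\<lambda>_. 0, [])) = ([R, F], tapes x y k (\<lambda>_. 0, []))"
    using map2_idle by (simp add: mstep_def)
  have "(mstep k ^^ (m + 3)) ([with_init R F], ?i) = (mstep k ^^ m) ([R, F], tapes x y k (\<lambda>_. 0, []))"
    by (simp only: funpow_add comp_apply numeral_3_eq_3 funpow.simps id_apply 1 2 3)
  also have "\<dots> = ([F], tapes x y k \<sigma>)"
    using exec_mstep[OF m(2) assms(2)] assms(3) by simp
  finally show ?thesis using m(1) by (intro exI[of _ "m + 3"]) auto
qed

lemma funpow_fixed: "f c = c \<Longrightarrow> (f ^^ n) c = c"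
  by (induction n) auto

lemma mstep_final:
  assumes "(mstep k ^^ m) c = (s, ts)" "s = [] \<or> s = [Fail]" "m \<le> t"
  shows "(mstep k ^^ t) c = (s, ts)"
proof -
  have "mstep k (s, ts) = (s, ts)" using assms(2) map2_idle by (auto simp: mstep_def)
  then have "(mstep k ^^ (t - m + m)) c = (s, ts)"
    using assms(1) by (simp only: funpow_add comp_apply) (rule funpow_fixed)
  then show ?thesis using assms(3) by simp
qed

interpretation emit: emitter 0 Emit "\<lambda>x y b \<sigma>. (fst \<sigma>, snd \<sigma> @ [b])" 1
  by unfold_locales (auto simp: runs_Emit[unfolded One_nat_def])

text \<open>The time bound comes from the syntax of \<open>P\<close>, so describing a function by an
  emission is enough to show it computable in polynomial time. The second input tape is blank here,
  hence \<open>[]\<close>.\<close>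

theorem emission_polytime:
  "polytime_computable (\<lambda>x. emitted (bit_at x) 2 (init_env x []) P)"
proof -
  let ?f = "\<lambda>x. emitted (bit_at x) 2 (init_env x []) P"
  obtain p where p: "emit.emission_spec P p" using emit.emission_spec_exists by blast
  define R where "R = (input_length 0 4 ;; input_length 1 6) ;; emit.comp_emission 2 P"
  obtain k where k: "k \<ge> 3" "valid k R" using valid_exists by blast
  obtain M enc where M: "wf_tm M" "ntapes M = k" "enc [] = accept M" and
    M_run: "\<And>xs t. run M xs t = map_prod enc id
       ((mstep k ^^ t) ([with_init R Skip], init_tapes k xs))"
    using machine_exists[of k "with_init R Skip"] k by auto
  define q where "q = p + [:12, 10:]"
  have "run M [x] (poly q (length x)) = (accept M, tapes x [] k (fst (start_state x []), ?f x))" for x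
  proof -
    have fold: "fold (\<lambda>b \<sigma>. (fst \<sigma>, snd \<sigma> @ [b])) bs (h, w) = (h, w @ bs)" for bs w and h :: "nat \<Rightarrow> nat"
      by (induction bs arbitrary: w) auto
    have "runs x [] (emit.comp_emission 2 P) (start_state x []) (poly p (length x + length []))
        (fold (\<lambda>b \<sigma>. (fst \<sigma>, snd \<sigma> @ [b])) (emitted (bit_at (input 0 x [])) 2 (init_env x []) P) (start_state x []))"
      by (rule emit.emission_specD[OF p]) (use init_env_le[of x "[]"] in \<open>auto intro!: good_start\<close>)
    then have 1: "runs x [] (emit.comp_emission 2 P) (start_state x []) (poly p (length x)) (fst (start_state x []), ?f x)"
      by (simp add: fold input_def start_state_def)
    have "runs x [] R (\<lambda>_. 0, []) (length x * 10 + 8 + poly p (length x)) (fst (start_state x []), ?f x)"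
      unfolding R_def by (rule runs_mono[OF runs_Seq[OF runs_prelude 1]]) simp
    from mstep_with_init[OF this k(2,1), of "[x]" Skip] obtain m where
      m: "m \<le> length x * 10 + 8 + poly p (length x) + 3"
      "(mstep k ^^ m) ([with_init R Skip], init_tapes k [x])
         = ([Skip], tapes x [] k (fst (start_state x []), ?f x))" by blast
    then have "(mstep k ^^ Suc m) ([with_init R Skip], init_tapes k [x])
         = ([], tapes x [] k (fst (start_state x []), ?f x))"
      using map2_idle by (simp add: mstep_def)
    from mstep_final[OF this, of "poly q (length x)"] show ?thesis
      using m(1) M(3) by (simp add: M_run q_def)
  qed
  moreover have "snd (last (tapes x [] k \<sigma>)) = word_cells (snd \<sigma>)" for x \<sigma>
    using k(1) by (simp add: tapes_def last_map)
  ultimately show ?thesis unfolding polytime_computable_def using M(1)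
    by (intro exI[of _ M] exI[of _ q]) simp
qed

text \<open>A word is checked by comparing the emitted bits with tape 0 instead of writing them.\<close>

definition match_eff :: "bool list \<Rightarrow> bool list \<Rightarrow> bool \<Rightarrow> cstate \<Rightarrow> cstate" where
  "match_eff x y b \<sigma> = (if scan x y (fst \<sigma>) 0 = bit_symbol b then upd 0 (Suc (fst \<sigma> 0)) \<sigma> else upd 3 (Suc (fst \<sigma> 3)) \<sigma>)"

interpretation match: emitter 1 "\<lambda>b. IfS 0 (bit_symbol b) (Inc 0) (Inc 3)" match_eff 2
proof
  show "match_eff x y b (upd j v \<sigma>) = upd j v (match_eff x y b \<sigma>)" if "4 \<le> j" for x y b j v \<sigma>
    using that by (auto simp: match_eff_def upd_def scan_def fun_eq_iff)
  show "runs x y (IfS 0 (bit_symbol b) (Inc 0) (Inc 3)) \<sigma> 2 (match_eff x y b \<sigma>)" for x y b \<sigma>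
  proof (cases "scan x y (fst \<sigma>) 0 = bit_symbol b")
    case True
    then show ?thesis using runs_IfT[OF True runs_Inc[of x y 0 "fst \<sigma>" "snd \<sigma>", unfolded prod.collapse]]
      by (simp add: match_eff_def upd_def numeral_2_eq_2)
  next
    case False
    then show ?thesis using runs_IfF[OF False runs_Inc[of x y 3 "fst \<sigma>" "snd \<sigma>", unfolded prod.collapse]]
      by (simp add: match_eff_def upd_def numeral_2_eq_2)
  qed
qed (auto simp: match_eff_def)

lemma scan_bsym: "scan x y h 0 = bit_symbol b \<longleftrightarrow> h 0 < length x \<and> x ! h 0 = b"
  by (auto simp: scan_def cells_def word_cells_def bit_symbol_def)

text \<open>Counter 3 never decreases, so a single mismatch is remembered; without a mismatch the
  head on \<open>x\<close> advances once per bit. A bit beyond the end meets a blank and is a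
  mismatch. Equality thus amounts to counter 3 being 0 and the head having passed all of
  \<open>x\<close>.\<close>

lemma fold_match:
  "h 0 \<le> length x \<Longrightarrow> \<exists>p f. fold (match_eff x y) bs (h, w) = (h(0 := p, 3 := f), w) \<and>
     (f = 0 \<and> length x \<le> p \<longleftrightarrow> h 3 = 0 \<and> bs = drop (h 0) x)"
proof (induction bs arbitrary: h)
  case Nil
  show ?case by (intro exI[of _ "h 0"] exI[of _ "h 3"]) (use Nil in auto)
next
  case (Cons b bs)
  show ?case
  proof (cases "h 0 < length x \<and> x ! h 0 = b")
    case True
    then have e: "match_eff x y b (h, w) = (h(0 := Suc (h 0)), w)"
      by (simp add: match_eff_def scan_bsym upd_def)
    have d: "drop (h 0) x = b # drop (Suc (h 0)) x" using True Cons_nth_drop_Suc by fastforce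
    have "\<exists>p f. fold (match_eff x y) bs (h(0 := Suc (h 0)), w) = ((h(0 := Suc (h 0)))(0 := p, 3 := f), w) \<and>
        (f = 0 \<and> length x \<le> p \<longleftrightarrow> (h(0 := Suc (h 0))) 3 = 0 \<and> bs = drop ((h(0 := Suc (h 0))) 0) x)"
      by (rule Cons.IH) (use True in simp)
    then obtain p f where "fold (match_eff x y) bs (h(0 := Suc (h 0)), w) = ((h(0 := Suc (h 0)))(0 := p, 3 := f), w)"
      "f = 0 \<and> length x \<le> p \<longleftrightarrow> (h(0 := Suc (h 0))) 3 = 0 \<and> bs = drop ((h(0 := Suc (h 0))) 0) x"
      by blast
    then show ?thesis using e d by (intro exI[of _ p] exI[of _ f]) auto
  next
    case False
    then have e: "match_eff x y b (h, w) = (h(3 := Suc (h 3)), w)"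
      using False by (auto simp add: match_eff_def scan_bsym upd_def)
    have d: "b # bs \<noteq> drop (h 0) x" using False
      by (metis Cons.prems Cons_nth_drop_Suc drop_all list.distinct(1) list.inject nat_less_le order.refl)
    have "\<exists>p f. fold (match_eff x y) bs (h(3 := Suc (h 3)), w) = ((h(3 := Suc (h 3)))(0 := p, 3 := f), w) \<and>
        (f = 0 \<and> length x \<le> p \<longleftrightarrow> (h(3 := Suc (h 3))) 3 = 0 \<and> bs = drop ((h(3 := Suc (h 3))) 0) x)"
      by (rule Cons.IH) (use Cons.prems in simp)
    then obtain p f where "fold (match_eff x y) bs (h(3 := Suc (h 3)), w) = ((h(3 := Suc (h 3)))(0 := p, 3 := f), w)"
      "\<not> (f = 0 \<and> length x \<le> p)"
      by auto
    then show ?thesis using e d by (intro exI[of _ p] exI[of _ f]) (auto simp: fun_upd_twist)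
  qed
qed

text \<open>Counter 2 already holds the truth value of the formula; it is erased unless no mismatch
  was counted and the head on tape 0 has reached the blank after the input.\<close>

definition verdict :: prog where
  "verdict = IfS 3 1 (IfS 0 0 Skip (Loop 2 Skip)) (Loop 2 Skip)"

lemma runs_verdict:
  assumes "h 2 \<le> 1"
  shows "runs x y verdict (h, w) 7 (h(2 := of_bool (h 2 = 1 \<and> h 3 = 0 \<and> length x \<le> h 0)), w)"
proof -
  have "runs x y (Loop 2 Skip) (h, w) (h 2 * 4 + 1) (h(2 := 0), w)"
    by (rule runs_Loop_Skip) simp
  then have L: "runs x y (Loop 2 Skip) (h, w) 5 (h(2 := 0), w)"
    by (rule runs_mono) (use assms in simp)
  consider "h 3 \<noteq> 0" | "h 3 = 0" "length x \<le> h 0" | "h 3 = 0" "\<not> length x \<le> h 0" by blast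
  then show ?thesis
  proof cases
    case 1
    then show ?thesis unfolding verdict_def
      by (intro runs_cong[OF runs_IfF[OF _ L]]) (auto simp: scan_counter)
  next
    case 2
    moreover have "h(2 := of_bool (h 2 = 1)) = h" using assms by (auto simp: fun_eq_iff)
    ultimately show ?thesis unfolding verdict_def
      by (intro runs_cong[OF runs_IfT[OF _ runs_IfT[OF _ runs_Skip]]]) (auto simp: scan_counter scan_blank input_def)
  next
    case 3
    then show ?thesis unfolding verdict_def
      by (intro runs_cong[OF runs_IfT[OF _ runs_IfF[OF _ L]]]) (auto simp: scan_counter scan_blank input_def)
  qed
qed

lemma run_halted:
  assumes "halted M (run M xs t)" "t \<le> t'"
  shows "run M xs t' = run M xs t"
proof -
  have fix1: "step M (run M xs t) = run M xs t" using assms(1) by (cases "run M xs t") auto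
  have "run M xs (t' - t + t) = run M xs t"
    unfolding run_def funpow_add comp_apply by (rule funpow_fixed) (use fix1 in \<open>simp add: run_def\<close>)
  then show ?thesis using assms(2) by simp
qed

text \<open>The verifier prints a word from the certificate and compares it with the input, so no
  parser has to be programmed. \<open>P\<close> and \<phi> read the certificate only; all they know
  of \<open>w\<close> is its length.\<close>

theorem matching_in_NP:
  assumes A: "\<And>w. w \<in> A \<longleftrightarrow> (\<exists>y. length y \<le> poly q (length w) \<and>
     emitted (bit_at y) 2 (init_env w y) P = w \<and> holds (bit_at y) 2 (init_env w y) \<phi>)"
  shows "in_NP A"
proof -
  obtain p where p: "match.emission_spec P p" using match.emission_spec_exists by blast
  obtain r where r: "form_spec 1 \<phi> r" using form_spec_exists[of 1 \<phi>] by auto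
  define R where "R = (input_length 0 4 ;; input_length 1 6) ;; match.comp_emission 2 P ;; comp_form 1 2 \<phi> ;; verdict"
  define F where "F = IfS 2 1 Fail Skip"
  obtain k where k: "k \<ge> 4" "valid k R" using valid_exists by blast
  obtain M enc where M: "wf_tm M" "ntapes M = k" "enc [] = accept M" "enc [Fail] = reject M" and
    M_run: "\<And>xs t. run M xs t = map_prod enc id
       ((mstep k ^^ t) ([with_init R F], init_tapes k xs))"
    using machine_exists[of k "with_init R F"] k by auto
  define s where "s = p + r + [:22, 10:]"
  define ok where "ok x y \<longleftrightarrow> emitted (bit_at y) 2 (init_env x y) P = x \<and> holds (bit_at y) 2 (init_env x y) \<phi>" for x y
  have run_eq: "fst (run M [x, y] (poly s (length x + length y))) = (if ok x y then accept M else reject M)" for x y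
  proof -
    let ?B = "length x + length y"
    let ?bs = "emitted (bit_at y) 2 (init_env x y) P"
    let ?b = "holds (bit_at y) 2 (init_env x y) \<phi>"
    let ?h = "fst (start_state x y)"
    have st: "start_state x y = (?h, [])" by (simp add: start_state_def)
    obtain pp f where pf: "fold (match_eff x y) ?bs (?h, []) = (?h(0 := pp, 3 := f), [])"
      "f = 0 \<and> length x \<le> pp \<longleftrightarrow> ?bs = x"
      using fold_match[of ?h x y ?bs "[]"] by (auto simp: start_state_def)
    have "runs x y (match.comp_emission 2 P) (start_state x y) (poly p ?B)
        (fold (match_eff x y) (emitted (bit_at (input 1 x y)) 2 (init_env x y) P) (start_state x y))"
      by (rule match.emission_specD[OF p]) (auto intro!: good_start init_env_le)
    then have 1: "runs x y (match.comp_emission 2 P) (start_state x y) (poly p ?B) (?h(0 := pp, 3 := f), [])"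
      using pf(1) by (simp add: input_def flip: st)
    have g: "good 1 2 (init_env x y) (?h(0 := pp, 3 := f))"
      using good_start[of 1 x y] by (auto simp: good_def vars_def)
    have 2: "runs x y (comp_form 1 2 \<phi>) (?h(0 := pp, 3 := f), []) (poly r ?B) (?h(0 := pp, 3 := f, 2 := of_bool ?b), [])"
      using form_specD[OF r g, of ?B x y "[]"] init_env_le by (simp add: input_def)
    have 3: "runs x y verdict (?h(0 := pp, 3 := f, 2 := of_bool ?b), []) 7
       (?h(0 := pp, 3 := f, 2 := of_bool (ok x y)), [])"
      by (rule runs_cong[OF runs_verdict]) (use pf(2) in \<open>auto simp: ok_def fun_eq_iff\<close>)
    define \<sigma> where "\<sigma> = (?h(0 := pp, 3 := f, 2 := of_bool (ok x y)), [] :: bool list)"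
    have "runs x y R (\<lambda>_. 0, []) (?B * 10 + 7 + (poly p ?B + (poly r ?B + 7 + 1) + 1) + 1) \<sigma>"
      unfolding R_def \<sigma>_def by (rule runs_Seq[OF runs_prelude runs_Seq[OF 1 runs_Seq[OF 2 3]]])
    from mstep_with_init[OF this k(2), of "[x, y]" F] k(1) obtain m where
      m: "m \<le> ?B * 10 + 7 + (poly p ?B + (poly r ?B + 7 + 1) + 1) + 1 + 3"
      "(mstep k ^^ m) ([with_init R F], init_tapes k [x, y])
         = ([F], tapes x y k \<sigma>)" by auto
    have f1: "mstep k ([F], tapes x y k \<sigma>) = ([if ok x y then Skip else Fail], tapes x y k \<sigma>)"
      using map2_idle k(1) scan_tapes[of 2 k x y \<sigma>]
      by (simp add: mstep_def F_def scan_counter \<sigma>_def del: nth_map)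
    have f2: "mstep k ([if ok x y then Skip else Fail], tapes x y k \<sigma>) = (if ok x y then [] else [Fail], tapes x y k \<sigma>)"
      using map2_idle by (simp add: mstep_def)
    have "(mstep k ^^ Suc (Suc m)) ([with_init R F], init_tapes k [x, y])
         = (if ok x y then [] else [Fail], tapes x y k \<sigma>)"
      by (simp only: funpow.simps comp_apply m(2) f1 f2)
    from mstep_final[OF this, of "poly s ?B"] show ?thesis
      using m(1) M(3,4) by (simp add: M_run s_def)
  qed
  have halts: "halted M (run M [x, y] (poly s (length x + length y)))" for x y
    using run_eq[of x y] by (simp add: halted_def)
  have acc: "(\<exists>t. fst (run M [x, y] t) = accept M) \<longleftrightarrow> ok x y" for x y
  proof
    assume "\<exists>t. fst (run M [x, y] t) = accept M"
    then obtain t where t: "fst (run M [x, y] t) = accept M" by blast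
    then have "halted M (run M [x, y] t)" by (simp add: halted_def)
    then have "run M [x, y] (poly s (length x + length y)) = run M [x, y] t"
      using run_halted halts by (metis nle_le)
    then show "ok x y" using run_eq[of x y] t M(1) by (auto simp: wf_tm_def split: if_splits)
  qed (use run_eq in metis)
  show ?thesis unfolding in_NP_def
    using M(1,2) k(1) halts A acc by (intro exI[of _ M] exI[of _ q] exI[of _ s]) (auto simp: ok_def)
qed

section \<open>Membership in NP\<close>

definition near_complete :: "'a graph \<Rightarrow> bool" where
  "near_complete G \<longleftrightarrow> (\<forall>u \<in> verts G. \<forall>v \<in> verts G. \<forall>w \<in> verts G.
     u \<noteq> v \<longrightarrow> u \<noteq> w \<longrightarrow> v \<noteq> w \<longrightarrow> {u, v} \<in> edges G \<or> {u, w} \<in> edges G)"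

text \<open>\<open>isomorphic\<close> also compares the degenerate pairs \<open>{u, u}\<close>.
  Neither graph has singleton edges, so distinct vertices suffice.\<close>

lemma not_free_ofI:
  assumes "simple_graph G" "S \<subseteq> verts G" "bij_betw f S (verts H)"
    and "\<And>u v. u \<in> S \<Longrightarrow> v \<in> S \<Longrightarrow> u \<noteq> v \<Longrightarrow> {u, v} \<in> edges G \<longleftrightarrow> {f u, f v} \<in> edges H"
    and "\<And>z. {z} \<notin> edges H"
  shows "\<not> free_of H G"
proof -
  have "{u} \<notin> edges G" for u using assms(1) by (auto simp: simple_graph_def)
  then have "{u, v} \<in> edges G \<longleftrightarrow> {f u, f v} \<in> edges H" if "u \<in> S" "v \<in> S" for u v
    using assms(4)[OF that] assms(5) by (cases "u = v") auto
  then show ?thesis using assms(2,3)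
    by (auto simp: free_of_def isomorphic_def induced_def)
qed

text \<open>An induced copy of \<open>H\<close> would carry the vertex \<open>a\<close> with its two
  non-neighbours into \<open>G\<close>.\<close>

lemma free_of_triple:
  assumes "near_complete G" "a \<in> verts H" "b \<in> verts H" "c \<in> verts H" "a \<noteq> b" "a \<noteq> c" "b \<noteq> c"
    and "{a, b} \<notin> edges H" "{a, c} \<notin> edges H"
  shows "free_of H G"
  unfolding free_of_def isomorphic_def
proof
  assume "\<exists>S\<subseteq>verts G. \<exists>f. bij_betw f (verts (induced G S)) (verts H) \<and>
       (\<forall>u\<in>verts (induced G S). \<forall>v\<in>verts (induced G S). ({u, v} \<in> edges (induced G S)) = ({f u, f v} \<in> edges H))"
  then obtain S f where S: "S \<subseteq> verts G" and f: "bij_betw f S (verts H)"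
    and e: "\<And>u v. u \<in> S \<Longrightarrow> v \<in> S \<Longrightarrow> {u, v} \<in> edges G \<longleftrightarrow> {f u, f v} \<in> edges H"
    by (auto simp: induced_def)
  have "verts H = f ` S" using f by (simp add: bij_betw_def)
  then obtain u v w where "u \<in> S" "v \<in> S" "w \<in> S" "f u = a" "f v = b" "f w = c"
    using assms(2-4) by (metis imageE)
  moreover from this have "u \<noteq> v" "u \<noteq> w" "v \<noteq> w" using assms(5-7) by auto
  ultimately show False using e assms(1,8,9) S unfolding near_complete_def by (metis subsetD)
qed

text \<open>If \<open>u\<close> misses both \<open>v\<close> and \<open>w\<close>, the three
  vertices induce \<open>P_1 + P_2\<close> or \<open>3P_1\<close> according to whether
  \<open>v\<close> and \<open>w\<close> are adjacent. Conversely, each of the two graphs has a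
  vertex with two non-neighbours.\<close>

lemma near_complete_iff_free:
  assumes "simple_graph G"
  shows "free_of (copies 3 (path_graph 1)) G \<and> free_of (disjoint_union (path_graph 1) (path_graph 2)) G
    \<longleftrightarrow> near_complete G"
proof
  let ?A = "copies 3 (path_graph 1)" and ?B = "disjoint_union (path_graph 1) (path_graph 2)"
  have A: "edges ?A = {}" "verts ?A = {(0, 0), (1, 0), (2, 0)}"
    by (auto simp: copies_def path_graph_def numeral_3_eq_3 less_Suc_eq)
  have B: "edges ?B = {{Inr 0, Inr 1}}" "verts ?B = {Inl 0, Inr 0, Inr 1}"
    by (auto simp: disjoint_union_def path_graph_def Plus_def)
  show "near_complete G" if free: "free_of ?A G \<and> free_of ?B G"
    unfolding near_complete_def
  proof (intro ballI impI)
    fix u v w assume *: "u \<in> verts G" "v \<in> verts G" "w \<in> verts G" "u \<noteq> v" "u \<noteq> w" "v \<noteq> w"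
    show "{u, v} \<in> edges G \<or> {u, w} \<in> edges G"
    proof (rule ccontr)
      assume n: "\<not> ({u, v} \<in> edges G \<or> {u, w} \<in> edges G)"
      then have n': "{v, u} \<notin> edges G" "{w, u} \<notin> edges G" by (auto simp: insert_commute)
      show False
      proof (cases "{v, w} \<in> edges G")
        case True
        define f :: "'a \<Rightarrow> nat + nat" where "f z = (if z = u then Inl 0 else if z = v then Inr 0 else Inr 1)" for z
        have "\<not> free_of ?B G"
          by (rule not_free_ofI[OF assms, of "{u, v, w}" f])
            (use * n n' True in \<open>auto simp: B[unfolded One_nat_def] f_def bij_betw_def inj_on_def doubleton_eq_iff insert_commute\<close>)
        then show False using free by blast
      next
        case False
        define f :: "'a \<Rightarrow> nat \<times> nat" where "f z = (if z = u then 0 else if z = v then 1 else 2, 0)" for z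
        have "\<not> free_of ?A G"
          by (rule not_free_ofI[OF assms, of "{u, v, w}" f])
            (use * n n' False in \<open>auto simp: A[unfolded One_nat_def] f_def bij_betw_def inj_on_def insert_commute\<close>)
        then show False using free by blast
      qed
    qed
  qed
  show "free_of ?A G \<and> free_of ?B G" if nc: "near_complete G"
  proof
    show "free_of ?A G"
      by (rule free_of_triple[OF nc, of "(0, 0)" _ "(1, 0)" "(2, 0)"]) (auto simp: A[unfolded One_nat_def])
    show "free_of ?B G"
      by (rule free_of_triple[OF nc, of "Inl 0" _ "Inr 0" "Inr 1"]) (auto simp: B[unfolded One_nat_def] doubleton_eq_iff)
  qed
qed

section \<open>Binary numerals from tables of digits\<close>

fun num :: "(nat \<Rightarrow> bool) \<Rightarrow> nat \<Rightarrow> nat" where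
  "num B 0 = 0"
| "num B (Suc M) = of_bool (B 0) + 2 * num (\<lambda>q. B (Suc q)) M"

lemma num_eq_0: "num B M = 0 \<longleftrightarrow> (\<forall>q < M. \<not> B q)"
proof (induction M arbitrary: B)
  case (Suc M)
  have "(\<forall>q < Suc M. \<not> B q) \<longleftrightarrow> \<not> B 0 \<and> (\<forall>q < M. \<not> B (Suc q))" by (auto simp: less_Suc_eq_0_disj)
  then show ?case using Suc by simp
qed simp

lemma num_inj: "num B M = num B' M \<Longrightarrow> q < M \<Longrightarrow> B q = B' q"
proof (induction M arbitrary: B B' q)
  case (Suc M)
  have "odd (num B (Suc M)) = B 0" "odd (num B' (Suc M)) = B' 0" by simp_all
  then have 0: "B 0 = B' 0" using Suc.prems(1) by metis
  then have "num (\<lambda>q. B (Suc q)) M = num (\<lambda>q. B' (Suc q)) M" using Suc.prems(1) by simp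
  then show ?case using Suc 0 by (cases q) auto
qed simp

lemma num_eq_iff: "num B M = num B' M \<longleftrightarrow> (\<forall>q < M. B q = B' q)"
proof
  show "\<forall>q < M. B q = B' q \<Longrightarrow> num B M = num B' M"
    by (induction M arbitrary: B B') (simp_all add: less_Suc_eq_0_disj)
qed (use num_inj in blast)

lemma num_bits: "n < 2 ^ M \<Longrightarrow> num (\<lambda>q. odd (n div 2 ^ q)) M = n"
proof (induction M arbitrary: n)
  case (Suc M)
  have "num (\<lambda>q. odd (n div 2 ^ Suc q)) M = n div 2"
    using Suc.IH[of "n div 2"] Suc.prems by (simp add: div_mult2_eq)
  then show ?case by (simp del: power_Suc)
qed simp

lemma binary_0: "binary 0 = []"
  by (subst binary.simps) simp

lemma less_power_binary: "n < 2 ^ length (binary n)"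
proof (induction n rule: binary.induct)
  case (1 n)
  then show ?case by (cases "n = 0") (auto simp: binary.simps[of n])
qed

abbreviation code :: "letter list \<Rightarrow> bool list" where
  "code ls \<equiv> concat (map letter_code ls)"

text \<open>A digit is printed when some set digit lies at or above it. This drops leading zeros by
  a bounded search, without computing the length of the numeral.\<close>

definition digits :: "nat \<Rightarrow> (nat \<Rightarrow> bool) \<Rightarrow> bool list" where
  "digits M B = concat (map (\<lambda>q. if \<exists>q' < M. q \<le> q' \<and> B q' then [False, B q] else []) [0..<M])"

lemma digits_0: "digits 0 B = []"
  by (simp add: digits_def)

lemma digits_Suc:
  "digits (Suc M) B = (if \<exists>q' < Suc M. B q' then [False, B 0] else []) @ digits M (\<lambda>q. B (Suc q))"
proof -
  have "(\<exists>q' < Suc M. Suc q \<le> q' \<and> B q') = (\<exists>q' < M. q \<le> q' \<and> B (Suc q'))" for q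
    by (auto simp: less_Suc_eq_0_disj)
  then have "map (\<lambda>q. if \<exists>q' < Suc M. q \<le> q' \<and> B q' then [False, B q] else []) (map Suc [0..<M]) =
      map (\<lambda>q. if \<exists>q' < M. q \<le> q' \<and> B (Suc q') then [False, B (Suc q)] else []) [0..<M]"
    unfolding map_map comp_def by presburger
  moreover have "[0..<Suc M] = 0 # map Suc [0..<M]" by (simp add: upt_conv_Cons map_Suc_upt)
  ultimately show ?thesis
    unfolding digits_def by (simp only: list.map concat.simps le0 simp_thms)
qed

text \<open>Both sides peel off the least significant digit, and \<open>binary\<close> stops exactly
  when no set digit is left.\<close>

lemma digits_eq: "digits M B = code (map Bit (binary (num B M)))"
proof (induction M arbitrary: B)
  case 0
  show ?case by (simp add: binary_0 digits_0)
next
  case (Suc M)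
  show ?case
  proof (cases "num B (Suc M) = 0")
    case True
    have 1: "num (\<lambda>q. B (Suc q)) M = 0" using True by simp
    have 2: "\<not> (\<exists>q' < Suc M. B q')" using True unfolding num_eq_0 by blast
    show ?thesis unfolding digits_Suc Suc 1 True if_not_P[OF 2] binary_0 by simp
  next
    case False
    then have "\<exists>q' < Suc M. B q'" unfolding num_eq_0 by blast
    moreover have "binary (num B (Suc M)) = B 0 # binary (num (\<lambda>q. B (Suc q)) M)"
    proof -
      have "odd (num B (Suc M)) = B 0" "num B (Suc M) div 2 = num (\<lambda>q. B (Suc q)) M" by simp_all
      then show ?thesis using False binary.simps[of "num B (Suc M)"] by presburger
    qed
    ultimately show ?thesis unfolding digits_Suc Suc by (simp only: list.map concat.simps letter_code.simps if_True)
  qed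
qed

lemma concat_map_upto_filter:
  "n \<le> M \<Longrightarrow> concat (map (\<lambda>v. if v < n then f v else []) [0..<M]) = concat (map f [0..<n])"
proof (induction M)
  case (Suc M)
  then show ?case by (cases "n = Suc M") (auto intro!: arg_cong[of _ _ concat])
qed simp

definition Disj where "Disj \<phi> \<psi> = Neg (Conj (Neg \<phi>) (Neg \<psi>))"
definition Impl where "Impl \<phi> \<psi> = Neg (Conj \<phi> (Neg \<psi>))"
definition All where "All e \<phi> = Neg (Exi e (Neg \<phi>))"
definition Le where "Le a b = Neg (NZ (Sub a b))"
definition Eq where "Eq a b = Conj (Le a b) (Le b a)"
definition Iff where "Iff \<phi> \<psi> = Conj (Impl \<phi> \<psi>) (Impl \<psi> \<phi>)"

lemma holds_derived [simp]:
  "holds z d \<rho> (Disj \<phi> \<psi>) \<longleftrightarrow> holds z d \<rho> \<phi> \<or> holds z d \<rho> \<psi>"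
  "holds z d \<rho> (Impl \<phi> \<psi>) \<longleftrightarrow> (holds z d \<rho> \<phi> \<longrightarrow> holds z d \<rho> \<psi>)"
  "holds z d \<rho> (All e \<phi>) \<longleftrightarrow> (\<forall>i < val \<rho> e. holds z (Suc d) (\<rho>(d := i)) \<phi>)"
  "holds z d \<rho> (Le a b) \<longleftrightarrow> val \<rho> a \<le> val \<rho> b"
  "holds z d \<rho> (Eq a b) \<longleftrightarrow> val \<rho> a = val \<rho> b"
  "holds z d \<rho> (Iff \<phi> \<psi>) \<longleftrightarrow> (holds z d \<rho> \<phi> \<longleftrightarrow> holds z d \<rho> \<psi>)"
  by (auto simp: Disj_def Impl_def All_def Le_def Eq_def Iff_def)

definition outs :: "bool list \<Rightarrow> emission" where
  "outs bs = foldr Sq (map Out bs) Nop"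

lemma emitted_outs [simp]: "emitted z d \<rho> (outs bs) = bs"
  by (induction bs) (simp_all add: outs_def)

abbreviation hard_lang :: "bool list set" where
  "hard_lang \<equiv> regular_list_colouring 3
     (\<lambda>G. free_of (copies 3 (path_graph 1)) G \<and>
          free_of (disjoint_union (path_graph 1) (path_graph 2)) G)"

lemma hard_lang_iff:
  "w \<in> hard_lang \<longleftrightarrow> (\<exists>G L. encodes w G L \<and> simple_graph G \<and> near_complete G \<and>
     list_assignment G L \<and> regular_lists 3 G L \<and> (\<exists>c. colouring G c \<and> respects_lists G c L))"
  unfolding regular_list_colouring_def using near_complete_iff_free by fast

section \<open>Encoded instances and their certificates\<close>

definition encoding :: "nat \<Rightarrow> nat graph \<Rightarrow> (nat \<Rightarrow> nat list) \<Rightarrow> bool list" where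
  "encoding n G cs = concat (map (\<lambda>u. code (vertex_letters n G (cs u) u)) [0..<n])"

lemma code_concat: "code (concat xss) = concat (map code xss)"
  by (induction xss) auto

lemma encodes_iff:
  "encodes w G L \<longleftrightarrow> (\<exists>n cs. verts G = {..<n} \<and> (\<forall>u < n. distinct (cs u) \<and> set (cs u) = L u) \<and> w = encoding n G cs)"
  unfolding encodes_def encoding_def code_concat by (simp add: comp_def)

text \<open>In a certificate, \<open>T 0 v 0\<close> says that \<open>v\<close> is a vertex, \<open>T 1\<close> is the adjacency relation,
  \<open>T 2\<close>, \<open>T 3\<close> and \<open>T 4\<close> hold the binary digits of the three colours of the list of a vertex
  and \<open>T 5\<close> those of its chosen colour.\<close>

definition colour_bits :: "nat \<Rightarrow> (nat \<Rightarrow> bool) \<Rightarrow> bool list" where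
  "colour_bits M B = [True, False] @ digits M B"

text \<open>All loops, over vertices as well as over digits, run below the same bound
  \<open>M\<close>; \<open>T 0\<close> cuts the range of vertices down.\<close>

definition cert_word :: "nat \<Rightarrow> (nat \<Rightarrow> nat \<Rightarrow> nat \<Rightarrow> bool) \<Rightarrow> bool list" where
  "cert_word M T = concat (map (\<lambda>u. if T 0 u 0 then
      concat (map (\<lambda>v. if T 0 v 0 then [False, T 1 u v] else []) [0..<M]) @
      colour_bits M (T 2 u) @ colour_bits M (T 3 u) @ colour_bits M (T 4 u) @ [True, True] else []) [0..<M])"

text \<open>The first clause makes the vertices an initial segment, as the encoding requires; the
  last one is \<open>near_complete\<close>. Colours are compared digit by digit.\<close>

definition cert_ok :: "nat \<Rightarrow> (nat \<Rightarrow> nat \<Rightarrow> nat \<Rightarrow> bool) \<Rightarrow> bool" where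
  "cert_ok M T \<longleftrightarrow>
     (\<forall>u < M. \<forall>v < M. v \<le> u \<longrightarrow> T 0 u 0 \<longrightarrow> T 0 v 0) \<and>
     (\<forall>u < M. T 0 u 0 \<longrightarrow> \<not> T 1 u u \<and>
        (\<exists>q < M. T 2 u q) \<and> (\<exists>q < M. T 3 u q) \<and> (\<exists>q < M. T 4 u q) \<and>
        (\<exists>q < M. T 2 u q \<noteq> T 3 u q) \<and> (\<exists>q < M. T 2 u q \<noteq> T 4 u q) \<and> (\<exists>q < M. T 3 u q \<noteq> T 4 u q) \<and>
        ((\<forall>q < M. T 5 u q = T 2 u q) \<or> (\<forall>q < M. T 5 u q = T 3 u q) \<or> (\<forall>q < M. T 5 u q = T 4 u q))) \<and>
     (\<forall>u < M. \<forall>v < M. T 0 u 0 \<and> T 0 v 0 \<and> T 1 u v \<longrightarrow> T 1 v u \<and> (\<exists>q < M. T 5 u q \<noteq> T 5 v q)) \<and>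
     (\<forall>u < M. \<forall>v < M. \<forall>w < M. T 0 u 0 \<and> T 0 v 0 \<and> T 0 w 0 \<and> u \<noteq> v \<and> u \<noteq> w \<and> v \<noteq> w \<longrightarrow> T 1 u v \<or> T 1 u w)"

definition side :: expr where "side = Add (V 0) (C 1)"

definition tab :: "nat \<Rightarrow> expr \<Rightarrow> expr \<Rightarrow> form" where
  "tab t a b = InputBit (Add (Mul (Add (Mul (C t) side) a) side) b)"

definition table :: "nat \<Rightarrow> bool list \<Rightarrow> nat \<Rightarrow> nat \<Rightarrow> nat \<Rightarrow> bool" where
  "table M y t a b = bit_at y ((t * M + a) * M + b)"

text \<open>To be placed at depth 3, inside the loop over the vertex \<open>V 2\<close>;
  \<open>V 3\<close> is the current digit and \<open>V 4\<close> searches for a set digit at or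
  above it. A bit that was read is printed by a case distinction, since \<open>Out\<close> takes
  constants.\<close>

definition colour_emission :: "nat \<Rightarrow> emission" where
  "colour_emission t = Sq (outs [True, False]) (For side
     (Cond (Exi side (Conj (Le (V 3) (V 4)) (tab t (V 2) (V 4))))
        (Cond (tab t (V 2) (V 3)) (outs [False, True]) (outs [False, False])) Nop))"

definition cert_emission :: emission where
  "cert_emission = For side (Cond (tab 0 (V 2) (C 0))
     (Sq (For side (Cond (tab 0 (V 3) (C 0)) (Cond (tab 1 (V 2) (V 3)) (outs [False, True]) (outs [False, False])) Nop))
     (Sq (colour_emission 2) (Sq (colour_emission 3) (Sq (colour_emission 4) (outs [True, True]))))) Nop)"

definition differ :: "nat \<Rightarrow> nat \<Rightarrow> form" where
  "differ s t = Exi side (Neg (Iff (tab s (V 2) (V 3)) (tab t (V 2) (V 3))))"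

definition cert_form :: form where
  "cert_form = Conj
     (All side (All side (Impl (Le (V 3) (V 2)) (Impl (tab 0 (V 2) (C 0)) (tab 0 (V 3) (C 0))))))
     (Conj
     (All side (Impl (tab 0 (V 2) (C 0)) (Conj (Neg (tab 1 (V 2) (V 2)))
        (Conj (Exi side (tab 2 (V 2) (V 3))) (Conj (Exi side (tab 3 (V 2) (V 3))) (Conj (Exi side (tab 4 (V 2) (V 3)))
        (Conj (differ 2 3) (Conj (differ 2 4) (Conj (differ 3 4)
        (Disj (Neg (differ 5 2)) (Disj (Neg (differ 5 3)) (Neg (differ 5 4)))))))))))))
     (Conj
     (All side (All side (Impl (Conj (tab 0 (V 2) (C 0)) (Conj (tab 0 (V 3) (C 0)) (tab 1 (V 2) (V 3))))
        (Conj (tab 1 (V 3) (V 2)) (Exi side (Neg (Iff (tab 5 (V 2) (V 4)) (tab 5 (V 3) (V 4)))))))))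
     (All side (All side (All side (Impl
        (Conj (tab 0 (V 2) (C 0)) (Conj (tab 0 (V 3) (C 0)) (Conj (tab 0 (V 4) (C 0))
        (Conj (Neg (Eq (V 2) (V 3))) (Conj (Neg (Eq (V 2) (V 4))) (Neg (Eq (V 3) (V 4))))))))
        (Disj (tab 1 (V 2) (V 3)) (tab 1 (V 2) (V 4)))))))))"

lemma val_side [simp]: "val \<rho> side = Suc (\<rho> 0)"
  by (simp add: side_def)

lemma holds_tab [simp]: "holds (bit_at y) d \<rho> (tab t a b) \<longleftrightarrow> table (Suc (\<rho> 0)) y t (val \<rho> a) (val \<rho> b)"
  by (simp add: tab_def table_def)

lemma holds_cert_form: "holds (bit_at y) 2 (init_env w y) cert_form \<longleftrightarrow> cert_ok (Suc (length w)) (table (Suc (length w)) y)"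
  by (simp add: cert_form_def cert_ok_def differ_def init_env_def eval_nat_numeral)

lemma if_bits: "(if b then [False, True] else [False, False]) = [False, b]"
  by simp

lemma emitted_colour_emission:
  "emitted (bit_at y) 3 ((init_env w y)(2 := u)) (colour_emission t) = colour_bits (Suc (length w)) (table (Suc (length w)) y t u)"
  by (simp add: colour_emission_def colour_bits_def digits_def init_env_def eval_nat_numeral if_bits
      del: upt_Suc cong: if_cong)

lemma emitted_cert_emission: "emitted (bit_at y) 2 (init_env w y) cert_emission = cert_word (Suc (length w)) (table (Suc (length w)) y)"
proof -
  have "Suc 2 = 3" by simp
  then show ?thesis
    unfolding cert_emission_def cert_word_def emitted.simps \<open>Suc 2 = 3\<close> emitted_colour_emission
    by (simp add: init_env_def if_bits del: upt_Suc cong: if_cong)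
qed

text \<open>Only \<open>6 * M * M\<close> entries are ever read, so an arbitrary \<open>T\<close>
  may be replaced by the table of a certificate of that length.\<close>

lemma table_cong:
  assumes "\<And>t a b. t < 6 \<Longrightarrow> a < M \<Longrightarrow> b < M \<Longrightarrow> T t a b = T' t a b"
  shows "cert_ok M T = cert_ok M T'" "cert_word M T = cert_word M T'"
proof -
  have d: "digits M (T t u) = digits M (T' t u)" if "t < 6" "u < M" for t u
    unfolding digits_def using assms[OF that]
    by (intro arg_cong[of _ _ concat] map_cong) auto
  have a: "T 0 u 0 = T' 0 u 0" if "u < M" for u using assms[of 0 u 0] that by simp
  have b: "T 1 u v = T' 1 u v" "T 2 u v = T' 2 u v" "T 3 u v = T' 3 u v" "T 4 u v = T' 4 u v" "T 5 u v = T' 5 u v"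
    if "u < M" "v < M" for u v using assms that by simp_all
  show "cert_word M T = cert_word M T'"
    unfolding cert_word_def colour_bits_def
  proof (intro arg_cong[of _ _ concat] map_cong refl)
    fix u assume "u \<in> set [0..<M]"
    then have u: "u < M" by simp
    have "map (\<lambda>v. if T 0 v 0 then [False, T 1 u v] else []) [0..<M] =
        map (\<lambda>v. if T' 0 v 0 then [False, T' 1 u v] else []) [0..<M]"
      using a b(1)[OF u] by simp
    note m = this
    show "(if T 0 u 0 then concat (map (\<lambda>v. if T 0 v 0 then [False, T 1 u v] else []) [0..<M]) @
          ([True, False] @ digits M (T 2 u)) @ ([True, False] @ digits M (T 3 u)) @ ([True, False] @ digits M (T 4 u)) @ [True, True]
        else []) =
       (if T' 0 u 0 then concat (map (\<lambda>v. if T' 0 v 0 then [False, T' 1 u v] else []) [0..<M]) @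
          ([True, False] @ digits M (T' 2 u)) @ ([True, False] @ digits M (T' 3 u)) @ ([True, False] @ digits M (T' 4 u)) @ [True, True]
        else [])"
      unfolding m a[OF u] d[of 2 u, simplified, OF u] d[of 3 u, simplified, OF u] d[of 4 u, simplified, OF u] ..
  qed
  show "cert_ok M T = cert_ok M T'"
    unfolding cert_ok_def
    by (intro arg_cong2[of _ _ _ _ "(\<and>)"]; simp only: a b cong: conj_cong imp_cong)
qed

lemma table_exists:
  "\<exists>y. length y = 6 * M * M \<and> (\<forall>t < 6. \<forall>a < M. \<forall>b < M. table M y t a b = T t a b)"
proof -
  define y where "y = map (\<lambda>k. T (k div M div M) (k div M mod M) (k mod M)) [0..<6 * M * M]"
  have lt: "k * N + b < K * N" if "k < K" "b < N" for k b K N :: nat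
  proof -
    have "k * N + b < Suc k * N" using that by simp
    also have "\<dots> \<le> K * N" using that by (intro mult_le_mono1) simp
    finally show ?thesis .
  qed
  have "table M y t a b = T t a b" if "t < 6" "a < M" "b < M" for t a b
  proof -
    have "((t * M + a) * M + b) div M = t * M + a" "((t * M + a) * M + b) mod M = b"
      "(t * M + a) div M = t" "(t * M + a) mod M = a" using that by simp_all
    then show ?thesis using lt[OF lt[OF that(1,2)] that(3)] by (simp add: table_def bit_at_def y_def)
  qed
  then show ?thesis by (intro exI[of _ y]) (simp add: y_def)
qed

text \<open>The bound \<open>Suc (length w)\<close> is large enough for everything: each vertex
  contributes at least its semicolon to \<open>w\<close>, and each digit of a colour contributes a
  letter.\<close>

lemma certificate_exists:
  assumes "w \<in> hard_lang"
  shows "\<exists>T. cert_word (Suc (length w)) T = w \<and> cert_ok (Suc (length w)) T"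
proof -
  let ?M = "Suc (length w)"
  obtain G L c n cs where G: "simple_graph G" "near_complete G" and L: "list_assignment G L" "regular_lists 3 G L"
    and c: "colouring G c" "respects_lists G c L"
    and n: "verts G = {..<n}" and cs: "\<And>u. u < n \<Longrightarrow> distinct (cs u)" "\<And>u. u < n \<Longrightarrow> set (cs u) = L u"
    and w: "w = encoding n G cs"
    using assms unfolding hard_lang_iff encodes_iff by blast
  have len: "length (code ls) = 2 * length ls" for ls
  proof (induction ls)
    case (Cons l ls) then show ?case by (cases l) auto
  qed simp
  have lw: "length w = 2 * (\<Sum>u < n. length (vertex_letters n G (cs u) u))"
  proof -
    have "length w = sum_list (map (\<lambda>u. length (code (vertex_letters n G (cs u) u))) [0..<n])"
      unfolding w encoding_def by (simp only: length_concat map_map comp_def)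
    then show ?thesis
      by (simp add: len interv_sum_list_conv_sum_set_nat atLeast0LessThan sum_distrib_left)
  qed
  have "(\<Sum>u < n. 1) \<le> (\<Sum>u < n. length (vertex_letters n G (cs u) u))"
    by (rule sum_mono) (simp add: vertex_letters_def)
  then have nM: "n \<le> ?M" using lw by simp
  have small: "a < 2 ^ ?M" if "u < n" "a \<in> set (cs u)" for u a
  proof -
    have "length (Comma # map Bit (binary a)) \<le> sum_list (map length (map (\<lambda>a. Comma # map Bit (binary a)) (cs u)))"
      by (rule member_le_sum_list) (use that in auto)
    also have "\<dots> \<le> length (vertex_letters n G (cs u) u)" by (simp add: vertex_letters_def length_concat comp_def)
    also have "\<dots> \<le> (\<Sum>u < n. length (vertex_letters n G (cs u) u))"
      by (rule member_le_sum) (use that in auto)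
    finally have "length (binary a) \<le> ?M" using lw by simp
    then show ?thesis using less_power_binary[of a] by (meson less_le_trans one_le_numeral power_increasing)
  qed
  have cs3: "length (cs u) = 3" if "u < n" for u
    using L(2) cs[OF that] that n by (metis distinct_card lessThan_iff regular_lists_def)
  define bit where "bit a q \<longleftrightarrow> odd (a div 2 ^ q)" for a q :: nat
  have bit: "num (bit a) ?M = a" if "a < 2 ^ ?M" for a
    using num_bits[OF that] by (simp add: bit_def[abs_def])
  have bit_neq: "\<exists>q < ?M. bit a q \<noteq> bit b q" if "a \<noteq> b" "a < 2 ^ ?M" "b < 2 ^ ?M" for a b
    using that bit num_eq_iff[of "bit a" ?M "bit b"] by auto
  define T where "T t u v \<longleftrightarrow> (if t = 0 then u < n else if t = 1 then {u, v} \<in> edges G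
     else if t = 5 then bit (c u) v else bit (cs u ! (t - 2)) v)" for t u v :: nat
  have T: "T 0 u v = (u < n)" "T 1 u v = ({u, v} \<in> edges G)" "T 2 u = bit (cs u ! 0)" "T 3 u = bit (cs u ! 1)"
    "T 4 u = bit (cs u ! 2)" "T 5 u = bit (c u)" for u v by (auto simp: T_def fun_eq_iff)
  have csm: "cs u ! i \<in> set (cs u)" if "u < n" "i < 3" for u i using cs3 that by simp
  have cs_eq: "cs u = [cs u ! 0, cs u ! 1, cs u ! 2]" if "u < n" for u
    using cs3[OF that] by (auto simp: numeral_3_eq_3 length_Suc_conv numeral_2_eq_2)
  have "cert_word ?M T = encoding n G cs"
    unfolding cert_word_def encoding_def T concat_map_upto_filter[OF nM]
  proof (intro arg_cong[of _ _ concat] map_cong refl)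
    fix u assume "u \<in> set [0..<n]"
    then have u: "u < n" by simp
    have "code (vertex_letters n G (cs u) u) =
       concat (map (\<lambda>v. [False, {u, v} \<in> edges G]) [0..<n]) @
       code (concat (map (\<lambda>a. Comma # map Bit (binary a)) [cs u ! 0, cs u ! 1, cs u ! 2])) @ [True, True]"
      unfolding vertex_letters_def cs_eq[OF u, symmetric] by (simp add: comp_def)
    then show "concat (map (\<lambda>v. [False, {u, v} \<in> edges G]) [0..<n]) @
         colour_bits ?M (bit (cs u ! 0)) @ colour_bits ?M (bit (cs u ! 1)) @ colour_bits ?M (bit (cs u ! 2)) @ [True, True]
       = code (vertex_letters n G (cs u) u)"
      using bit[OF small[OF u csm[OF u]]] by (simp add: colour_bits_def digits_eq del: One_nat_def)
  qed
  moreover have "cert_ok ?M T"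
    unfolding cert_ok_def T
  proof (intro conjI allI impI)
    fix u assume u: "u < n"
    show "{u, u} \<notin> edges G" using G(1) by (auto simp: simple_graph_def)
    have pos: "\<exists>q < ?M. bit (cs u ! i) q" if "i < 3" for i
    proof -
      have "cs u ! i \<in> {1..}" using csm[OF u that] cs(2)[OF u] L(1) n u by (auto simp: list_assignment_def)
      then show ?thesis using num_eq_0[of "bit (cs u ! i)" ?M] bit[OF small[OF u csm[OF u that]]] by auto
    qed
    show "\<exists>q < ?M. bit (cs u ! 0) q" "\<exists>q < ?M. bit (cs u ! 1) q" "\<exists>q < ?M. bit (cs u ! 2) q"
      by (rule pos; simp)+
    have ne: "\<exists>q < ?M. bit (cs u ! i) q \<noteq> bit (cs u ! j) q" if "i < 3" "j < 3" "i \<noteq> j" for i j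
      using that cs(1)[OF u] cs3[OF u] small[OF u csm[OF u]] by (intro bit_neq) (auto simp: nth_eq_iff_index_eq)
    show "\<exists>q < ?M. bit (cs u ! 0) q \<noteq> bit (cs u ! 1) q" "\<exists>q < ?M. bit (cs u ! 0) q \<noteq> bit (cs u ! 2) q"
      "\<exists>q < ?M. bit (cs u ! 1) q \<noteq> bit (cs u ! 2) q"
      by (rule ne; simp)+
    have "c u \<in> set (cs u)" using c(2) cs(2)[OF u] u n by (auto simp: respects_lists_def)
    then have "c u \<in> set [cs u ! 0, cs u ! 1, cs u ! 2]" using cs_eq[OF u] by metis
    then show "(\<forall>q < ?M. bit (c u) q = bit (cs u ! 0) q) \<or> (\<forall>q < ?M. bit (c u) q = bit (cs u ! 1) q) \<or>
       (\<forall>q < ?M. bit (c u) q = bit (cs u ! 2) q)" by auto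
  next
    fix u v assume uv: "u < n \<and> v < n \<and> {u, v} \<in> edges G"
    then show "{v, u} \<in> edges G" by (simp add: insert_commute)
    have "c u \<in> set (cs u)" "c v \<in> set (cs v)" using c(2) cs(2) uv n by (auto simp: respects_lists_def)
    moreover have "c u \<noteq> c v" using c(1) uv n by (auto simp: colouring_def)
    ultimately show "\<exists>q < ?M. bit (c u) q \<noteq> bit (c v) q" using small uv by (intro bit_neq) auto
  next
    fix u v x assume "u < n \<and> v < n \<and> x < n \<and> u \<noteq> v \<and> u \<noteq> x \<and> v \<noteq> x"
    then show "{u, v} \<in> edges G \<or> {u, x} \<in> edges G" using G(2) n by (auto simp: near_complete_def)
  qed auto
  ultimately show "\<exists>T. cert_word ?M T = w \<and> cert_ok ?M T" using w by blast
qed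

lemma certificate_sound:
  assumes w: "cert_word (Suc (length w)) T = w" and ok: "cert_ok (Suc (length w)) T"
  shows "w \<in> hard_lang"
proof -
  let ?M = "Suc (length w)"
  note ok' = ok[unfolded cert_ok_def]
  note o1 = ok'[THEN conjunct1, rule_format]
  note o2 = ok'[THEN conjunct2, THEN conjunct1, rule_format]
  note o3 = ok'[THEN conjunct2, THEN conjunct2, THEN conjunct1, rule_format, OF _ _ conjI[OF _ conjI]]
  note o4 = ok'[THEN conjunct2, THEN conjunct2, THEN conjunct2, rule_format]
  \<comment> \<open>The first non-vertex, or the bound itself if there is none. As
    \<open>T 0\<close> is closed downwards, the vertices are exactly the numbers below
    \<open>n\<close>.\<close>
  define n where "n = (LEAST v. v = ?M \<or> \<not> T 0 v 0)"
  have nM: "n \<le> ?M" unfolding n_def by (rule Least_le) simp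
  have lo: "T 0 v 0" if "v < n" for v using not_less_Least[OF that[unfolded n_def]] by simp
  have n1: "n = ?M \<or> \<not> T 0 n 0" unfolding n_def by (rule LeastI[of _ ?M]) simp
  have N: "T 0 v 0 \<longleftrightarrow> v < n" if "v < ?M" for v
    using lo[of v] n1 o1[of v n] that by (metis linorder_not_less le_neq_implies_less nM)
  have ok1: "\<not> T 1 u u" "\<exists>q < ?M. T 2 u q" "\<exists>q < ?M. T 3 u q" "\<exists>q < ?M. T 4 u q"
    "\<exists>q < ?M. T 2 u q \<noteq> T 3 u q" "\<exists>q < ?M. T 2 u q \<noteq> T 4 u q" "\<exists>q < ?M. T 3 u q \<noteq> T 4 u q"
    "(\<forall>q < ?M. T 5 u q = T 2 u q) \<or> (\<forall>q < ?M. T 5 u q = T 3 u q) \<or> (\<forall>q < ?M. T 5 u q = T 4 u q)"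
    if "u < n" for u
  proof -
    have "u < ?M" using that nM by simp
    note o = o2[OF this lo[OF that]]
    show "\<not> T 1 u u" "\<exists>q < ?M. T 2 u q" "\<exists>q < ?M. T 3 u q" "\<exists>q < ?M. T 4 u q"
    "\<exists>q < ?M. T 2 u q \<noteq> T 3 u q" "\<exists>q < ?M. T 2 u q \<noteq> T 4 u q" "\<exists>q < ?M. T 3 u q \<noteq> T 4 u q"
    "(\<forall>q < ?M. T 5 u q = T 2 u q) \<or> (\<forall>q < ?M. T 5 u q = T 3 u q) \<or> (\<forall>q < ?M. T 5 u q = T 4 u q)"
      using o by - (elim conjE, assumption)+
  qed
  have ok2: "T 1 v u" "\<exists>q < ?M. T 5 u q \<noteq> T 5 v q" if "u < n" "v < n" "T 1 u v" for u v
    using o3[of u v] lo that nM by simp_all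
  have ok3: "T 1 u v \<or> T 1 u x" if "u < n" "v < n" "x < n" "u \<noteq> v" "u \<noteq> x" "v \<noteq> x" for u v x
    using o4[of u v x] lo that nM by simp
  define G :: "nat graph" where "G = ({..<n}, {{u, v} |u v. u < n \<and> v < n \<and> T 1 u v})"
  have V: "verts G = {..<n}" by (simp add: G_def)
  have E: "{u, v} \<in> edges G \<longleftrightarrow> T 1 u v" if "u < n" "v < n" for u v
    using that ok2(1) by (auto simp: G_def doubleton_eq_iff)
  define cs where "cs u = [num (T 2 u) ?M, num (T 3 u) ?M, num (T 4 u) ?M]" for u
  define c where "c u = num (T 5 u) ?M" for u
  have pos: "num B ?M \<ge> 1" if "\<exists>q < ?M. B q" for B
    using that num_eq_0[of B ?M] by (metis less_one not_le)
  have enc: "w = encoding n G cs"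
  proof -
    have f: "(if T 0 v 0 then (f v :: bool list) else []) = (if v < n then f v else [])" if "v \<in> set [0..<?M]" for v f
      using N[of v] that by (simp del: upt_Suc)
    have f1: "map (\<lambda>v. if T 0 v 0 then f v else []) [0..<?M] = map (\<lambda>v. if v < n then (f v :: bool list) else []) [0..<?M]" for f
      by (rule map_cong) (use f in auto)
    have "cert_word ?M T = concat (map (\<lambda>u. concat (map (\<lambda>v. [False, T 1 u v]) [0..<n]) @
       colour_bits ?M (T 2 u) @ colour_bits ?M (T 3 u) @ colour_bits ?M (T 4 u) @ [True, True]) [0..<n])"
      unfolding cert_word_def f1 concat_map_upto_filter[OF nM] ..
    also have "\<dots> = encoding n G cs"
      unfolding encoding_def
    proof (intro arg_cong[of _ _ concat] map_cong refl)
      fix u assume "u \<in> set [0..<n]"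
      then have u: "u < n" by simp
      have "map (\<lambda>v. [False, T 1 u v]) [0..<n] = map (\<lambda>v. [False, {u, v} \<in> edges G]) [0..<n]"
        using E[OF u] by simp
      note m = this
      show "concat (map (\<lambda>v. [False, T 1 u v]) [0..<n]) @
         colour_bits ?M (T 2 u) @ colour_bits ?M (T 3 u) @ colour_bits ?M (T 4 u) @ [True, True] =
         code (vertex_letters n G (cs u) u)"
        unfolding m by (simp add: vertex_letters_def comp_def colour_bits_def digits_eq cs_def)
    qed
    finally show ?thesis unfolding w .
  qed
  have cs: "distinct (cs u)" if "u < n" for u
    using ok1(5-7)[OF that] unfolding cs_def by (auto simp: num_eq_iff simp del: num.simps)
  have 1: "encodes w G (\<lambda>u. set (cs u))"
    unfolding encodes_iff using V cs enc by blast
  have 2: "simple_graph G"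
    unfolding simple_graph_def V
  proof (intro conjI ballI)
    fix e assume "e \<in> edges G"
    then obtain u v where e: "e = {u, v}" "u < n" "v < n" "T 1 u v" by (auto simp: G_def)
    then have "u \<noteq> v" using ok1(1) by blast
    then show "e \<subseteq> {..<n}" "card e = 2" using e by simp_all
  qed simp
  have 3: "near_complete G" unfolding near_complete_def V using ok3 E by simp
  have cs1: "a \<ge> 1" if "u < n" "a \<in> set (cs u)" for u a
  proof -
    have "\<forall>a \<in> set (cs u). a \<ge> 1"
      unfolding cs_def list.set using pos[OF ok1(2)[OF that(1)]] pos[OF ok1(3)[OF that(1)]] pos[OF ok1(4)[OF that(1)]]
      by blast
    then show ?thesis using that by blast
  qed
  have 4: "list_assignment G (\<lambda>u. set (cs u))"
    unfolding list_assignment_def V using cs1 by auto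
  have 5: "regular_lists 3 G (\<lambda>u. set (cs u))"
    unfolding regular_lists_def V
  proof (intro ballI conjI)
    fix u assume "u \<in> {..<n}"
    then have "card (set (cs u)) = length (cs u)" using cs by (simp add: distinct_card)
    then show "card (set (cs u)) = 3" by (simp add: cs_def)
  qed simp
  have 6: "c u \<in> set (cs u)" if "u < n" for u
    using ok1(8)[OF that] unfolding c_def cs_def list.set num_eq_iff[symmetric] by blast
  have 7: "c u \<noteq> c v" if "u < n" "v < n" "T 1 u v" for u v
    using ok2(2)[OF that] unfolding c_def num_eq_iff by blast
  have "colouring G c" unfolding colouring_def V using 6 7 cs1 E by simp
  moreover have "respects_lists G c (\<lambda>u. set (cs u))" unfolding respects_lists_def V using 6 by simp
  ultimately show ?thesis unfolding hard_lang_iff using 1 2 3 4 5 by blast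
qed

lemma hard_lang_certificate:
  "w \<in> hard_lang \<longleftrightarrow> (\<exists>T. cert_word (Suc (length w)) T = w \<and> cert_ok (Suc (length w)) T)"
  by (rule iffI, erule certificate_exists, elim exE conjE, rule certificate_sound)

theorem hard_lang_in_NP: "in_NP hard_lang"
proof (rule matching_in_NP)
  fix w :: "bool list"
  let ?M = "Suc (length w)"
  \<comment> \<open>This is \<open>6 * (m + 1) * (m + 1)\<close> for \<open>m = length w\<close>,
    the size of the six tables.\<close>
  let ?q = "[:6, 12, 6:] :: nat poly"
  have q: "poly ?q (length w) = 6 * ?M * ?M" by (simp add: algebra_simps)
  show "w \<in> hard_lang \<longleftrightarrow> (\<exists>y. length y \<le> poly ?q (length w) \<and>
     emitted (bit_at y) 2 (init_env w y) cert_emission = w \<and> holds (bit_at y) 2 (init_env w y) cert_form)"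
    unfolding hard_lang_certificate emitted_cert_emission holds_cert_form q
  proof
    assume "\<exists>T. cert_word ?M T = w \<and> cert_ok ?M T"
    then obtain T where T: "cert_word ?M T = w" "cert_ok ?M T" by blast
    obtain y where y: "length y = 6 * ?M * ?M" "\<And>t a b. t < 6 \<Longrightarrow> a < ?M \<Longrightarrow> b < ?M \<Longrightarrow> table ?M y t a b = T t a b"
      using table_exists[of ?M T] by blast
    show "\<exists>y. length y \<le> 6 * ?M * ?M \<and> cert_word ?M (table ?M y) = w \<and> cert_ok ?M (table ?M y)"
      using y(1) T table_cong[OF y(2)] by (intro exI[of _ y]) simp
  qed blast
qed

section \<open>Clauses as colours\<close>

lemma code_inj: "code ls = code ls' \<Longrightarrow> ls = ls'"
proof (induction ls arbitrary: ls')
  case Nil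
  then show ?case by (cases ls') (auto elim: letter_code.elims)
next
  case (Cons l ls)
  show ?case
  proof (cases ls')
    case Nil
    then show ?thesis using Cons.prems by (cases l) auto
  next
    case (Cons l' ls'')
    then show ?thesis using Cons.prems Cons.IH by (cases l; cases l') auto
  qed
qed

lemma terminated_eq:
  "r @ s # xs = r' @ s # xs' \<Longrightarrow> s \<notin> set r \<Longrightarrow> s \<notin> set r' \<Longrightarrow> r = r' \<and> xs = xs'"
proof (induction r arbitrary: r')
  case Nil
  then show ?case by (cases r') auto
next
  case (Cons a r)
  then show ?case by (cases r') auto
qed

text \<open>To be applied twice: semicolons separate the rows of vertices, and commas the colours of
  a list.\<close>

lemma terminated_inj:
  assumes "concat (map (\<lambda>r. r @ [s]) rs) = concat (map (\<lambda>r. r @ [s]) rs')"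
    and "\<And>r. r \<in> set rs \<Longrightarrow> s \<notin> set r" "\<And>r. r \<in> set rs' \<Longrightarrow> s \<notin> set r"
  shows "rs = rs'"
  using assms
proof (induction rs arbitrary: rs')
  case Nil
  then show ?case by (cases rs') auto
next
  case (Cons r rs)
  then obtain r' rs'' where rs': "rs' = r' # rs''" by (cases rs') auto
  have "r @ s # concat (map (\<lambda>r. r @ [s]) rs) = r' @ s # concat (map (\<lambda>r. r @ [s]) rs'')"
    using Cons.prems(1) rs' by simp
  then have "r = r' \<and> concat (map (\<lambda>r. r @ [s]) rs) = concat (map (\<lambda>r. r @ [s]) rs'')"
    by (rule terminated_eq) (simp_all add: Cons.prems(2,3) rs')
  then show ?case using Cons.IH[of rs''] Cons.prems(2,3) rs' by simp
qed

lemma binary_inj: "binary a = binary b \<Longrightarrow> a = b"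
proof (induction a arbitrary: b rule: binary.induct)
  case (1 a)
  show ?case
  proof (cases "a = 0 \<or> b = 0")
    case True
    then show ?thesis using 1(2) binary.simps[of a] binary.simps[of b] by (auto split: if_splits)
  next
    case False
    then have "odd a = odd b" "binary (a div 2) = binary (b div 2)"
      using 1(2) binary.simps[of a] binary.simps[of b] by auto
    then have "a mod 2 = b mod 2" "a div 2 = b div 2" using 1(1) False by (auto simp: odd_iff_mod_2_eq_one parity_cases)
    then show ?thesis by (metis div_mult_mod_eq)
  qed
qed

text \<open>Membership in the language only provides some instance encoded by the word. Unique
  readability identifies it with the instance that was encoded, without which the reduction would
  not be sound.\<close>

lemma encoding_inj:
  assumes "encoding n G cs = encoding n' G' cs'"
  shows "n = n'" "\<And>u. u < n \<Longrightarrow> cs u = cs' u" "\<And>u v. u < n \<Longrightarrow> v < n \<Longrightarrow> {u, v} \<in> edges G \<longleftrightarrow> {u, v} \<in> edges G'"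
proof -
  define row where "row n G cs u = map (\<lambda>v. Bit ({u, v} \<in> edges G)) [0..<n] @
     concat (map (\<lambda>a. Comma # map Bit (binary a)) (cs u))" for n and G :: "nat graph" and cs :: "nat \<Rightarrow> nat list" and u
  have enc: "encoding n G cs = code (concat (map (\<lambda>r. r @ [Semicolon]) (map (row n G cs) [0..<n])))" for n G cs
    unfolding encoding_def code_concat by (simp add: comp_def row_def vertex_letters_def)
  have semi: "Semicolon \<notin> set (row n G cs u)" for n G cs u by (auto simp: row_def)
  have rows: "map (row n G cs) [0..<n] = map (row n' G' cs') [0..<n']"
    by (rule terminated_inj[OF code_inj[OF assms[unfolded enc]]]) (auto simp: semi)
  then show n: "n = n'" by (metis length_map length_upt diff_zero)
  have row_eq: "row n G cs u = row n G' cs' u" if "u < n" for u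
  proof -
    have "map (row n G cs) [0..<n] ! u = map (row n' G' cs') [0..<n'] ! u" using rows by simp
    then show ?thesis using that n by simp
  qed
  \<comment> \<open>Commas precede the colours. One more comma at the end turns them into
    terminators, up to the first one, so \<open>terminated_inj\<close> applies.\<close>
  have comma: "concat (map (\<lambda>a. Comma # map Bit (binary a)) as) @ [Comma] =
     Comma # concat (map (\<lambda>r. r @ [Comma]) (map (\<lambda>a. map Bit (binary a)) as))" for as
    by (induction as) auto
  fix u assume u: "u < n"
  have 1: "map (\<lambda>v. Bit ({u, v} \<in> edges G)) [0..<n] = map (\<lambda>v. Bit ({u, v} \<in> edges G')) [0..<n]"
    and 2: "concat (map (\<lambda>a. Comma # map Bit (binary a)) (cs u)) = concat (map (\<lambda>a. Comma # map Bit (binary a)) (cs' u))"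
    using row_eq[OF u] unfolding row_def n[symmetric] by (simp_all add: append_eq_append_conv del: map_eq_conv)
  have "map (\<lambda>a. map Bit (binary a)) (cs u) = map (\<lambda>a. map Bit (binary a)) (cs' u)"
  proof (rule terminated_inj[of Comma])
    have "Comma # concat (map (\<lambda>r. r @ [Comma]) (map (\<lambda>a. map Bit (binary a)) (cs u))) =
      Comma # concat (map (\<lambda>r. r @ [Comma]) (map (\<lambda>a. map Bit (binary a)) (cs' u)))"
      unfolding comma[symmetric] 2 ..
    then show "concat (map (\<lambda>r. r @ [Comma]) (map (\<lambda>a. map Bit (binary a)) (cs u))) =
      concat (map (\<lambda>r. r @ [Comma]) (map (\<lambda>a. map Bit (binary a)) (cs' u)))" by (rule list.inject[THEN iffD1, THEN conjunct2])
  qed auto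
  moreover have "inj (\<lambda>a. map Bit (binary a))"
  proof (rule injI)
    fix a b assume "map Bit (binary a) = map Bit (binary b)"
    moreover have "inj Bit" by (rule injI) simp
    ultimately show "a = b" using binary_inj by (simp add: inj_map_eq_map)
  qed
  ultimately show "cs u = cs' u" by (simp only: inj_map_eq_map)
  show "{u, v} \<in> edges G \<longleftrightarrow> {u, v} \<in> edges G'" if "v < n" for v
    using 1 that by (auto simp: map_eq_conv)
qed

lemma encoding_in_hard_lang:
  assumes V: "verts G = {..<n}" and G: "simple_graph G" "near_complete G"
    and cs: "\<And>u. u < n \<Longrightarrow> distinct (cs u) \<and> length (cs u) = 3 \<and> set (cs u) \<subseteq> {1..}"
  shows "encoding n G cs \<in> hard_lang \<longleftrightarrow>
    (\<exists>c. (\<forall>u < n. c u \<in> set (cs u)) \<and> (\<forall>u < n. \<forall>v < n. {u, v} \<in> edges G \<longrightarrow> c u \<noteq> c v))"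
    (is "_ \<longleftrightarrow> (\<exists>c. ?P c)")
proof
  assume "encoding n G cs \<in> hard_lang"
  then obtain G' L n' cs' c where *: "verts G' = {..<n'}" "\<And>u. u < n' \<Longrightarrow> set (cs' u) = L u"
    "encoding n G cs = encoding n' G' cs'" "colouring G' c" "respects_lists G' c L"
    unfolding hard_lang_iff encodes_iff by blast
  note e = encoding_inj[OF *(3)]
  have "c u \<in> set (cs u)" if "u < n" for u
    using that e *(1,2,5) unfolding respects_lists_def by auto
  moreover have "c u \<noteq> c v" if "u < n" "v < n" "{u, v} \<in> edges G" for u v
    using that e *(1,4) unfolding colouring_def by auto
  ultimately show "\<exists>c. ?P c" by blast
next
  assume "\<exists>c. ?P c"
  then obtain c where c: "?P c" by blast
  have 1: "encodes (encoding n G cs) G (\<lambda>u. set (cs u))" unfolding encodes_iff using V cs by blast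
  have 2: "list_assignment G (\<lambda>u. set (cs u))" unfolding list_assignment_def V using cs by blast
  have 3: "regular_lists 3 G (\<lambda>u. set (cs u))" unfolding regular_lists_def V using cs by (simp add: distinct_card)
  have "c u \<ge> 1" if "u < n" for u using c cs[OF that] that by auto
  then have 4: "colouring G c" unfolding colouring_def V using c by simp
  have 5: "respects_lists G c (\<lambda>u. set (cs u))" unfolding respects_lists_def V using c by simp
  show "encoding n G cs \<in> hard_lang" unfolding hard_lang_iff using G 1 2 3 4 5 by blast
qed

section \<open>Clauses expressed by a selection of colours\<close>

type_synonym colour = "nat \<times> nat \<times> nat"
type_synonym lit = "bool \<times> nat"

text \<open>An empty clause stands for no condition.\<close>

definition satisfiable :: "nat \<Rightarrow> (nat \<Rightarrow> lit list) \<Rightarrow> bool" where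
  "satisfiable R cl \<longleftrightarrow> (\<exists>S. \<forall>r < R. cl r \<noteq> [] \<longrightarrow> (\<exists>(b, v) \<in> set (cl r). (v \<in> S) = b))"

text \<open>The tags are crossed: a true variable uses up the colours \<open>(2, v, _)\<close>,
  which leaves tag 3 to its positive literals.\<close>

definition lit_colour :: "nat \<Rightarrow> lit \<Rightarrow> colour" where
  "lit_colour r = (\<lambda>(b, u). (if b then 3 else 2, u, r))"

text \<open>The colours \<open>(0, v, _)\<close> and \<open>(1, v, _)\<close> form two chains, of which the one whose first colour is
  taken by the pair \<open>(v, 0, 2)\<close> is pushed forward along the pairs \<open>(v, r, k)\<close>, \<open>k < 2\<close>, and then takes the
  colours \<open>(2 + k, v, _)\<close>. A literal of the clause \<open>r\<close> can thus be picked by the pair \<open>(0, r, 3)\<close> only if it is true.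
  The pairs with \<open>k \<ge> 4\<close> use up the colours \<open>(4, v, r)\<close>, \<open>(5, v, r)\<close> and \<open>(6, v, r)\<close>, which pad the short lists.\<close>

definition palette :: "(nat \<Rightarrow> lit list) \<Rightarrow> nat \<Rightarrow> nat \<Rightarrow> nat \<Rightarrow> bool \<Rightarrow> colour list" where
  "palette cl v r k s =
     (if k < 2 then [(k, v, r), if s then (2 + k, v, r) else (k, v, Suc r), (4, v, r)]
      else if k = 2 then (if r = 0 then [(0, v, 0), (1, v, 0), (4, v, 0)] else [(7, v, r), (8, v, r), (9, v, r)])
      else if k = 3 then
        (if v = 0 \<and> cl r \<noteq> [] then take 3 (map (lit_colour r) (cl r) @ [(4, 0, r), (5, 0, r)])
         else [(10, v, r), (11, v, r), (12, v, r)])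
      else [(4, v, r), (5, v, r), (6, v, r)])"

lemma palette_simps:
  "k < 2 \<Longrightarrow> palette cl v r k s = [(k, v, r), if s then (2 + k, v, r) else (k, v, Suc r), (4, v, r)]"
  "palette cl v r 2 s = (if r = 0 then [(0, v, 0), (1, v, 0), (4, v, 0)] else [(7, v, r), (8, v, r), (9, v, r)])"
  "palette cl v r 3 s = (if v = 0 \<and> cl r \<noteq> [] then take 3 (map (lit_colour r) (cl r) @ [(4, 0, r), (5, 0, r)])
         else [(10, v, r), (11, v, r), (12, v, r)])"
  "4 \<le> k \<Longrightarrow> palette cl v r k s = [(4, v, r), (5, v, r), (6, v, r)]"
  by (auto simp: palette_def)

text \<open>The triple names a pair of non-adjacent vertices and the Boolean its member. Only
  different pairs have to differ; the two members of a pair may share a colour.\<close>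

definition selection :: "nat \<Rightarrow> nat \<Rightarrow> (nat \<Rightarrow> lit list) \<Rightarrow> (nat \<times> nat \<times> nat \<Rightarrow> bool \<Rightarrow> colour) \<Rightarrow> bool" where
  "selection N R cl c \<longleftrightarrow>
     (\<forall>v < N. \<forall>r < R. \<forall>k < 7. \<forall>s. c (v, r, k) s \<in> set (palette cl v r k s)) \<and>
     (\<forall>p \<in> {..<N} \<times> {..<R} \<times> {..<7}. \<forall>q \<in> {..<N} \<times> {..<R} \<times> {..<7}. \<forall>s s'. p \<noteq> q \<longrightarrow> c p s \<noteq> c q s')"

text \<open>A chain is forced link by link. Once \<open>(x, v, r)\<close> is used outside the pair
  \<open>(v, r, x)\<close>, the member \<open>True\<close> is left with \<open>(2 + x, v, r)\<close>
  and the member \<open>False\<close> with \<open>(x, v, Suc r)\<close>, which is thereby used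
  outside the next pair. A clause can then only pick a colour of the chain that was not pushed, that
  is, a true literal.\<close>

lemma selection_satisfiable:
  assumes c: "selection N R cl c" and N: "N \<ge> 1"
    and lits: "\<And>r b v. r < R \<Longrightarrow> (b, v) \<in> set (cl r) \<Longrightarrow> v < N"
  shows "satisfiable R cl"
proof -
  have mem: "c (v, r, k) s \<in> set (palette cl v r k s)" if "v < N" "r < R" "k < 7" for v r k s
    using c[unfolded selection_def, THEN conjunct1, rule_format] that by simp
  have disj: "c (v, r, k) s \<noteq> c (v', r', k') s'"
    if "v < N" "r < R" "k < 7" "v' < N" "r' < R" "k' < 7" "(v, r, k) \<noteq> (v', r', k')" for v r k v' r' k' s s'
    using c[unfolded selection_def, THEN conjunct2, rule_format, of "(v, r, k)" "(v', r', k')"] that by simp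
  \<comment> \<open>The pairs with \<open>k\<close> equal to 4, 5 and 6 have the same three colours
    and must differ from each other, so one member of each already exhausts these colours.\<close>
  have dead: "c (v', r', k) s \<noteq> (j, v, r)" if "v < N" "r < R" "v' < N" "r' < R" "k < 4" "j \<in> {4, 5, 6}" for v r v' r' k s j
  proof
    assume e: "c (v', r', k) s = (j, v, r)"
    have ne: "c (v, r, i) True \<noteq> (j, v, r)" if "i \<in> {4, 5, 6}" for i
      unfolding e[symmetric] using that \<open>v < N\<close> \<open>r < R\<close> \<open>v' < N\<close> \<open>r' < R\<close> \<open>k < 4\<close> by (intro disj) auto
    have in3: "c (v, r, i) True \<in> {(4, v, r), (5, v, r), (6, v, r)}" if "i \<in> {4, 5, 6}" for i
      using mem[of v r i True] that \<open>v < N\<close> \<open>r < R\<close> by (auto simp: palette_simps)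
    have d: "c (v, r, 4) True \<noteq> c (v, r, 5) True" "c (v, r, 4) True \<noteq> c (v, r, 6) True" "c (v, r, 5) True \<noteq> c (v, r, 6) True"
      using that by (intro disj; simp)+
    have "c (v, r, 4) True \<in> {(4, v, r), (5, v, r), (6, v, r)}" "c (v, r, 5) True \<in> {(4, v, r), (5, v, r), (6, v, r)}"
      "c (v, r, 6) True \<in> {(4, v, r), (5, v, r), (6, v, r)}" by (rule in3; simp)+
    moreover have "c (v, r, 4) True \<noteq> (j, v, r)" "c (v, r, 5) True \<noteq> (j, v, r)" "c (v, r, 6) True \<noteq> (j, v, r)"
      by (rule ne; simp)+
    ultimately show False using d \<open>j \<in> {4, 5, 6}\<close> by auto
  qed
  \<comment> \<open>What is passed on is only that somebody outside the pair uses
    \<open>(x, v, r)\<close>: at the start the pair \<open>(v, 0, 2)\<close>, later the preceding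
    link.\<close>
  have chain: "(\<exists>v' r' k' s'. v' < N \<and> r' < R \<and> k' < 7 \<and> (v', r', k') \<noteq> (v, r, x) \<and> c (v', r', k') s' = (x, v, r)) \<and>
      c (v, r, x) True = (2 + x, v, r)"
    if "v < N" "x < 2" "c (v, 0, 2) True = (x, v, 0)" "r < R" for v x r
    using that(4)
  proof (induction r)
    case 0
    have "c (v, 0, x) True \<noteq> (x, v, 0)"
      unfolding that(3)[symmetric] using that(1,2) 0 by (intro disj) auto
    moreover have "c (v, 0, x) True \<noteq> (4, v, 0)" using that(1,2) 0 by (intro dead) auto
    ultimately have 1: "c (v, 0, x) True = (2 + x, v, 0)"
      using mem[of v 0 x True] that(1,2) 0 by (auto simp: palette_simps)
    have "v < N \<and> 0 < R \<and> (2 :: nat) < 7 \<and> (v, 0, 2) \<noteq> (v, 0, x) \<and> c (v, 0, 2) True = (x, v, 0)"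
      using that(1-3) 0 by simp
    then show ?case using 1 by blast
  next
    case (Suc r)
    then obtain v' r' k' s' where q: "v' < N" "r' < R" "k' < 7" "(v', r', k') \<noteq> (v, r, x)" "c (v', r', k') s' = (x, v, r)"
      by (meson Suc_lessD)
    have "c (v, r, x) False \<noteq> (x, v, r)" unfolding q(5)[symmetric] using that(1,2) q Suc.prems by (intro disj) auto
    moreover have "c (v, r, x) False \<noteq> (4, v, r)" using that(1,2) Suc.prems by (intro dead) auto
    ultimately have f: "c (v, r, x) False = (x, v, Suc r)"
      using mem[of v r x False] that(1,2) Suc.prems by (auto simp: palette_simps)
    have "c (v, Suc r, x) True \<noteq> (x, v, Suc r)"
      unfolding f[symmetric] using that(1,2) Suc.prems by (intro disj) auto
    moreover have "c (v, Suc r, x) True \<noteq> (4, v, Suc r)" using that(1,2) Suc.prems by (intro dead) auto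
    ultimately have 1: "c (v, Suc r, x) True = (2 + x, v, Suc r)"
      using mem[of v "Suc r" x True] that(1,2) Suc.prems by (auto simp: palette_simps)
    have "v < N \<and> r < R \<and> x < 7 \<and> (v, r, x) \<noteq> (v, Suc r, x) \<and> c (v, r, x) False = (x, v, Suc r)"
      using f that(1,2) Suc.prems by simp
    then show ?case using 1 by blast
  qed
  \<comment> \<open>One member of the pair \<open>(v, 0, 2)\<close> decides. Its third colour is
    dead, so if it does not push chain 0 it pushes chain 1.\<close>
  define S where "S = {v. c (v, 0, 2) True = (0, v, 0)}"
  have "\<exists>(b, v) \<in> set (cl r). (v \<in> S) = b" if r: "r < R" "cl r \<noteq> []" for r
  proof -
    have "c (0, r, 3) True \<in> set (map (lit_colour r) (cl r) @ [(4, 0, r), (5, 0, r)])"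
      using mem[of 0 r 3 True] r N by (auto simp: palette_simps dest: in_set_takeD)
    moreover have "c (0, r, 3) True \<noteq> (4, 0, r)" "c (0, r, 3) True \<noteq> (5, 0, r)"
      using r N by (intro dead; simp)+
    ultimately obtain b u where bu: "(b, u) \<in> set (cl r)" "c (0, r, 3) True = (if b then 3 else 2, u, r)"
      by (auto simp: lit_colour_def)
    have u: "u < N" using lits bu r by blast
    have start: "c (u, 0, 2) True = (0, u, 0) \<or> c (u, 0, 2) True = (1, u, 0)"
      using mem[of u 0 2 True] dead[of u 0 u 0 2 4 True] u r by (auto simp: palette_simps)
    have ne: "c (u, r, x) True \<noteq> (if b then 3 else 2, u, r)" if "x < 2" for x
      unfolding bu(2)[symmetric] using that u r N by (intro disj) auto
    have "(u \<in> S) = b"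
    proof (cases "u \<in> S")
      case True
      then have "c (u, r, 0) True = (2, u, r)" using chain[of u 0 r] u r by (simp add: S_def)
      then show ?thesis using ne[of 0] True by (cases b) auto
    next
      case False
      then have "c (u, r, 1) True = (3, u, r)" using chain[of u 1 r] u r start by (simp add: S_def)
      then show ?thesis using ne[of 1] False by (cases b) auto
    qed
    then show ?thesis using bu(1) by blast
  qed
  then show ?thesis unfolding satisfiable_def by blast
qed

text \<open>The chain \<open>x v\<close> is pushed; in the other one both members of every pair
  share \<open>(k, v, r)\<close>. This leaves the colours \<open>(3 - x v, v, _)\<close>, those of
  the true literals, for the clauses to pick from.\<close>

lemma satisfiable_selection:
  assumes "satisfiable R cl" and len: "\<And>r. r < R \<Longrightarrow> length (cl r) \<le> 3"
  shows "\<exists>c. selection N R cl c"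
proof -
  obtain S where S: "\<And>r. r < R \<Longrightarrow> cl r \<noteq> [] \<Longrightarrow> \<exists>(b, v) \<in> set (cl r). (v \<in> S) = b"
    using assms(1) unfolding satisfiable_def by blast
  have "\<exists>l. l \<in> set (cl r) \<and> (snd l \<in> S) = fst l" if "r < R" "cl r \<noteq> []" for r
    using S[OF that] by force
  then obtain l where l: "\<And>r. r < R \<Longrightarrow> cl r \<noteq> [] \<Longrightarrow> l r \<in> set (cl r) \<and> (snd (l r) \<in> S) = fst (l r)"
    by metis
  define x :: "nat \<Rightarrow> nat" where "x v = (if v \<in> S then 0 else 1)" for v
  define c :: "nat \<times> nat \<times> nat \<Rightarrow> bool \<Rightarrow> colour" where
    "c = (\<lambda>(v, r, k) s.
       if k < 2 then (if k = x v then (if s then (2 + k, v, r) else (k, v, Suc r)) else (k, v, r))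
       else if k = 2 then (if r = 0 then (x v, v, 0) else (7, v, r))
       else if k = 3 then (if v = 0 \<and> cl r \<noteq> [] then lit_colour r (l r) else (10, v, r))
       else (k, v, r))"
  \<comment> \<open>\<open>own\<close> sends a colour back to the pair that uses it. One left
    inverse proves all required differences at once.\<close>
  define own :: "colour \<Rightarrow> nat \<times> nat \<times> nat" where
    "own = (\<lambda>(t, v, r).
       if t < 2 then (if t = x v then (if r = 0 then (v, 0, 2) else (v, r - 1, t)) else (v, r, t))
       else if t < 4 then (if t - 2 = x v then (v, r, t - 2) else (0, r, 3))
       else if t = 7 then (v, r, 2)
       else if t = 10 then (v, r, 3)
       else (v, r, t))"
  have own: "own (c (v, r, k) s) = (v, r, k)" if "v < N" "r < R" "k < 7" for v r k s
  proof -
    consider "k < 2" | "k = 2" | "k = 3" | "k = 4" | "k = 5" | "k = 6" using \<open>k < 7\<close> by linarith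
    then show ?thesis
    proof cases
      case 3
      show ?thesis
      proof (cases "v = 0 \<and> cl r \<noteq> []")
        case True
        obtain b u where bu: "l r = (b, u)" by force
        then have "(u \<in> S) = b" using l[of r] that(2) True by auto
        then show ?thesis using 3 True bu by (auto simp: c_def own_def lit_colour_def x_def)
      qed (use 3 in \<open>auto simp: c_def own_def\<close>)
    qed (auto simp: c_def own_def x_def)
  qed
  have "c (v, r, k) s \<in> set (palette cl v r k s)" if "v < N" "r < R" "k < 7" for v r k s
  proof -
    consider "k < 2" | "k = 2" | "k = 3" | "k = 4" | "k = 5" | "k = 6" using \<open>k < 7\<close> by linarith
    then show ?thesis
    proof cases
      case 3
      have "lit_colour r (l r) \<in> set (palette cl v r k s)" if "v = 0 \<and> cl r \<noteq> []"
        using that 3 l[OF \<open>r < R\<close>] len[OF \<open>r < R\<close>] by (auto simp: palette_simps)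
      then show ?thesis using 3 by (auto simp: c_def palette_simps)
    qed (auto simp: c_def palette_simps x_def)
  qed
  moreover have "c p s \<noteq> c q s'" if "p \<in> {..<N} \<times> {..<R} \<times> {..<7}" "q \<in> {..<N} \<times> {..<R} \<times> {..<7}" "p \<noteq> q" for p q s s'
  proof -
    have "own (c p s) = p" "own (c q s') = q" using that(1,2) own by auto
    then show ?thesis using that(3) by metis
  qed
  ultimately show ?thesis unfolding selection_def by (intro exI[of _ c]) blast
qed

section \<open>Tableaux of Turing machines\<close>

text \<open>Halting states are made to idle, so the same clauses describe the run before and after
  halting, and acceptance can be tested at one fixed time.\<close>

definition trans :: "tm \<Rightarrow> nat \<Rightarrow> nat list \<Rightarrow> nat \<times> (nat \<times> move) list" where
  "trans M q as = (if q = accept M \<or> q = reject M then (q, idle as) else delta M q as)"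

definition scanned :: "config \<Rightarrow> nat list" where
  "scanned c = map (\<lambda>(h, t). t h) (snd c)"

lemma step_trans:
  "step M c = (fst (trans M (fst c) (scanned c)), map2 act (snd (trans M (fst c) (scanned c))) (snd c))"
  by (cases c) (auto simp: trans_def scanned_def halted_def map2_idle split_beta)

definition proper :: "tm \<Rightarrow> config \<Rightarrow> bool" where
  "proper M c \<longleftrightarrow> fst c < nstates M \<and> length (snd c) = ntapes M \<and>
     (\<forall>j < ntapes M. \<forall>z. snd (snd c ! j) z < nsyms M)"

definition symbols :: "tm \<Rightarrow> nat list \<Rightarrow> bool" where
  "symbols M as \<longleftrightarrow> length as = ntapes M \<and> set as \<subseteq> {..<nsyms M}"

lemma scanned_symbols:
  assumes "proper M c"
  shows "symbols M (scanned c)"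
proof -
  have l: "length (snd c) = ntapes M" using assms by (simp add: proper_def)
  have "scanned c ! j < nsyms M" if "j < ntapes M" for j
  proof -
    have "scanned c ! j = snd (snd c ! j) (fst (snd c ! j))"
      using that l by (simp add: scanned_def split_beta)
    then show ?thesis using assms that by (simp add: proper_def)
  qed
  moreover have "length (scanned c) = ntapes M" using l by (simp add: scanned_def)
  ultimately show ?thesis unfolding symbols_def by (metis in_set_conv_nth lessThan_iff subsetI)
qed

lemma trans_wf:
  assumes "wf_tm M" "q < nstates M" "symbols M as"
  shows "fst (trans M q as) < nstates M" "length (snd (trans M q as)) = ntapes M"
    "\<And>j. j < ntapes M \<Longrightarrow> fst (snd (trans M q as) ! j) < nsyms M"
proof -
  have *: "fst (trans M q as) < nstates M \<and> length (snd (trans M q as)) = ntapes M \<and>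
      fst ` set (snd (trans M q as)) \<subseteq> {..<nsyms M}"
  proof (cases "q = accept M \<or> q = reject M")
    case True
    then show ?thesis using assms(2,3) by (auto simp: trans_def idle_def symbols_def)
  next
    case False
    have "case delta M q as of (q', acts) \<Rightarrow>
           q' < nstates M \<and> length acts = ntapes M \<and> fst ` set acts \<subseteq> {..<nsyms M}"
    proof -
      have "\<forall>q as. q < nstates M \<and> length as = ntapes M \<and> set as \<subseteq> {..<nsyms M} \<longrightarrow>
        (case delta M q as of (q', acts) \<Rightarrow>
           q' < nstates M \<and> length acts = ntapes M \<and> fst ` set acts \<subseteq> {..<nsyms M})"
        using assms(1) unfolding wf_tm_def by (elim conjE)
      then show ?thesis using assms(2,3) unfolding symbols_def by simp
    qed
    then show ?thesis using False by (simp add: trans_def split_beta)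
  qed
  then show "fst (trans M q as) < nstates M" "length (snd (trans M q as)) = ntapes M" by blast+
  fix j assume "j < ntapes M"
  then have "snd (trans M q as) ! j \<in> set (snd (trans M q as))" using * by simp
  then show "fst (snd (trans M q as) ! j) < nsyms M" using * by blast
qed

lemma act_cell: "snd (act (a, m) T) z = (if z = fst T then a else snd T z)" "fst (act (a, m) T) = fst T + offset m"
  by (cases T; simp)+

lemma proper_step:
  assumes "wf_tm M" "proper M c"
  shows "proper M (step M c)"
proof -
  note t = trans_wf[OF assms(1) _ scanned_symbols[OF assms(2)], of "fst c"]
  have c: "fst c < nstates M" "length (snd c) = ntapes M" using assms(2) by (auto simp: proper_def)
  have "snd (snd (step M c) ! j) z < nsyms M" if "j < ntapes M" for j z
  proof -
    obtain a m where am: "snd (trans M (fst c) (scanned c)) ! j = (a, m)" by force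
    have "snd (step M c) ! j = act (a, m) (snd c ! j)"
      using that t(2)[OF c(1)] c(2) am by (simp add: step_trans)
    then show ?thesis using assms(2) that t(3)[OF c(1) that] am
      by (simp add: act_cell proper_def)
  qed
  then show ?thesis using t c unfolding proper_def by (simp add: step_trans)
qed

lemma proper_run:
  assumes "wf_tm M"
  shows "proper M (run M xs t)"
proof (induction t)
  case 0
  have "word_cells w z < nsyms M" for w z using assms by (auto simp: word_cells_def wf_tm_def)
  then show ?case using assms by (auto simp: run_def init_config_def proper_def wf_tm_def)
next
  case (Suc t)
  then show ?case using proper_step[OF assms] by (simp add: run_def)
qed

lemma run_Suc: "run M xs (Suc t) = step M (run M xs t)"
  by (simp add: run_def)

text \<open>The tapes are recorded relative to their heads: position \<open>i\<close> is the cell at distance \<open>i - W\<close>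
  from the head, so a move of the head shifts the tape. \<open>KC j a\<close> says that a position of tape \<open>j\<close>
  holds \<open>a\<close>, and \<open>KE q as\<close> that the state is \<open>q\<close> and the first heads scan \<open>as\<close>.\<close>

datatype kind = KC nat nat | KE nat "nat list"

definition cell :: "nat \<Rightarrow> config \<Rightarrow> nat \<Rightarrow> nat \<Rightarrow> nat" where
  "cell W c j i = snd (snd c ! j) (fst (snd c ! j) + int i - int W)"

text \<open>Seen from the head, the tape moves the opposite way. The truncation of
  \<open>i - 1\<close> does no harm: the clauses apply \<open>shift\<close> only at positions from 1
  on.\<close>

fun shift :: "move \<Rightarrow> nat \<Rightarrow> nat" where
  "shift Left i = Suc i"
| "shift Stay i = i"
| "shift Right i = i - 1"

datatype schema =
    Push nat nat "nat list" nat
  | Head nat nat "nat list"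
  | Next nat "nat list"
  | Scan nat "nat list" nat
  | Start
  | Inp nat
  | Rest nat
  | Tail nat
  | Final nat

type_synonym slit = "bool \<times> kind \<times> nat \<times> nat"

text \<open>Three literals suffice because the scanned symbols are gathered tape by tape:
  \<open>Scan\<close> extends the prefix in \<open>KE\<close>, and \<open>Push\<close>,
  \<open>Head\<close> and \<open>Next\<close> rely on the complete one. On the first
  \<open>p\<close> cells of tape 1 from the head on, \<open>Rest\<close> leaves the symbol open, and
  \<open>Tail\<close> lets no bit follow a blank, so that what is guessed is a word. The window has
  \<open>2 * T + 3\<close> positions with the head at \<open>T + 1\<close>.\<close>

primrec clause :: "tm \<Rightarrow> bool list \<Rightarrow> nat \<Rightarrow> nat \<Rightarrow> schema \<Rightarrow> nat \<Rightarrow> nat \<Rightarrow> slit list" where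
  "clause M x p T (Push j q as a) t i =
     (if 1 \<le> i \<and> i < 2 * T + 2 \<and> i \<noteq> T + 1
      then [(False, KE q as, t, 0), (False, KC j a, t, i), (True, KC j a, Suc t, shift (snd (snd (trans M q as) ! j)) i)] else [])"
| "clause M x p T (Head j q as) t i =
     [(False, KE q as, t, 0), (True, KC j (fst (snd (trans M q as) ! j)), Suc t, shift (snd (snd (trans M q as) ! j)) (T + 1))]"
| "clause M x p T (Next q as) t i = [(False, KE q as, t, 0), (True, KE (fst (trans M q as)) [], Suc t, 0)]"
| "clause M x p T (Scan q as a) t i =
     [(False, KE q as, t, 0), (False, KC (length as) a, t, T + 1), (True, KE q (as @ [a]), t, 0)]"
| "clause M x p T Start t i = [(True, KE (start M) [], 0, 0)]"
| "clause M x p T (Inp a) t i = (if word_cells x (int i - int (T + 1)) = a then [(True, KC 0 a, 0, i)] else [])"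
| "clause M x p T (Rest j) t i =
     (if j = 1 \<and> T + 1 \<le> i \<and> i < T + 1 + p then [(True, KC 1 0, 0, i), (True, KC 1 1, 0, i), (True, KC 1 2, 0, i)]
      else [(True, KC j 0, 0, i)])"
| "clause M x p T (Tail b) t i =
     (if T + 1 \<le> i \<and> i < 2 * T + 2 then [(False, KC 1 0, 0, i), (False, KC 1 b, 0, Suc i)] else [])"
| "clause M x p T (Final q) t i = [(False, KE q [], T, 0)]"

definition schemas :: "tm \<Rightarrow> schema set" where
  "schemas M =
     {Push j q as a |j q as a. j < ntapes M \<and> q < nstates M \<and> symbols M as \<and> a < nsyms M} \<union>
     {Head j q as |j q as. j < ntapes M \<and> q < nstates M \<and> symbols M as} \<union>
     {Next q as |q as. q < nstates M \<and> symbols M as} \<union>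
     {Scan q as a |q as a. q < nstates M \<and> length as < ntapes M \<and> set as \<subseteq> {..<nsyms M} \<and> a < nsyms M} \<union>
     {Start} \<union> {Inp a |a. a < 3} \<union> {Rest j |j. 1 \<le> j \<and> j < ntapes M} \<union> {Tail 1, Tail 2} \<union>
     {Final q |q. q < nstates M \<and> q \<noteq> accept M}"

definition kinds :: "tm \<Rightarrow> kind set" where
  "kinds M = {KC j a |j a. j < ntapes M \<and> a < nsyms M} \<union>
     {KE q as |q as. q < nstates M \<and> length as \<le> ntapes M \<and> set as \<subseteq> {..<nsyms M}}"

lemma finite_lists: "finite {as. set as \<subseteq> {..<s :: nat} \<and> length as \<le> k}"
  by (rule finite_lists_length_le) simp

lemma finite_kinds: "finite (kinds M)"
proof -
  have "kinds M \<subseteq> (\<lambda>(j, a). KC j a) ` ({..<ntapes M} \<times> {..<nsyms M}) \<union>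
     (\<lambda>(q, as). KE q as) ` ({..<nstates M} \<times> {as. set as \<subseteq> {..<nsyms M} \<and> length as \<le> ntapes M})"
    by (force simp: kinds_def)
  then show ?thesis by (rule finite_subset) (simp add: finite_lists)
qed

lemma finite_schemas: "finite (schemas M)"
proof -
  let ?L = "{as. set as \<subseteq> {..<nsyms M} \<and> length as \<le> ntapes M}"
  have "schemas M \<subseteq> (\<lambda>(j, q, as, a). Push j q as a) ` ({..<ntapes M} \<times> {..<nstates M} \<times> ?L \<times> {..<nsyms M}) \<union>
     (\<lambda>(j, q, as). Head j q as) ` ({..<ntapes M} \<times> {..<nstates M} \<times> ?L) \<union>
     (\<lambda>(q, as). Next q as) ` ({..<nstates M} \<times> ?L) \<union>
     (\<lambda>(q, as, a). Scan q as a) ` ({..<nstates M} \<times> ?L \<times> {..<nsyms M}) \<union>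
     {Start} \<union> Inp ` {..<3} \<union> Rest ` {..<ntapes M} \<union> {Tail 1, Tail 2} \<union> Final ` {..<nstates M}"
    unfolding schemas_def symbols_def by (intro Un_mono subset_refl) force+
  then show ?thesis by (rule finite_subset) (simp add: finite_lists)
qed

definition models :: "(kind \<Rightarrow> nat \<Rightarrow> nat \<Rightarrow> bool) \<Rightarrow> slit list \<Rightarrow> bool" where
  "models U ls \<longleftrightarrow> (ls \<noteq> [] \<longrightarrow> (\<exists>(b, kd, t, i) \<in> set ls. U kd t i = b))"

lemma cell_step:
  assumes "wf_tm M" "proper M c" "j < ntapes M" "(a, m) = snd (trans M (fst c) (scanned c)) ! j"
    and "m = Right \<Longrightarrow> 1 \<le> i"
  shows "cell W (step M c) j (shift m i) = (if i = W then a else cell W c j i)"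
proof -
  have "length (snd (trans M (fst c) (scanned c))) = ntapes M"
    using trans_wf(2)[OF assms(1) _ scanned_symbols[OF assms(2)]] assms(2) by (simp add: proper_def)
  moreover have "length (snd c) = ntapes M" using assms(2) by (simp add: proper_def)
  ultimately have s: "snd (step M c) ! j = act (a, m) (snd c ! j)"
    using assms(3,4) by (simp add: step_trans)
  have "int (shift m i) + offset m = int i" using assms(5) by (cases m) auto
  then have z: "fst (snd c ! j) + offset m + int (shift m i) - int W = fst (snd c ! j) + int i - int W" by simp
  show ?thesis unfolding cell_def s act_cell z by auto
qed

lemma cell_scanned: "j < length (snd c) \<Longrightarrow> cell W c j W = scanned c ! j"
  by (simp add: cell_def scanned_def split_beta)

lemma cell_init:
  assumes "j < ntapes M"
  shows "cell W (run M [x, y] 0) j i = word_cells (if j = 0 then x else if j = 1 then y else []) (int i - int W)"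
proof -
  have "snd (run M [x, y] 0) ! j = (0, word_cells (if j = 0 then x else if j = 1 then y else []))"
    using assms by (auto simp: run_def init_config_def nth_Cons split: nat.split)
  then show ?thesis by (simp add: cell_def)
qed

lemma tableau_complete:
  assumes M: "wf_tm M" "ntapes M \<ge> 2" and y: "length y \<le> p" and acc: "fst (run M [x, y] T) = accept M"
  shows "\<exists>U. \<forall>sc \<in> schemas M. \<forall>t < T. \<forall>i < 2 * T + 3. models U (clause M x p T sc t i)"
proof -
  define c where "c = run M [x, y]"
  define U where "U kd t i = (case kd of KC j a \<Rightarrow> cell (T + 1) (c t) j i = a
     | KE q as \<Rightarrow> fst (c t) = q \<and> take (length as) (scanned (c t)) = as)" for kd t i
  have U: "U (KC j a) t i \<longleftrightarrow> cell (T + 1) (c t) j i = a"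
    "U (KE q as) t i \<longleftrightarrow> fst (c t) = q \<and> take (length as) (scanned (c t)) = as" for j a q as t i
    by (simp_all add: U_def)
  have proper: "proper M (c t)" for t unfolding c_def using proper_run[OF M(1)] .
  have len: "length (scanned (c t)) = ntapes M" "length (snd (c t)) = ntapes M" for t
    using scanned_symbols[OF proper] proper by (simp_all add: symbols_def proper_def)
  have with_init: "U (KE q as) t 0 \<Longrightarrow> symbols M as \<Longrightarrow> fst (c t) = q \<and> scanned (c t) = as" for q as t
    by (simp add: U symbols_def len)
  have cSuc: "c (Suc t) = step M (c t)" for t by (simp add: c_def run_Suc)
  have "models U (clause M x p T sc t i)" if sc: "sc \<in> schemas M" and ti: "t < T" "i < 2 * T + 3" for sc t i
  proof (cases sc)
    case (Push j q as a)
    have "U (KC j a) (Suc t) (shift (snd (snd (trans M q as) ! j)) i)"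
      if "1 \<le> i" "i \<noteq> T + 1" "U (KE q as) t 0" "U (KC j a) t i"
      using cell_step[OF M(1) proper, of j "fst (snd (trans M q as) ! j)" "snd (snd (trans M q as) ! j)" t i "T + 1"]
        with_init[OF that(3)] that sc Push by (simp add: U cSuc schemas_def)
    then show ?thesis using Push by (auto simp: models_def)
  next
    case (Head j q as)
    have "U (KC j (fst (snd (trans M q as) ! j))) (Suc t) (shift (snd (snd (trans M q as) ! j)) (T + 1))"
      if "U (KE q as) t 0"
      using cell_step[OF M(1) proper, of j "fst (snd (trans M q as) ! j)" "snd (snd (trans M q as) ! j)" t "T + 1" "T + 1"]
        with_init[OF that] that sc Head by (simp add: U cSuc schemas_def)
    then show ?thesis using Head by (auto simp: models_def)
  next
    case (Next q as)
    have "U (KE (fst (trans M q as)) []) (Suc t) 0" if "U (KE q as) t 0"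
      using with_init[OF that] sc Next by (simp add: U cSuc schemas_def step_trans)
    then show ?thesis using Next by (auto simp: models_def)
  next
    case (Scan q as a)
    then have l: "length as < ntapes M" using sc by (simp add: schemas_def)
    have "U (KE q (as @ [a])) t 0" if "U (KE q as) t 0" "U (KC (length as) a) t (T + 1)"
      using that l by (simp add: U cell_scanned len take_Suc_conv_app_nth)
    then show ?thesis using Scan by (auto simp: models_def)
  next
    case Start
    have "U (KE (start M) []) 0 0" by (simp add: U c_def run_def init_config_def)
    then show ?thesis using Start by (auto simp: models_def)
  next
    case (Inp a)
    have "U (KC 0 a) 0 i" if "word_cells x (int i - int (T + 1)) = a"
      unfolding U c_def using cell_init[of 0 M "T + 1" x y i] M(2) that by simp
    then show ?thesis using Inp by (auto simp: models_def)
  next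
    case (Rest j)
    then have j: "1 \<le> j" "j < ntapes M" using sc by (auto simp: schemas_def)
    have *: "U (KC j a) 0 i \<longleftrightarrow> word_cells (if j = 1 then y else []) (int i - int (T + 1)) = a" for a
      unfolding U c_def using cell_init[of j M "T + 1" x y i] j by simp
    show ?thesis
    proof (cases "j = 1 \<and> T + 1 \<le> i \<and> i < T + 1 + p")
      case True
      have "word_cells y z = 0 \<or> word_cells y z = 1 \<or> word_cells y z = 2" for z by (simp add: word_cells_def)
      then show ?thesis using Rest True * by (auto simp: models_def)
    next
      case False
      then have "word_cells (if j = 1 then y else []) (int i - int (T + 1)) = 0"
        using y j by (auto simp: word_cells_def)
      then show ?thesis using Rest False * by (auto simp: models_def)
    qed
  next
    case (Tail b)
    then have b: "b \<noteq> 0" using sc by (auto simp: schemas_def)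
    have *: "U (KC 1 a) 0 i \<longleftrightarrow> word_cells y (int i - int (T + 1)) = a" for a i
      unfolding U c_def using cell_init[of 1 M "T + 1" x y i] M(2) by simp
    have "\<not> U (KC 1 b) 0 (Suc i)" if "T + 1 \<le> i" "U (KC 1 0) 0 i"
      using that b unfolding * by (auto simp: word_cells_def split: if_splits)
    then show ?thesis using Tail by (auto simp: models_def)
  next
    case (Final q)
    have "\<not> U (KE q []) T 0" using sc Final acc by (auto simp: U c_def schemas_def)
    then show ?thesis using Final by (auto simp: models_def)
  qed
  then show ?thesis by blast
qed

text \<open>\<open>U\<close> may contain more facts than a single run has. The step clauses are
  forward implications, so all facts of the run on the guessed \<open>y\<close> that matter lie in
  \<open>U\<close>; if that run did not accept, the clause \<open>Final\<close> for its last state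
  would be violated.\<close>

lemma tableau_sound:
  assumes M: "wf_tm M" "ntapes M \<ge> 2" and T: "1 \<le> T" "p \<le> T"
    and U: "\<And>sc t i. sc \<in> schemas M \<Longrightarrow> t < T \<Longrightarrow> i < 2 * T + 3 \<Longrightarrow> models U (clause M x p T sc t i)"
  shows "\<exists>y. length y \<le> p \<and> fst (run M [x, y] T) = accept M"
proof -
  have nsyms: "3 \<le> nsyms M" using M(1) by (simp add: wf_tm_def)
  define l where "l = (LEAST i. i = p \<or> U (KC 1 0) 0 (T + 1 + i))"
  define y where "y = map (\<lambda>i. U (KC 1 2) 0 (T + 1 + i)) [0..<l]"
  have lp: "l \<le> p" unfolding l_def by (rule Least_le) simp
  have l1: "l = p \<or> U (KC 1 0) 0 (T + 1 + l)" unfolding l_def by (rule LeastI[of _ p]) simp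
  have l2: "\<not> U (KC 1 0) 0 (T + 1 + i)" if "i < l" for i
    using not_less_Least[OF that[unfolded l_def]] by blast
  have guess: "U (KC 1 0) 0 (T + 1 + i) \<or> U (KC 1 1) 0 (T + 1 + i) \<or> U (KC 1 2) 0 (T + 1 + i)" if "i < p" for i
    using U[of "Rest 1" 0 "T + 1 + i"] that T M(2) by (auto simp: schemas_def models_def)
  have tail: "U (KC 1 0) 0 (T + 1 + (l + d))" if "l + d < p" for d
    using that
  proof (induction d)
    case 0
    then show ?case using l1 by simp
  next
    case (Suc d)
    then have "U (KC 1 0) 0 (T + 1 + (l + d))" by simp
    then have "\<not> U (KC 1 1) 0 (T + 1 + (l + Suc d))" "\<not> U (KC 1 2) 0 (T + 1 + (l + Suc d))"
      using U[of "Tail 1" 0 "T + 1 + (l + d)"] U[of "Tail 2" 0 "T + 1 + (l + d)"] Suc.prems T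
      by (auto simp: schemas_def models_def)
    then show ?case using guess[OF Suc.prems] by blast
  qed
  have ly: "length y = l" by (simp add: y_def)
  have init: "U (KC j (cell (T + 1) (run M [x, y] 0) j i)) 0 i" if j: "j < ntapes M" and i: "i < 2 * T + 3" for j i
  proof -
    consider "j = 0" | "j = 1" "T + 1 \<le> i" "i < T + 1 + l" | "j = 1" "T + 1 + l \<le> i" "i < T + 1 + p"
      | "1 \<le> j" "\<not> (j = 1 \<and> T + 1 \<le> i \<and> i < T + 1 + p)" by linarith
    then show ?thesis
    proof cases
      case 1
      have "word_cells x (int i - int (T + 1)) < 3" by (simp add: word_cells_def)
      then show ?thesis using U[of "Inp (word_cells x (int i - int (T + 1)))" 0 i] T i 1 M(2)
        by (simp add: cell_init schemas_def models_def)
    next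
      case 2
      define d where "d = i - (T + 1)"
      have d: "i = T + 1 + d" "d < l" using 2 by (simp_all add: d_def)
      have "word_cells y (int i - int (T + 1)) = (if U (KC 1 2) 0 i then 2 else 1)"
        using d by (simp add: word_cells_def ly) (simp add: y_def)
      moreover have "U (KC 1 1) 0 i \<or> U (KC 1 2) 0 i" using l2[OF d(2)] guess[of d] d lp by auto
      ultimately show ?thesis using 2 M(2) by (auto simp: cell_init)
    next
      case 3
      have "word_cells y (int i - int (T + 1)) = 0" using 3 by (simp add: word_cells_def ly)
      moreover have "U (KC 1 0) 0 i" using tail[of "i - (T + 1) - l"] 3 by simp
      ultimately show ?thesis using 3 M(2) by (simp add: cell_init)
    next
      case 4
      have "word_cells (if j = 1 then y else []) (int i - int (T + 1)) = 0"
        using 4 lp by (auto simp: word_cells_def ly)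
      then show ?thesis using U[of "Rest j" 0 i] 4 T i j by (auto simp: cell_init schemas_def models_def)
    qed
  qed
  define c where "c = run M [x, y]"
  have proper: "proper M (c t)" for t unfolding c_def using proper_run[OF M(1)] .
  have len: "length (scanned (c t)) = ntapes M" "length (snd (c t)) = ntapes M" "fst (c t) < nstates M"
    "set (scanned (c t)) \<subseteq> {..<nsyms M}" "symbols M (scanned (c t))" for t
    using scanned_symbols[OF proper] proper by (simp_all add: symbols_def proper_def)
  have cSuc: "c (Suc t) = step M (c t)" for t by (simp add: c_def run_Suc)
  have cell_less: "cell W (c t) j i < nsyms M" if "j < ntapes M" for W t j i
    using proper[of t] that by (simp add: proper_def cell_def)
  \<comment> \<open>Nothing is known about cells entering at the border of the window, so the
    reliable range loses one position on each side per step. At time \<open>T\<close> only the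
    scanned cell \<open>T + 1\<close> is left.\<close>
  have main: "U (KE (fst (c t)) []) t 0 \<and>
      (\<forall>j < ntapes M. \<forall>i. t < i \<and> i + t < 2 * T + 2 \<longrightarrow> U (KC j (cell (T + 1) (c t) j i)) t i)" if "t \<le> T" for t
    using that
  proof (induction t)
    case 0
    have "U (KE (start M) []) 0 0" using U[of Start 0 0] T by (simp add: schemas_def models_def)
    then show ?case using init by (simp add: c_def run_def init_config_def)
  next
    case (Suc t)
    then have t: "t < T" by simp
    have E0: "U (KE (fst (c t)) []) t 0" and
      C: "\<And>j i. j < ntapes M \<Longrightarrow> t < i \<Longrightarrow> i + t < 2 * T + 2 \<Longrightarrow> U (KC j (cell (T + 1) (c t) j i)) t i"
      using Suc by auto
    have "U (KE (fst (c t)) (take n (scanned (c t)))) t 0" if "n \<le> ntapes M" for n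
      using that
    proof (induction n)
      case 0
      then show ?case using E0 by simp
    next
      case (Suc n)
      have "set (take n (scanned (c t))) \<subseteq> {..<nsyms M}" using len(4) set_take_subset by (rule subset_trans[rotated])
      moreover have "scanned (c t) ! n < nsyms M" using len(1,4)[of t] Suc.prems by (metis Suc_le_lessD lessThan_iff nth_mem subsetD)
      ultimately have "Scan (fst (c t)) (take n (scanned (c t))) (scanned (c t) ! n) \<in> schemas M"
        using len Suc.prems by (simp add: schemas_def)
      from U[OF this t, of 0] show ?case
        using Suc C[of n "T + 1"] t len[of t] by (simp add: models_def cell_scanned take_Suc_conv_app_nth)
    qed
    from this[of "ntapes M"] have E: "U (KE (fst (c t)) (scanned (c t))) t 0" using len by simp
    have "U (KE (fst (c (Suc t))) []) (Suc t) 0"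
      using U[of "Next (fst (c t)) (scanned (c t))" t 0] E len t
      by (simp add: schemas_def models_def cSuc step_trans)
    moreover have "U (KC j (cell (T + 1) (c (Suc t)) j i)) (Suc t) i"
      if j: "j < ntapes M" and i: "Suc t < i" "i + Suc t < 2 * T + 2" for j i
    proof -
      obtain a m where am: "(a, m) = snd (trans M (fst c') (scanned c')) ! j" if "c' = c t" for c'
        by (metis surj_pair)
      note am = am[OF refl]
      \<comment> \<open>The position, before the step, of the cell that ends up at \<open>i\<close>.
        It differs from \<open>i\<close> by at most one and so lies in the wider range of time
        \<open>t\<close>.\<close>
      define i0 where "i0 = (case m of Left \<Rightarrow> i - 1 | Stay \<Rightarrow> i | Right \<Rightarrow> i + 1)"
      have i0: "shift m i0 = i" "t < i0" "i0 + t < 2 * T + 2" using i by (cases m; simp add: i0_def)+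
      have cell: "cell (T + 1) (c (Suc t)) j i = (if i0 = T + 1 then a else cell (T + 1) (c t) j i0)"
        using cell_step[OF M(1) proper j am, of i0 "T + 1"] i0 by (simp add: cSuc)
      show ?thesis
      proof (cases "i0 = T + 1")
        case True
        then show ?thesis using U[of "Head j (fst (c t)) (scanned (c t))" t 0] E len t j am[symmetric] cell i0(1)
          by (simp add: schemas_def models_def)
      next
        case False
        then show ?thesis
          using U[of "Push j (fst (c t)) (scanned (c t)) (cell (T + 1) (c t) j i0)" t i0] E C[OF j i0(2,3)] len t j
            am[symmetric] cell i0 cell_less[OF j]
          by (simp add: schemas_def models_def)
      qed
    qed
    ultimately show ?case by blast
  qed
  have "fst (c T) = accept M"
  proof (rule ccontr)
    assume "fst (c T) \<noteq> accept M"
    then show False using U[of "Final (fst (c T))" 0 0] main[of T] len(3)[of T] T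
      by (simp add: schemas_def models_def)
  qed
  then show ?thesis using ly lp by (auto simp: c_def)
qed

lemma clause_wf:
  assumes M: "wf_tm M" "ntapes M \<ge> 2" and sc: "sc \<in> schemas M" and "t < T" "i < 2 * T + 3"
  shows "length (clause M x p T sc t i) \<le> 3" "distinct (clause M x p T sc t i)"
    "\<And>b kd t' i'. (b, kd, t', i') \<in> set (clause M x p T sc t i) \<Longrightarrow> kd \<in> kinds M \<and> t' \<le> T \<and> i' < 2 * T + 3"
proof -
  have M3: "3 \<le> nsyms M" "start M < nstates M" using M by (simp_all add: wf_tm_def)
  have sh: "shift m i < 2 * T + 3" if "i < 2 * T + 2" for m i using that by (cases m) auto
  have st: "fst (trans M q as) < nstates M" "fst (snd (trans M q as) ! j) < nsyms M"
    if "q < nstates M" "symbols M as" "j < ntapes M" for q as j using trans_wf[OF M(1) that(1,2)] that(3) by auto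
  show "length (clause M x p T sc t i) \<le> 3" by (cases sc) auto
  show "distinct (clause M x p T sc t i)" by (cases sc) auto
  show "kd \<in> kinds M \<and> t' \<le> T \<and> i' < 2 * T + 3" if "(b, kd, t', i') \<in> set (clause M x p T sc t i)" for b kd t' i'
    using that sc assms(4,5) M3 M(2) sh[of i] sh[of "T + 1"] st[where j = 0]
    by (cases sc) (auto simp: schemas_def kinds_def symbols_def st split: if_splits)
qed

section \<open>The reduction\<close>

fun of_bits :: "bool list \<Rightarrow> nat" where
  "of_bits [] = 0"
| "of_bits (b # bs) = of_bool b + 2 * of_bits bs"

text \<open>The least significant digit comes first, so a last digit \<open>True\<close> excludes
  leading zeros.\<close>

lemma binary_of_bits: "bs \<noteq> [] \<Longrightarrow> last bs \<Longrightarrow> binary (of_bits bs) = bs \<and> of_bits bs > 0"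
proof (induction bs)
  case (Cons b bs)
  show ?case
  proof (cases "bs = []")
    case True
    then show ?thesis using Cons.prems binary.simps[of 1] binary_0 by simp
  next
    case False
    then have IH: "binary (of_bits bs) = bs" "of_bits bs > 0" using Cons by auto
    have "odd (of_bits (b # bs)) = b" "of_bits (b # bs) div 2 = of_bits bs" by simp_all
    then show ?thesis using IH binary.simps[of "of_bits (b # bs)"] by simp
  qed
qed simp

text \<open>Three unary fields, each closed by \<open>True\<close>. The value is exponential in the
  components, but the length is only their sum plus 3, and loops can print the digits without
  arithmetic. The final \<open>True\<close> makes the word a numeral without leading zeros.\<close>

definition name_bits :: "colour \<Rightarrow> bool list" where
  "name_bits = (\<lambda>(t, a, b). replicate t False @ True # replicate a False @ True # replicate b False @ [True])"

definition name :: "colour \<Rightarrow> nat" where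
  "name c = of_bits (name_bits c)"

lemma binary_name: "binary (name c) = name_bits c" "name c \<ge> 1"
  using binary_of_bits[of "name_bits c"] by (auto simp: name_def name_bits_def split: prod.split)

lemma name_bits_inj: "name_bits c = name_bits c' \<Longrightarrow> c = c'"
proof -
  have *: "m = m' \<and> xs = xs'" if "replicate m False @ True # xs = replicate m' False @ True # xs'" for m m' xs xs'
  proof -
    have "replicate m False = replicate m' False \<and> xs = xs'"
      using that by (rule terminated_eq) simp_all
    then show ?thesis by (metis length_replicate)
  qed
  obtain t a b t' a' b' where c: "c = (t, a, b)" "c' = (t', a', b')" by (metis surj_pair)
  assume e: "name_bits c = name_bits c'"
  have 1: "t = t' \<and> replicate a False @ True # replicate b False @ [True] = replicate a' False @ True # replicate b' False @ [True]"
    by (rule *) (use e in \<open>simp add: name_bits_def c\<close>)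
  have 2: "a = a' \<and> replicate b False @ [True] = replicate b' False @ [True]"
    by (rule *[OF 1[THEN conjunct2]])
  have "b = b'" using arg_cong[OF 2[THEN conjunct2], of length] by simp
  then show "c = c'" using 1 2 c by simp
qed

lemma name_inj: "inj name"
proof (rule injI)
  fix c c' assume "name c = name c'"
  then have "binary (name c) = binary (name c')" by simp
  then show "c = c'" unfolding binary_name by (rule name_bits_inj)
qed

text \<open>Literal colours have tags 2 and 3, so the padding colours with tags 4 and 5 are new. Two
  of them suffice because a clause that is listed is not empty.\<close>

lemma palette_wf:
  assumes "length (cl r) \<le> 3" "distinct (cl r)"
  shows "distinct (palette cl v r k s)" "length (palette cl v r k s) = 3"
proof -
  have d: "distinct (map (lit_colour r) (cl r) @ [(4, 0, r), (5, 0, r)])"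
  proof -
    have "inj (lit_colour r)" by (auto simp: inj_def lit_colour_def split: if_splits)
    then have "inj_on (lit_colour r) (set (cl r))" by (rule inj_on_subset) simp
    then have "distinct (map (lit_colour r) (cl r))" using assms(2) by (simp add: distinct_map)
    moreover have "fst (lit_colour r l) < 4" for l by (auto simp: lit_colour_def split: prod.split)
    then have "(a, b) \<notin> set (map (lit_colour r) (cl r))" if "4 \<le> a" for a b
      using that by (metis fst_conv imageE leD set_map)
    ultimately show ?thesis by simp
  qed
  show "distinct (palette cl v r k s)"
    using d by (auto simp: palette_def distinct_take simp del: take_append distinct_append)
  show "length (palette cl v r k s) = 3"
  proof -
    have "length (cl r) \<ge> 1" if "cl r \<noteq> []" using that by (cases "cl r") auto
    then show ?thesis using assms(1) by (auto simp: palette_def)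
  qed
qed

section \<open>The cocktail party graph and its lists\<close>

definition cocktail :: "nat \<Rightarrow> nat graph" where
  "cocktail n = ({..<n}, {{u, v} |u v. u < n \<and> v < n \<and> u div 2 \<noteq> v div 2})"

lemma cocktail_edge: "u < n \<Longrightarrow> v < n \<Longrightarrow> {u, v} \<in> edges (cocktail n) \<longleftrightarrow> u div 2 \<noteq> v div 2"
  by (auto simp: cocktail_def doubleton_eq_iff)

lemma cocktail_simple: "simple_graph (cocktail n)"
proof -
  have "card {u, v} = 2" if "u div 2 \<noteq> v div 2" for u v :: nat using that by (cases "u = v") auto
  then show ?thesis unfolding simple_graph_def by (auto simp: cocktail_def)
qed

lemma cocktail_near_complete: "near_complete (cocktail n)"
  unfolding near_complete_def
proof (intro ballI impI)
  fix u v w assume "u \<in> verts (cocktail n)" "v \<in> verts (cocktail n)" "w \<in> verts (cocktail n)"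
    and ne: "u \<noteq> v" "u \<noteq> w" "v \<noteq> w"
  then have "u < n" "v < n" "w < n" by (auto simp: cocktail_def)
  moreover have "u div 2 \<noteq> v div 2 \<or> u div 2 \<noteq> w div 2" 
  proof (rule ccontr)
    assume "\<not> (u div 2 \<noteq> v div 2 \<or> u div 2 \<noteq> w div 2)"
    then have "u mod 2 \<noteq> v mod 2" "u mod 2 \<noteq> w mod 2" "v mod 2 \<noteq> w mod 2"
      using ne by (metis div_mult_mod_eq)+
    moreover have "u mod 2 < 2" "v mod 2 < 2" "w mod 2 < 2" by simp_all
    ultimately show False by linarith
  qed
  ultimately show "{u, v} \<in> edges (cocktail n) \<or> {u, w} \<in> edges (cocktail n)" by (simp add: cocktail_edge)
qed

lemma mult_add_inj:
  assumes "a * m + b = a' * m + b'" "b < m" "b' < (m :: nat)"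
  shows "a = a'" "b = b'"
  using arg_cong[OF assms(1), of "\<lambda>z. z div m"] arg_cong[OF assms(1), of "\<lambda>z. z mod m"] assms(2,3)
  by simp_all

text \<open>The number 14 counts seven pairs of two vertices for each variable and clause. The
  quotient \<open>g div 2\<close> names the pair, matching the non-edges of \<open>cocktail\<close>,
  and the parity of \<open>g\<close> its member.\<close>

definition instance_lists :: "nat \<Rightarrow> (nat \<Rightarrow> lit list) \<Rightarrow> nat \<Rightarrow> nat list" where
  "instance_lists R cl g = map name (palette cl (g div 14 div R) (g div 14 mod R) (g div 2 mod 7) (odd g))"

theorem instance_iff_satisfiable:
  assumes N: "N \<ge> 1"
    and cl: "\<And>r. r < R \<Longrightarrow> length (cl r) \<le> 3 \<and> distinct (cl r)"
    and lits: "\<And>r b v. r < R \<Longrightarrow> (b, v) \<in> set (cl r) \<Longrightarrow> v < N"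
  shows "encoding (N * R * 14) (cocktail (N * R * 14)) (instance_lists R cl) \<in> hard_lang \<longleftrightarrow> satisfiable R cl"
proof -
  define n where "n = N * R * 14"
  have dec: "g div 14 div R < N" "g div 14 mod R < R" "g div 2 mod 7 < 7" if "g < n" for g
  proof -
    have 1: "g div 14 < N * R" using that by (simp add: n_def div_less_iff_less_mult)
    then have "R > 0" by (cases R) auto
    then show "g div 14 div R < N" "g div 14 mod R < R" using 1 by (simp_all add: div_less_iff_less_mult)
  qed simp
  have "encoding n (cocktail n) (instance_lists R cl) \<in> hard_lang \<longleftrightarrow>
    (\<exists>c. (\<forall>u < n. c u \<in> set (instance_lists R cl u)) \<and> (\<forall>u < n. \<forall>v < n. {u, v} \<in> edges (cocktail n) \<longrightarrow> c u \<noteq> c v))"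
  proof (rule encoding_in_hard_lang)
    show "distinct (instance_lists R cl u) \<and> length (instance_lists R cl u) = 3 \<and> set (instance_lists R cl u) \<subseteq> {1..}"
      if "u < n" for u
    proof -
      note w = palette_wf[of cl "u div 14 mod R"]
      have "inj_on name A" for A using name_inj by (rule inj_on_subset) simp
      then show ?thesis using w cl[OF dec(2)[OF that]] binary_name(2)
        by (auto simp: instance_lists_def distinct_map)
    qed
  qed (auto simp: cocktail_def cocktail_simple[unfolded cocktail_def] cocktail_near_complete[unfolded cocktail_def])
  also have "\<dots> \<longleftrightarrow> (\<exists>c. selection N R cl c)"
  proof
    assume "\<exists>c. (\<forall>u < n. c u \<in> set (instance_lists R cl u)) \<and> (\<forall>u < n. \<forall>v < n. {u, v} \<in> edges (cocktail n) \<longrightarrow> c u \<noteq> c v)"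
    then obtain c where c: "\<And>u. u < n \<Longrightarrow> c u \<in> set (instance_lists R cl u)"
      "\<And>u v. u < n \<Longrightarrow> v < n \<Longrightarrow> u div 2 \<noteq> v div 2 \<Longrightarrow> c u \<noteq> c v"
      using cocktail_edge by metis
    \<comment> \<open>The inverse of the decoding of vertex numbers in
      \<open>instance_lists\<close>.\<close>
    define G where "G v r k s = ((v * R + r) * 7 + k) * 2 + of_bool s" for v r k and s :: bool
    have G: "G v r k s < n" "G v r k s div 2 = (v * R + r) * 7 + k" "odd (G v r k s) = s"
      "G v r k s div 14 = v * R + r" if "v < N" "r < R" "k < 7" for v r k s
    proof -
      have "v * R + r < Suc v * R" using that by simp
      also have "\<dots> \<le> N * R" using that by (intro mult_le_mono1) simp
      finally have "Suc (v * R + r) \<le> N * R" by simp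
      then have "Suc (v * R + r) * 14 \<le> N * R * 14" by (rule mult_le_mono1)
      then show "G v r k s < n" using that by (cases s) (simp_all add: G_def n_def)
      show "G v r k s div 2 = (v * R + r) * 7 + k" "odd (G v r k s) = s" by (cases s; simp add: G_def)+
      then have "G v r k s div 2 div 7 = v * R + r" using that by simp
      then show "G v r k s div 14 = v * R + r" by (simp add: div_mult2_eq[symmetric])
    qed
    define d where "d = (\<lambda>(v, r, k) s. inv name (c (G v r k s)))"
    have name_d: "name (d (v, r, k) s) = c (G v r k s)" and d_in: "d (v, r, k) s \<in> set (palette cl v r k s)"
      if vrk: "v < N" "r < R" "k < 7" for v r k s
    proof -
      have "instance_lists R cl (G v r k s) = map name (palette cl v r k s)"
      proof -
        have "((v * R + r) * 7 + k) mod 7 = k" using vrk(3) by (simp only: mod_mult_self3 mod_less)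
        then show ?thesis unfolding instance_lists_def G[OF vrk] using vrk by (simp only:) simp
      qed
      then obtain e where e: "e \<in> set (palette cl v r k s)" "c (G v r k s) = name e"
        using c(1)[OF G(1)[OF vrk]] by (metis imageE set_map)
      then show "name (d (v, r, k) s) = c (G v r k s)" "d (v, r, k) s \<in> set (palette cl v r k s)"
        by (simp_all add: d_def inv_f_f[OF name_inj])
    qed
    have "d p s \<noteq> d q s'" if pq: "p \<in> {..<N} \<times> {..<R} \<times> {..<7}" "q \<in> {..<N} \<times> {..<R} \<times> {..<7}" "p \<noteq> q" for p q s s'
    proof -
      obtain v r k v' r' k' where e: "p = (v, r, k)" "q = (v', r', k')" by (metis surj_pair)
      then have b: "v < N" "r < R" "k < 7" "v' < N" "r' < R" "k' < 7" using pq by auto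
      have "(v * R + r) * 7 + k \<noteq> (v' * R + r') * 7 + k'"
      proof
        assume eq: "(v * R + r) * 7 + k = (v' * R + r') * 7 + k'"
        note 1 = mult_add_inj[OF eq b(3,6)]
        note 2 = mult_add_inj[OF 1(1) b(2,5)]
        show False using pq(3) e 1(2) 2 by simp
      qed
      then have "c (G v r k s) \<noteq> c (G v' r' k' s')" using b G by (intro c(2)) simp_all
      then show ?thesis using name_d b e by metis
    qed
    then show "\<exists>c. selection N R cl c" unfolding selection_def using d_in by (intro exI[of _ d]) simp
  next
    assume "\<exists>c. selection N R cl c"
    then obtain c where c: "selection N R cl c" by blast
    have mem: "c (v, r, k) s \<in> set (palette cl v r k s)" if "v < N" "r < R" "k < 7" for v r k s
      using c[unfolded selection_def, THEN conjunct1, rule_format] that by simp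
    have disj: "c (v, r, k) s \<noteq> c (v', r', k') s'"
      if "v < N" "r < R" "k < 7" "v' < N" "r' < R" "k' < 7" "(v, r, k) \<noteq> (v', r', k')" for v r k v' r' k' s s'
      using c[unfolded selection_def, THEN conjunct2, rule_format, of "(v, r, k)" "(v', r', k')"] that by simp
    define d where "d g = name (c (g div 14 div R, g div 14 mod R, g div 2 mod 7) (odd g))" for g
    have "d u \<in> set (instance_lists R cl u)" if "u < n" for u
      using mem dec[OF that] by (simp add: d_def instance_lists_def)
    moreover have "d u \<noteq> d v" if "u < n" "v < n" "{u, v} \<in> edges (cocktail n)" for u v
    proof -
      have ne: "u div 2 \<noteq> v div 2" using that by (simp add: cocktail_edge)
      have "(u div 14 div R, u div 14 mod R, u div 2 mod 7) \<noteq> (v div 14 div R, v div 14 mod R, v div 2 mod 7)"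
      proof
        assume "(u div 14 div R, u div 14 mod R, u div 2 mod 7) = (v div 14 div R, v div 14 mod R, v div 2 mod 7)"
        then have "u div 14 = v div 14" "u div 2 mod 7 = v div 2 mod 7" by (metis Pair_inject div_mult_mod_eq)+
        moreover have "g div 14 = g div 2 div 7" for g :: nat by (simp add: div_mult2_eq[symmetric])
        ultimately show False using ne by (metis div_mult_mod_eq)
      qed
      then show ?thesis unfolding d_def using disj dec[OF that(1)] dec[OF that(2)] name_inj by (simp add: inj_eq)
    qed
    ultimately show "\<exists>c. (\<forall>u < n. c u \<in> set (instance_lists R cl u)) \<and> (\<forall>u < n. \<forall>v < n. {u, v} \<in> edges (cocktail n) \<longrightarrow> c u \<noteq> c v)"
      by blast
  qed
  also have "\<dots> \<longleftrightarrow> satisfiable R cl"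
  proof
    assume "\<exists>c. selection N R cl c"
    then obtain c where "selection N R cl c" by blast
    then show "satisfiable R cl" using N by (rule selection_satisfiable) (rule lits)
  next
    assume "satisfiable R cl"
    then show "\<exists>c. selection N R cl c" by (rule satisfiable_selection) (simp add: cl)
  qed
  finally show ?thesis by (simp add: n_def)
qed

section \<open>Numbering the clauses and variables of the tableau\<close>

definition cnf :: "nat \<Rightarrow> nat \<Rightarrow> (kind \<Rightarrow> nat) \<Rightarrow> (schema \<Rightarrow> nat \<Rightarrow> nat \<Rightarrow> slit list) \<Rightarrow> schema list \<Rightarrow> nat \<Rightarrow> lit list" where
  "cnf P K idx cla scs r = (let k = r mod length scs; z = r div length scs in
     map (\<lambda>(b, kd, t, i). (b, (t * P + i) * K + idx kd)) (cla (scs ! k) (z div P) (z mod P)))"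

text \<open>The variable numbers form a mixed-radix code, injective for kinds in \<open>KS\<close>
  and positions below \<open>P\<close>. The hypothesis \<open>wf\<close> keeps all literals in that
  range, so a valuation \<open>U\<close> can be transported to a set of numbers.\<close>

lemma satisfiable_cnf:
  assumes idx: "inj_on idx KS" "idx ` KS \<subseteq> {..<K}" and P: "P \<ge> 1"
    and wf: "\<And>sc t i b kd t' i'. sc \<in> set scs \<Longrightarrow> t < T \<Longrightarrow> i < P \<Longrightarrow> (b, kd, t', i') \<in> set (cla sc t i) \<Longrightarrow> kd \<in> KS \<and> i' < P"
  shows "satisfiable (T * P * length scs) (cnf P K idx cla scs) \<longleftrightarrow>
    (\<exists>U. \<forall>sc \<in> set scs. \<forall>t < T. \<forall>i < P. models U (cla sc t i))"
proof
  define vn where "vn kd t i = (t * P + i) * K + idx kd" for kd t i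
  have vn_inj: "kd = kd' \<and> t = t' \<and> i = i'"
    if "kd \<in> KS" "kd' \<in> KS" "i < P" "i' < P" "vn kd t i = vn kd' t' i'" for kd kd' t t' i i'
  proof -
    have k: "idx kd < K" "idx kd' < K" using idx(2) that by auto
    from arg_cong[OF that(5), of "\<lambda>z. z mod K"] arg_cong[OF that(5), of "\<lambda>z. z div K"]
    have 1: "idx kd = idx kd'" and 2: "t * P + i = t' * P + i'" using k by (simp_all add: vn_def)
    from arg_cong[OF 2, of "\<lambda>z. z mod P"] arg_cong[OF 2, of "\<lambda>z. z div P"]
    have "i = i'" "t = t'" using that by simp_all
    then show ?thesis using 1 idx(1) that by (auto dest: inj_onD)
  qed
  have cnf: "cnf P K idx cla scs ((t * P + i) * length scs + k) = map (\<lambda>(b, kd, t, i). (b, vn kd t i)) (cla (scs ! k) t i)"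
    if "i < P" "k < length scs" for t i k
  proof -
    have "scs \<noteq> []" using that(2) by auto
    then show ?thesis using that by (simp add: cnf_def vn_def Let_def)
  qed
  {
    assume "satisfiable (T * P * length scs) (cnf P K idx cla scs)"
    then obtain S where S: "\<And>r. r < T * P * length scs \<Longrightarrow> cnf P K idx cla scs r \<noteq> [] \<Longrightarrow>
       \<exists>(b, v) \<in> set (cnf P K idx cla scs r). (v \<in> S) = b" unfolding satisfiable_def by blast
    have "models (\<lambda>kd t i. vn kd t i \<in> S) (cla sc t i)" if sc: "sc \<in> set scs" and ti: "t < T" "i < P" for sc t i
    proof -
      obtain k where k: "k < length scs" "scs ! k = sc" using sc by (auto simp: in_set_conv_nth)
      have "t * P + i < Suc t * P" using ti by simp
      also have "\<dots> \<le> T * P" using ti by (intro mult_le_mono1) simp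
      finally have "Suc (t * P + i) * length scs \<le> T * P * length scs" by (intro mult_le_mono1) simp
      then have r: "(t * P + i) * length scs + k < T * P * length scs" using k(1) by simp
      show ?thesis unfolding models_def
      proof
        assume "cla sc t i \<noteq> []"
        then have "\<exists>(b, v) \<in> set (map (\<lambda>(b, kd, t, i). (b, vn kd t i)) (cla sc t i)). (v \<in> S) = b"
          using S[OF r] unfolding cnf[OF ti(2) k(1), of t] k(2) by simp
        then show "\<exists>(b, kd, t, i) \<in> set (cla sc t i). (vn kd t i \<in> S) = b"
          unfolding set_map bex_simps by (auto split: prod.splits)
      qed
    qed
    then show "\<exists>U. \<forall>sc \<in> set scs. \<forall>t < T. \<forall>i < P. models U (cla sc t i)" by (intro exI) blast
  }
  {
    assume "\<exists>U. \<forall>sc \<in> set scs. \<forall>t < T. \<forall>i < P. models U (cla sc t i)"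
    then obtain U where U: "\<And>sc t i. sc \<in> set scs \<Longrightarrow> t < T \<Longrightarrow> i < P \<Longrightarrow> models U (cla sc t i)" by blast
    define S where "S = {vn kd t i |kd t i. kd \<in> KS \<and> i < P \<and> U kd t i}"
    have S: "vn kd t i \<in> S \<longleftrightarrow> U kd t i" if "kd \<in> KS" "i < P" for kd t i
      using that vn_inj[of kd _ i _ t] by (auto simp: S_def)
    have "\<exists>(b, v) \<in> set (cnf P K idx cla scs r). (v \<in> S) = b"
      if r: "r < T * P * length scs" and ne: "cnf P K idx cla scs r \<noteq> []" for r
    proof -
      define k z where "k = r mod length scs" and "z = r div length scs"
      define t i where "t = z div P" and "i = z mod P"
      have "length scs > 0" using r by (cases "length scs") auto
      then have k: "k < length scs" and "z < T * P" using r by (simp_all add: k_def z_def div_less_iff_less_mult)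
      then have t: "t < T" and i: "i < P" using P by (simp_all add: t_def i_def div_less_iff_less_mult)
      have c: "cnf P K idx cla scs r = map (\<lambda>(b, kd, t, i). (b, vn kd t i)) (cla (scs ! k) t i)"
        by (simp add: cnf_def vn_def k_def z_def t_def i_def Let_def)
      then obtain b kd t' i' where l: "(b, kd, t', i') \<in> set (cla (scs ! k) t i)" "U kd t' i' = b"
        using U[OF nth_mem[OF k] t i] ne by (auto simp: models_def)
      then have "(vn kd t' i' \<in> S) = b" using S wf[OF nth_mem[OF k] t i l(1)] by blast
      moreover have "(b, vn kd t' i') \<in> set (cnf P K idx cla scs r)" unfolding c using l(1) by force
      ultimately show ?thesis by blast
    qed
    then show "satisfiable (T * P * length scs) (cnf P K idx cla scs)"
      unfolding satisfiable_def by (intro exI) blast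
  }
qed

section \<open>Printing the instance\<close>

definition seqs :: "emission list \<Rightarrow> emission" where
  "seqs Ps = foldr Sq Ps Nop"

lemma emitted_seqs [simp]: "emitted z d \<rho> (seqs Ps) = concat (map (emitted z d \<rho>) Ps)"
  by (induction Ps) (simp_all add: seqs_def)

definition poly_expr :: "nat poly \<Rightarrow> expr" where
  "poly_expr p = foldr (\<lambda>c e. Add (C c) (Mul (V 0) e)) (coeffs p) (C 0)"

lemma val_poly_expr [simp]: "val \<rho> (poly_expr p) = poly p (\<rho> 0)"
proof -
  have "val \<rho> (foldr (\<lambda>c e. Add (C c) (Mul (V 0) e)) cs (C 0)) = horner_sum id (\<rho> 0) cs" for cs
    by (induction cs) simp_all
  then show ?thesis by (simp add: poly_expr_def poly_def)
qed

definition colour_code :: "colour list \<Rightarrow> bool list" where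
  "colour_code cs = code (concat (map (\<lambda>c. Comma # map Bit (binary (name c))) cs))"

type_synonym xcolour = "nat \<times> expr \<times> expr"

text \<open>The tag is a constant and is printed literally; the other two components are computed
  and printed in unary by one loop each, as \<open>name_bits\<close> prescribes.\<close>

definition xcol :: "xcolour \<Rightarrow> emission" where
  "xcol = (\<lambda>(t, a, b). seqs [outs [True, False], outs (code (map Bit (replicate t False @ [True]))),
     For a (outs [False, False]), outs [False, True], For b (outs [False, False]), outs [False, True]])"

definition val_colour :: "(nat \<Rightarrow> nat) \<Rightarrow> xcolour \<Rightarrow> colour" where
  "val_colour \<rho> = (\<lambda>(t, a, b). (t, val \<rho> a, val \<rho> b))"

definition xcols :: "xcolour list \<Rightarrow> emission" where
  "xcols cs = seqs (map xcol cs)"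

lemma emitted_xcols: "emitted z d \<rho> (xcols cs) = colour_code (map (val_colour \<rho>) cs)"
proof -
  have "concat (map (\<lambda>i. [False, False]) [0..<n]) = code (map Bit (replicate n False))" for n
    by (induction n) (simp_all add: replicate_append_same[symmetric])
  then have "emitted z d \<rho> (xcol c) = code (Comma # map Bit (binary (name (val_colour \<rho> c))))" for c
    by (simp add: xcol_def val_colour_def binary_name name_bits_def split: prod.split)
  then show ?thesis by (simp add: xcols_def colour_code_def code_concat comp_def)
qed

definition Truth where "Truth = NZ (C 1)"

text \<open>At depth 5, variables 0 and 1 are the input lengths, 2 is the number of a propositional
  variable, 3 the time and 4 the position of a clause.\<close>

fun alts :: "(nat \<Rightarrow> bool) \<Rightarrow> (nat \<Rightarrow> nat) \<Rightarrow> (form \<times> 'a list) list \<Rightarrow> 'a list" where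
  "alts z \<rho> [] = []"
| "alts z \<rho> ((g, ls) # gs) = (if holds z 5 \<rho> g then ls else alts z \<rho> gs)"

type_synonym xlit = "bool \<times> kind \<times> expr \<times> expr"

definition val_lit :: "(nat \<Rightarrow> nat) \<Rightarrow> xlit \<Rightarrow> slit" where
  "val_lit \<rho> = (\<lambda>(b, kd, t, i). (b, kd, val \<rho> t, val \<rho> i))"

locale reduction =
  fixes M :: tm and p q :: "nat poly" and idx :: "kind \<Rightarrow> nat" and scs :: "schema list"
begin

abbreviation "xT \<equiv> poly_expr q"
abbreviation "xmid \<equiv> Add xT (C 1)"
abbreviation "xP \<equiv> Add (Mul (C 2) xT) (C 3)"
abbreviation "K \<equiv> card (kinds M)"
abbreviation "xN \<equiv> Mul (Mul (Add xT (C 1)) xP) (C K)"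
abbreviation "xR \<equiv> Mul (Mul xT xP) (C (length scs))"
abbreviation "xn \<equiv> Mul (Mul xN xR) (C 14)"

definition Lt where "Lt a b = NZ (Sub b a)"

lemma holds_Lt [simp]: "holds z d \<rho> (Lt a b) \<longleftrightarrow> val \<rho> a < val \<rho> b" "holds z d \<rho> Truth"
  by (auto simp: Lt_def Truth_def)

fun xshift :: "move \<Rightarrow> expr \<Rightarrow> expr" where
  "xshift Left e = Add e (C 1)"
| "xshift Stay e = e"
| "xshift Right e = Sub e (C 1)"

lemma val_xshift [simp]: "val \<rho> (xshift m e) = shift m (val \<rho> e)"
  by (cases m) simp_all

text \<open>A schema is one of finitely many constants, so its symbols and the values of
  \<open>trans\<close> are worked out when the program is written down. What remains for run time is
  the input, the time \<open>V 3\<close> and the position \<open>V 4\<close>; the tests on them in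
  \<open>clause\<close> become guards.\<close>

primrec xclause :: "schema \<Rightarrow> (form \<times> xlit list) list" where
  "xclause (Push j st as a) =
     [(Conj (Lt (C 0) (V 4)) (Conj (Lt (V 4) (Add (Mul (C 2) xT) (C 2))) (Neg (Eq (V 4) xmid))),
       [(False, KE st as, V 3, C 0), (False, KC j a, V 3, V 4),
        (True, KC j a, Add (V 3) (C 1), xshift (snd (snd (trans M st as) ! j)) (V 4))])]"
| "xclause (Head j st as) =
     [(Truth, [(False, KE st as, V 3, C 0),
        (True, KC j (fst (snd (trans M st as) ! j)), Add (V 3) (C 1), xshift (snd (snd (trans M st as) ! j)) xmid)])]"
| "xclause (Next st as) = [(Truth, [(False, KE st as, V 3, C 0), (True, KE (fst (trans M st as)) [], Add (V 3) (C 1), C 0)])]"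
| "xclause (Scan st as a) =
     [(Truth, [(False, KE st as, V 3, C 0), (False, KC (length as) a, V 3, xmid), (True, KE st (as @ [a]), V 3, C 0)])]"
| "xclause Start = [(Truth, [(True, KE (start M) [], C 0, C 0)])]"
| "xclause (Inp a) =
     [(if a = 0 then Disj (Lt (V 4) xmid) (Le (Add xmid (V 0)) (V 4))
       else if a = 1 then Conj (Le xmid (V 4)) (Conj (Lt (V 4) (Add xmid (V 0))) (Neg (InputBit (Sub (V 4) xmid))))
       else if a = 2 then Conj (Le xmid (V 4)) (InputBit (Sub (V 4) xmid)) else Neg Truth, [(True, KC 0 a, C 0, V 4)])]"
| "xclause (Rest j) =
     [(if j = 1 then Conj (Le xmid (V 4)) (Lt (V 4) (Add xmid (poly_expr p))) else Neg Truth,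
       [(True, KC 1 0, C 0, V 4), (True, KC 1 1, C 0, V 4), (True, KC 1 2, C 0, V 4)]),
      (Truth, [(True, KC j 0, C 0, V 4)])]"
| "xclause (Tail b) =
     [(Conj (Le xmid (V 4)) (Lt (V 4) (Add (Mul (C 2) xT) (C 2))),
       [(False, KC 1 0, C 0, V 4), (False, KC 1 b, C 0, Add (V 4) (C 1))])]"
| "xclause (Final st) = [(Truth, [(False, KE st [], xT, C 0)])]"

lemma word_cells_cases:
  "word_cells x (int i - int m) = 0 \<longleftrightarrow> i < m \<or> m + length x \<le> i"
  "word_cells x (int i - int m) = Suc 0 \<longleftrightarrow> m \<le> i \<and> i < m + length x \<and> \<not> bit_at x (i - m)"
  "word_cells x (int i - int m) = 2 \<longleftrightarrow> m \<le> i \<and> bit_at x (i - m)"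
proof -
  have "nat (int i - int m) = i - m" by simp
  then show "word_cells x (int i - int m) = 0 \<longleftrightarrow> i < m \<or> m + length x \<le> i"
    "word_cells x (int i - int m) = Suc 0 \<longleftrightarrow> m \<le> i \<and> i < m + length x \<and> \<not> bit_at x (i - m)"
    "word_cells x (int i - int m) = 2 \<longleftrightarrow> m \<le> i \<and> bit_at x (i - m)"
    by (auto simp: word_cells_def bit_at_def)
qed

lemma xclause:
  assumes "sc \<in> schemas M" "\<rho> 0 = length x"
  shows "map (val_lit \<rho>) (alts (bit_at x) \<rho> (xclause sc)) =
    clause M x (poly p (length x)) (poly q (length x)) sc (\<rho> 3) (\<rho> 4)"
proof (cases sc)
  case (Inp a)
  then have "a = 0 \<or> a = 1 \<or> a = 2" using assms(1) by (auto simp: schemas_def)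
  then show ?thesis using Inp assms(2) word_cells_cases[where m = "poly q (length x) + 1"]
    by (elim disjE) (auto simp: val_lit_def)
qed (use assms(2) in \<open>auto simp: val_lit_def\<close>)

definition xvar :: "kind \<Rightarrow> expr \<Rightarrow> expr \<Rightarrow> expr" where
  "xvar kd t i = Add (Mul (Add (Mul t xP) i) (C K)) (C (idx kd))"

definition xclno :: "nat \<Rightarrow> expr" where
  "xclno k = Add (Mul (Add (Mul (V 3) xP) (V 4)) (C (length scs))) (C k)"

definition xlits :: "expr \<Rightarrow> xlit list \<Rightarrow> xcolour list" where
  "xlits r ls = take 3 (map (\<lambda>(b, kd, t, i). (if b then 3 else 2, xvar kd t i, r)) ls @ [(4, C 0, r), (5, C 0, r)])"

definition xfree :: "nat \<Rightarrow> expr \<Rightarrow> xcolour list" where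
  "xfree t r = [(t, V 2, r), (t + 1, V 2, r), (t + 2, V 2, r)]"

fun alt_emission :: "(form \<times> emission) list \<Rightarrow> emission \<Rightarrow> emission" where
  "alt_emission [] Q = Q"
| "alt_emission ((g, P) # gs) Q = Cond g P (alt_emission gs Q)"

definition palette_emission :: "nat \<Rightarrow> nat \<Rightarrow> bool \<Rightarrow> emission" where
  "palette_emission k m s = (let r = xclno k in
     if m < 2 then xcols [(m, V 2, r), if s then (2 + m, V 2, r) else (m, V 2, Add r (C 1)), (4, V 2, r)]
     else if m = 2 then Cond (NZ r) (xcols (xfree 7 r)) (xcols [(0, V 2, r), (1, V 2, r), (4, V 2, r)])
     else if m = 3 then Cond (NZ (V 2)) (xcols (xfree 10 r))
       (alt_emission (map (\<lambda>(g, ls). (g, xcols (xlits r ls))) (xclause (scs ! k))) (xcols (xfree 10 r)))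
     else xcols (xfree 4 r))"

text \<open>Since the alternatives are nonempty, \<open>[]\<close> can signal that no guard holds,
  in accordance with the meaning of an empty clause.\<close>

lemma emitted_alt_emission:
  "(\<And>g ls. (g, ls) \<in> set gs \<Longrightarrow> ls \<noteq> []) \<Longrightarrow>
   emitted z 5 \<rho> (alt_emission (map (\<lambda>(g, ls). (g, F ls)) gs) Q) =
     (if alts z \<rho> gs = [] then emitted z 5 \<rho> Q else emitted z 5 \<rho> (F (alts z \<rho> gs)))"
proof (induction gs)
  case (Cons g gs)
  obtain a ls where g: "g = (a, ls)" by force
  have "ls \<noteq> []" using Cons.prems[of a ls] g by simp
  moreover have "emitted z 5 \<rho> (alt_emission (map (\<lambda>(g, ls). (g, F ls)) gs) Q) =
     (if alts z \<rho> gs = [] then emitted z 5 \<rho> Q else emitted z 5 \<rho> (F (alts z \<rho> gs)))"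
    by (rule Cons.IH) (use Cons.prems in auto)
  ultimately show ?case using g by simp
qed simp

lemma xclause_nonempty: "(g, ls) \<in> set (xclause sc) \<Longrightarrow> ls \<noteq> []"
  by (cases sc) auto

abbreviation "tableau_cnf x \<equiv> cnf (2 * poly q (length x) + 3) K idx (clause M x (poly p (length x)) (poly q (length x))) scs"

lemma emitted_palette_emission:
  assumes \<rho>: "\<rho> 0 = length x" and i: "\<rho> 4 < 2 * poly q (length x) + 3" and k: "k < length scs"
    and scs: "set scs \<subseteq> schemas M" and m: "m < 7"
  shows "emitted (bit_at x) 5 \<rho> (palette_emission k m s) =
    colour_code (palette (tableau_cnf x) (\<rho> 2) (val \<rho> (xclno k)) m s)"
proof -
  let ?r = "val \<rho> (xclno k)"
  have r: "?r = (\<rho> 3 * (2 * poly q (length x) + 3) + \<rho> 4) * length scs + k" using \<rho> by (simp add: xclno_def)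
  have "scs \<noteq> []" using k by auto
  then have cl: "tableau_cnf x ?r = map (\<lambda>(b, kd, t, i). (b, (t * (2 * poly q (length x) + 3) + i) * K + idx kd))
      (clause M x (poly p (length x)) (poly q (length x)) (scs ! k) (\<rho> 3) (\<rho> 4))"
    unfolding cnf_def r using i k by (simp add: Let_def)
  have sck: "scs ! k \<in> schemas M" using k scs by auto
  define gs where "gs = xclause (scs ! k)"
  have alts: "tableau_cnf x ?r = map (\<lambda>(b, kd, t, i). (b, val \<rho> (xvar kd t i))) (alts (bit_at x) \<rho> gs)"
    unfolding cl xclause[where x = x and \<rho> = \<rho>, OF sck \<rho>, symmetric] gs_def
    using \<rho> by (simp add: val_lit_def xvar_def comp_def split_beta)
  have lits: "map (val_colour \<rho>) (xlits (xclno k) ls) =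
     take 3 (map (lit_colour ?r) (map (\<lambda>(b, kd, t, i). (b, val \<rho> (xvar kd t i))) ls) @ [(4, 0, ?r), (5, 0, ?r)])" for ls
    by (simp add: xlits_def val_colour_def lit_colour_def take_map[symmetric] comp_def split_beta)
  consider "m < 2" | "m = 2" | "m = 3" | "4 \<le> m" by linarith
  then show ?thesis
  proof cases
    case 1
    then show ?thesis by (simp add: palette_emission_def palette_def emitted_xcols val_colour_def Let_def del: emitted_seqs)
  next
    case 2
    then show ?thesis by (simp add: palette_emission_def palette_def emitted_xcols val_colour_def xfree_def Let_def del: emitted_seqs)
  next
    case 3
    have "emitted (bit_at x) 5 \<rho> (alt_emission (map (\<lambda>(g, ls). (g, xcols (xlits (xclno k) ls))) gs) (xcols (xfree 10 (xclno k)))) =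
      (if alts (bit_at x) \<rho> gs = [] then emitted (bit_at x) 5 \<rho> (xcols (xfree 10 (xclno k)))
       else emitted (bit_at x) 5 \<rho> (xcols (xlits (xclno k) (alts (bit_at x) \<rho> gs))))"
      by (rule emitted_alt_emission) (use xclause_nonempty gs_def in blast)
    moreover have "tableau_cnf x ?r = [] \<longleftrightarrow> alts (bit_at x) \<rho> gs = []" unfolding alts by simp
    moreover have "map (val_colour \<rho>) (xlits (xclno k) (alts (bit_at x) \<rho> gs)) =
        take 3 (map (lit_colour ?r) (tableau_cnf x ?r) @ [(4, 0, ?r), (5, 0, ?r)])"
      unfolding lits alts ..
    moreover have "map (val_colour \<rho>) (xfree 10 (xclno k)) = [(10, \<rho> 2, ?r), (11, \<rho> 2, ?r), (12, \<rho> 2, ?r)]"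
      by (simp add: xfree_def val_colour_def)
    moreover have "palette_emission k 3 s = Cond (NZ (V 2)) (xcols (xfree 10 (xclno k)))
       (alt_emission (map (\<lambda>(g, ls). (g, xcols (xlits (xclno k) ls))) gs) (xcols (xfree 10 (xclno k))))"
      by (simp add: palette_emission_def gs_def Let_def)
    ultimately show ?thesis using 3 by (simp only: palette_simps(3) emitted.simps holds.simps val.simps emitted_xcols) auto
  next
    case 4
    then show ?thesis by (simp add: palette_emission_def palette_def emitted_xcols val_colour_def xfree_def Let_def del: emitted_seqs)
  qed
qed

definition xpair :: "nat \<Rightarrow> nat \<Rightarrow> expr" where
  "xpair k m = Add (Mul (Add (Mul (V 2) xR) (xclno k)) (C 7)) (C m)"

text \<open>Expressions have no division. Instead of comparing halves, the row tests whether
  \<open>V 5\<close> is one of the two members \<open>2 * m\<close> and \<open>2 * m + 1\<close> of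
  the pair \<open>m\<close> of the vertex.\<close>

definition vertex_emission :: "nat \<Rightarrow> nat \<Rightarrow> emission" where
  "vertex_emission k s = (let m = s div 2; e = Mul (C 2) (xpair k m) in
     seqs [For xn (Cond (Conj (Neg (Eq (V 5) e)) (Neg (Eq (V 5) (Add e (C 1))))) (outs [False, True]) (outs [False, False])),
       palette_emission k m (odd s), outs [True, True]])"

text \<open>Loops run over variable, time and position; the schemas and the fourteen vertices are
  fixed in number and are unrolled. The order of nesting reproduces the numbering of the
  vertices.\<close>

definition red_emission :: emission where
  "red_emission = For xN (For xT (For xP (seqs (map (\<lambda>k. seqs (map (vertex_emission k) [0..<14])) [0..<length scs]))))"

definition image :: "bool list \<Rightarrow> bool list" where
  "image x = (let t = poly q (length x); P = 2 * t + 3; R = t * P * length scs; n = (t + 1) * P * K * R * 14 in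
     encoding n (cocktail n) (instance_lists R (tableau_cnf x)))"

lemma div_mod_mult_add:
  assumes "b < (m :: nat)"
  shows "(a * m + b) div m = a" "(a * m + b) mod m = b"
  using assms by simp_all

lemma emitted_vertex_emission:
  assumes \<rho>: "\<rho> 0 = length x" and scs: "set scs \<subseteq> schemas M"
    and b: "\<rho> 2 < (t + 1) * P * K" "\<rho> 3 < t" "\<rho> 4 < P" "k < length scs" "s < 14"
    and d: "t = poly q (length x)" "P = 2 * t + 3" "R = t * P * length scs" "n = (t + 1) * P * K * R * 14"
    and g: "g = (\<rho> 2 * R + ((\<rho> 3 * P + \<rho> 4) * length scs + k)) * 14 + s"
  shows "emitted (bit_at x) 5 \<rho> (vertex_emission k s) =
    code (vertex_letters n (cocktail n) (instance_lists R (tableau_cnf x) g) g)"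
proof -
  let ?r = "(\<rho> 3 * P + \<rho> 4) * length scs + k"
  have lt: "a * m + c < a' * m" if "a < a'" "c < m" for a a' c m :: nat
  proof -
    have "a * m + c < Suc a * m" using that by simp
    also have "\<dots> \<le> a' * m" using that by (intro mult_le_mono1) simp
    finally show ?thesis .
  qed
  have r: "?r < R" unfolding d(3) by (intro lt b)
  have gn: "g < n" unfolding g d(4) by (intro lt b r)
  have clno: "val \<rho> (xclno k) = ?r" using \<rho> d by (simp add: xclno_def)
  have g14: "g div 14 = \<rho> 2 * R + ?r" unfolding g by (rule div_mod_mult_add(1)[OF b(5)])
  have g14R: "g div 14 div R = \<rho> 2" "g div 14 mod R = ?r"
    unfolding g14 by (rule div_mod_mult_add[OF r])+
  have g2: "g div 2 = (\<rho> 2 * R + ?r) * 7 + s div 2" unfolding g by simp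
  have g7: "g div 2 mod 7 = s div 2" unfolding g2 by (rule div_mod_mult_add(2)) (use b(5) in simp)
  have go: "odd g = odd s" unfolding g by simp
  have pair: "val \<rho> (xpair k (s div 2)) = g div 2"
    unfolding g2 xpair_def using clno \<rho> d by simp
  have n: "val \<rho> xn = n" using \<rho> d by simp
  have pal: "emitted (bit_at x) 5 \<rho> (palette_emission k (s div 2) (odd s)) =
     code (concat (map (\<lambda>a. Comma # map Bit (binary a)) (instance_lists R (tableau_cnf x) g)))"
    unfolding instance_lists_def g14R g7 go
    using emitted_palette_emission[where x = x and \<rho> = \<rho>, OF \<rho> _ b(4) scs, of "s div 2" "odd s"] b(3,5) d clno by (simp add: colour_code_def comp_def)
  have row: "emitted (bit_at x) 5 \<rho> (For xn (Cond (Conj (Neg (Eq (V 5) (Mul (C 2) (xpair k (s div 2)))))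
      (Neg (Eq (V 5) (Add (Mul (C 2) (xpair k (s div 2))) (C 1))))) (outs [False, True]) (outs [False, False]))) =
    code (map (\<lambda>u. Bit ({g, u} \<in> edges (cocktail n))) [0..<n])"
  proof -
    have pair': "val (\<rho>(5 := u)) (xpair k (s div 2)) = g div 2" for u
      using pair by (simp add: xpair_def xclno_def)
    have "(u \<noteq> 2 * (g div 2) \<and> u \<noteq> 2 * (g div 2) + 1) = ({g, u} \<in> edges (cocktail n))" if "u < n" for u
    proof -
      have "u div 2 = m \<longleftrightarrow> u = 2 * m \<or> u = 2 * m + 1" for m by linarith
      then show ?thesis using cocktail_edge[OF gn that] by metis
    qed
    then have "(if u \<noteq> 2 * (g div 2) \<and> u \<noteq> 2 * (g div 2) + 1 then [False, True] else [False, False]) =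
       letter_code (Bit ({g, u} \<in> edges (cocktail n)))" if "u < n" for u using that by simp
    then have "map (\<lambda>u. if u \<noteq> 2 * (g div 2) \<and> u \<noteq> 2 * (g div 2) + 1 then [False, True] else [False, False]) [0..<n] =
       map letter_code (map (\<lambda>u. Bit ({g, u} \<in> edges (cocktail n))) [0..<n])"
      unfolding map_map comp_def by (intro map_cong) auto
    note m = this
    show ?thesis
      unfolding emitted.simps n unfolding holds.simps holds_derived val.simps pair' emitted_outs fun_upd_same m ..
  qed
  show ?thesis
    unfolding vertex_emission_def Let_def emitted_seqs list.map concat.simps pal row emitted_outs vertex_letters_def
    by simp
qed

lemma concat_map_mult:
  "concat (map f [0..<a * b]) = concat (map (\<lambda>i. concat (map (\<lambda>j. f (i * b + j)) [0..<b])) [0..<a])"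
proof (induction a)
  case (Suc a)
  have "[0..<Suc a * b] = [0..<a * b] @ map (\<lambda>j. a * b + j) [0..<b]"
    using upt_add_eq_append[of 0 "a * b" b] map_add_upt[of "a * b" b] by (simp add: add.commute)
  then show ?case using Suc by (simp add: comp_def)
qed simp

lemma emitted_red_emission:
  assumes scs: "set scs \<subseteq> schemas M"
  shows "emitted (bit_at x) 2 (init_env x []) red_emission = image x"
proof -
  define t P R n where d: "t = poly q (length x)" "P = 2 * t + 3" "R = t * P * length scs" "n = (t + 1) * P * K * R * 14"
  define N where "N = (t + 1) * P * K"
  define f where "f g = code (vertex_letters n (cocktail n) (instance_lists R (tableau_cnf x) g) g)" for g
  have vert: "emitted (bit_at x) 5 ((init_env x [])(2 := v, 3 := w, 4 := i)) (vertex_emission k s) =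
      f ((v * R + ((w * P + i) * length scs + k)) * 14 + s)"
    if "v < N" "w < t" "i < P" "k < length scs" "s < 14" for v w i k s
    unfolding f_def by (rule emitted_vertex_emission[OF _ scs _ _ _ that(4,5) d]) (use that in \<open>simp_all add: init_env_def N_def\<close>)
  have "image x = concat (map f [0..<N * (t * (P * (length scs * 14)))])"
  proof -
    have "n = N * (t * (P * (length scs * 14)))" unfolding d(4) d(3) N_def by (simp only: mult.assoc)
    then show ?thesis
      unfolding image_def Let_def encoding_def f_def d[symmetric] by simp
  qed
  \<comment> \<open>The range of all vertices has a length with five factors; splitting at each
    product gives the five nested ranges of the program.\<close>
  also have "\<dots> = concat (map (\<lambda>v. concat (map (\<lambda>w. concat (map (\<lambda>i. concat (map (\<lambda>k. concat (map (\<lambda>s.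
      f (v * (t * (P * (length scs * 14))) + (w * (P * (length scs * 14)) + (i * (length scs * 14) + (k * 14 + s))))) [0..<14]))
      [0..<length scs])) [0..<P])) [0..<t])) [0..<N])"
    unfolding concat_map_mult ..
  also have "\<dots> = concat (map (\<lambda>v. concat (map (\<lambda>w. concat (map (\<lambda>i. concat (map (\<lambda>k. concat (map (\<lambda>s.
      emitted (bit_at x) 5 ((init_env x [])(2 := v, 3 := w, 4 := i)) (vertex_emission k s)) [0..<14]))
      [0..<length scs])) [0..<P])) [0..<t])) [0..<N])"
  proof (intro arg_cong[of _ _ concat] map_cong refl)
    fix v w i k s assume "v \<in> set [0..<N]" "w \<in> set [0..<t]" "i \<in> set [0..<P]" "k \<in> set [0..<length scs]" "s \<in> set [0..<14]"
    then have b: "v < N" "w < t" "i < P" "k < length scs" "s < 14" by simp_all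
    have "v * (t * (P * (length scs * 14))) + (w * (P * (length scs * 14)) + (i * (length scs * 14) + (k * 14 + s))) =
      (v * R + ((w * P + i) * length scs + k)) * 14 + s" unfolding d(3) by (simp add: algebra_simps)
    note e = this
    show "f (v * (t * (P * (length scs * 14))) + (w * (P * (length scs * 14)) + (i * (length scs * 14) + (k * 14 + s)))) =
      emitted (bit_at x) 5 ((init_env x [])(2 := v, 3 := w, 4 := i)) (vertex_emission k s)"
      unfolding e by (rule vert[OF b, symmetric])
  qed
  also have "\<dots> = emitted (bit_at x) 2 (init_env x []) red_emission"
  proof -
    have "Suc 2 = 3" "Suc 3 = 4" "Suc 4 = (5 :: nat)" by simp_all
    moreover have "val (init_env x []) xN = N" "val ((init_env x [])(2 := v)) xT = t" "val ((init_env x [])(2 := v, 3 := w)) xP = P" for v w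
      by (simp_all add: init_env_def N_def d)
    ultimately show ?thesis
      unfolding red_emission_def emitted.simps by (simp only: emitted_seqs map_map comp_def)
  qed
  finally show ?thesis by simp
qed

end

section \<open>Reduction of an arbitrary problem in NP\<close>

theorem hard_lang_NP_hard: "NP_hard hard_lang"
  unfolding NP_hard_def
proof (intro allI impI)
  fix A assume "in_NP A"
  then obtain M p r where NP: "wf_tm M \<and> ntapes M \<ge> 2 \<and>
      (\<forall>x y. halted M (run M [x, y] (poly r (length x + length y)))) \<and>
      (\<forall>x. x \<in> A \<longleftrightarrow> (\<exists>y. length y \<le> poly p (length x) \<and> (\<exists>t. fst (run M [x, y] t) = accept M)))"
    unfolding in_NP_def by (elim exE)
  then have M: "wf_tm M" "ntapes M \<ge> 2" by simp_all
  note halts = NP[THEN conjunct2, THEN conjunct2, THEN conjunct1, rule_format]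
  note A = NP[THEN conjunct2, THEN conjunct2, THEN conjunct2, rule_format]
  \<comment> \<open>The composition bounds the running time for all admissible certificates; the
    summands \<open>p\<close> and 1 ensure \<open>pp \<le> T\<close> and \<open>1 \<le> T\<close>,
    as \<open>tableau_sound\<close> demands.\<close>
  define q where "q = pcompose r ([:0, 1:] + p) + p + [:1:]"
  obtain idx where idx: "bij_betw idx (kinds M) {..<card (kinds M)}"
    using finite_kinds ex_bij_betw_finite_nat by (metis atLeast0LessThan)
  obtain scs where scs: "set scs = schemas M" using finite_list[OF finite_schemas] by blast
  interpret reduction M p q idx scs .
  have "x \<in> A \<longleftrightarrow> image x \<in> hard_lang" for x
  proof -
    define T where "T = poly q (length x)"
    define pp where "pp = poly p (length x)"
    have T: "1 \<le> T" "pp \<le> T" by (simp_all add: T_def q_def pp_def)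
    have rT: "poly r (length x + length y) \<le> T" if "length y \<le> pp" for y :: "bool list"
    proof -
      have "poly r (length x + length y) \<le> poly r (length x + pp)" using that by (intro poly_nat_mono) simp
      then show ?thesis by (simp add: T_def q_def pp_def poly_pcompose)
    qed
    \<comment> \<open>On admissible certificates the machine has halted by time \<open>T\<close>, so
      acceptance at any time is acceptance at \<open>T\<close>.\<close>
    have acc: "(\<exists>t. fst (run M [x, y] t) = accept M) \<longleftrightarrow> fst (run M [x, y] T) = accept M" if "length y \<le> pp" for y
    proof
      assume "\<exists>t. fst (run M [x, y] t) = accept M"
      then obtain t where t: "fst (run M [x, y] t) = accept M" by blast
      have h: "halted M (run M [x, y] T)" unfolding run_halted[OF halts rT[OF that]] by (rule halts)
      have "halted M (run M [x, y] t)" using t by (simp add: halted_def)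
      have "run M [x, y] T = run M [x, y] t"
      proof (cases "t \<le> T")
        case True
        then show ?thesis by (rule run_halted[OF \<open>halted M (run M [x, y] t)\<close>])
      next
        case False
        then show ?thesis by (intro run_halted[OF h, symmetric]) simp
      qed
      then show "fst (run M [x, y] T) = accept M" using t by simp
    qed blast
    have "x \<in> A \<longleftrightarrow> (\<exists>y. length y \<le> pp \<and> fst (run M [x, y] T) = accept M)"
      unfolding A pp_def[symmetric] by (intro ex_cong1 conj_cong refl acc)
    also have "\<dots> \<longleftrightarrow> (\<exists>U. \<forall>sc \<in> set scs. \<forall>t < T. \<forall>i < 2 * T + 3. models U (clause M x pp T sc t i))"
    proof
      assume "\<exists>y. length y \<le> pp \<and> fst (run M [x, y] T) = accept M"
      then obtain y where "length y \<le> pp" "fst (run M [x, y] T) = accept M" by (elim exE conjE)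
      then show "\<exists>U. \<forall>sc \<in> set scs. \<forall>t < T. \<forall>i < 2 * T + 3. models U (clause M x pp T sc t i)"
        unfolding scs by (rule tableau_complete[OF M])
    next
      assume "\<exists>U. \<forall>sc \<in> set scs. \<forall>t < T. \<forall>i < 2 * T + 3. models U (clause M x pp T sc t i)"
      then obtain U where U: "\<forall>sc \<in> set scs. \<forall>t < T. \<forall>i < 2 * T + 3. models U (clause M x pp T sc t i)" ..
      show "\<exists>y. length y \<le> pp \<and> fst (run M [x, y] T) = accept M"
        by (rule tableau_sound[OF M T]) (rule U[unfolded scs, rule_format])
    qed
    also have "\<dots> \<longleftrightarrow> satisfiable (T * (2 * T + 3) * length scs) (cnf (2 * T + 3) K idx (clause M x pp T) scs)"
    proof (rule satisfiable_cnf[symmetric, where KS = "kinds M"])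
      show "inj_on idx (kinds M)" "idx ` kinds M \<subseteq> {..<K}" using idx by (simp_all add: bij_betw_def)
      show "kd \<in> kinds M \<and> i' < 2 * T + 3"
        if "sc \<in> set scs" "t < T" "i < 2 * T + 3" "(b, kd, t', i') \<in> set (clause M x pp T sc t i)" for sc t i b kd t' i'
        using clause_wf(3)[OF M _ that(2-4)] that(1) scs by simp
    qed simp
    also have "\<dots> \<longleftrightarrow> image x \<in> hard_lang"
    proof -
      let ?P = "2 * T + 3"
      have dec: "scs ! (r mod length scs) \<in> schemas M" "r div length scs div ?P < T" "r div length scs mod ?P < ?P"
        if "r < T * ?P * length scs" for r
      proof -
        have l: "length scs > 0" using that by (cases "length scs") auto
        then show "scs ! (r mod length scs) \<in> schemas M" unfolding scs[symmetric] by (intro nth_mem mod_less_divisor)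
        have "r div length scs < T * ?P" using that by (simp only: div_less_iff_less_mult[OF l])
        then show "r div length scs div ?P < T" by (subst div_less_iff_less_mult) simp_all
      qed simp
      have inj: "(t * ?P + i) * K + idx kd = (t' * ?P + i') * K + idx kd' \<longleftrightarrow> kd = kd' \<and> t = t' \<and> i = i'"
        if "kd \<in> kinds M" "kd' \<in> kinds M" "i < ?P" "i' < ?P" for kd kd' t t' i i'
      proof
        assume e: "(t * ?P + i) * K + idx kd = (t' * ?P + i') * K + idx kd'"
        have k: "idx kd < K" "idx kd' < K" using idx that by (auto simp: bij_betw_def)
        note 1 = mult_add_inj[OF e k]
        note 2 = mult_add_inj[OF 1(1) that(3,4)]
        show "kd = kd' \<and> t = t' \<and> i = i'"
          using 1(2) 2 idx that(1,2) by (auto simp: bij_betw_def dest: inj_onD)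
      qed simp
      \<comment> \<open>The literals of a tableau clause lie in the range where the numbering is
        injective, so they remain distinct and give distinct colours.\<close>
      have cl: "length (cnf ?P K idx (clause M x pp T) scs r) \<le> 3 \<and> distinct (cnf ?P K idx (clause M x pp T) scs r)"
        if "r < T * ?P * length scs" for r
      proof -
        note w = clause_wf[OF M dec(1)[OF that] dec(2,3)[OF that], where x = x and p = pp]
        have "inj_on (\<lambda>(b, kd, t, i). (b, (t * ?P + i) * K + idx kd))
          (set (clause M x pp T (scs ! (r mod length scs)) (r div length scs div ?P) (r div length scs mod ?P)))"
        proof (rule inj_onI)
          fix l l' assume l: "l \<in> set (clause M x pp T (scs ! (r mod length scs)) (r div length scs div ?P) (r div length scs mod ?P))"
            "l' \<in> set (clause M x pp T (scs ! (r mod length scs)) (r div length scs div ?P) (r div length scs mod ?P))"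
            and e: "(\<lambda>(b, kd, t, i). (b, (t * ?P + i) * K + idx kd)) l = (\<lambda>(b, kd, t, i). (b, (t * ?P + i) * K + idx kd)) l'"
          obtain b kd t i b' kd' t' i' where ll: "l = (b, kd, t, i)" "l' = (b', kd', t', i')" by (metis surj_pair)
          show "l = l'" using w(3)[OF l(1)[unfolded ll]] w(3)[OF l(2)[unfolded ll]] e inj[of kd kd' i i' t t'] by (simp add: ll)
        qed
        then show ?thesis using w(1,2) by (simp add: cnf_def Let_def distinct_map)
      qed
      have lits: "v < (T + 1) * ?P * K" if r: "r < T * ?P * length scs" and bv: "(b, v) \<in> set (cnf ?P K idx (clause M x pp T) scs r)" for r b v
      proof -
        note w = clause_wf(3)[OF M dec(1)[OF r] dec(2,3)[OF r], where x = x and p = pp]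
        obtain kd t i where l: "(b, kd, t, i) \<in> set (clause M x pp T (scs ! (r mod length scs)) (r div length scs div ?P) (r div length scs mod ?P))"
          "v = (t * ?P + i) * K + idx kd" using bv by (auto simp: cnf_def Let_def)
        have k: "idx kd < K" using w[OF l(1)] idx by (auto simp: bij_betw_def)
        have "t * ?P + i < Suc t * ?P" using w[OF l(1)] by simp
        also have "\<dots> \<le> (T + 1) * ?P" using w[OF l(1)] by (intro mult_le_mono1) simp
        finally have "Suc (t * ?P + i) * K \<le> (T + 1) * ?P * K" by (intro mult_le_mono1) simp
        then show ?thesis using k l(2) by simp
      qed
      \<comment> \<open>At least one variable must exist, because the pairs of the clauses are
        attached to variable 0.\<close>
      have "KE (start M) [] \<in> kinds M" using M by (auto simp: kinds_def wf_tm_def)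
      then have "K \<ge> 1" using finite_kinds by (metis One_nat_def Suc_leI card_gt_0_iff empty_iff)
      then have "(T + 1) * ?P * K \<ge> 1" by simp
      from instance_iff_satisfiable[OF this, of "T * ?P * length scs" "cnf ?P K idx (clause M x pp T) scs"] cl lits
      show ?thesis by (simp add: image_def Let_def T_def pp_def)
    qed
    finally show ?thesis .
  qed
  moreover have "polytime_computable image"
    using emission_polytime[of red_emission] emitted_red_emission scs by simp
  ultimately show "polytime_reducible A hard_lang"
    unfolding polytime_reducible_def by (intro exI[of _ image] conjI allI)
qed

theorem theorem8:
  "NP_complete
     (regular_list_colouring 3
        (\<lambda>G. free_of (copies 3 (path_graph 1)) G \<and>
             free_of (disjoint_union (path_graph 1) (path_graph 2)) G))"
  unfolding NP_complete_def using hard_lang_in_NP hard_lang_NP_hard by blast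

end
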